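(* Let $I$ be an ideal of a polynomial ring over a field $\mathsf k$ minimally generated by square-free monomials $m_1,\ldots,m_q$ such that $m_{i_1}\mid\operatorname{lcm}(m_{i_2},\ldots,m_{i_s})$, where $3\le s\le q$ and $i_1,\ldots,i_s$ are distinct integers between $1$ and $q$. Then $$\operatorname{pd}(I)\le q-2\quad\text{and}\quad \operatorname{pd}(I^2)\le\begin{cases}\binom q2-(q-s+2)&\text{if }q>s\\ \binom q2-1&\text{if }q=s.\end{cases}$$ Moreover, these bounds are sharp: for all integers $q\ge s\ge3$, both inequalities are equalities for the $\mathcal D$-extremal ideal $I=\mathcal E_{q,\mathcal D}$ with $\mathcal D=\{(1,\{2,\ldots,s\})\}$.
   Context: $\operatorname{pd}(I)$ denotes the projective dimension of $I$ (not of the quotient by $I$) as a module over the polynomial ring, i.e. the largest $i$ with $\beta_i(I)\neq0$. The $\mathcal D$-extremal ideal for $\mathcal D=\{(1,\{2,\ldots,s\})\}$: let $[q]=\{1,\dots,q\}$, $S_{[q]}=\mathsf k[y_C:\emptyset\ne C\subseteq[q]]$ and $Q(\mathcal D)=\{C\subseteq[q]: C\ne\emptyset,\ 1\notin C\text{ or }C\cap\{2,\ldots,s\}\neq\emptyset\}$. For $i\in[q]$ put $\epsilon_{\mathcal D,i}=\prod_{C\in Q(\mathcal D),\,i\in C}y_C$. Then $\mathcal E_{q,\mathcal D}=(\epsilon_{\mathcal D,1},\ldots,\epsilon_{\mathcal D,q})\subseteq S_{[q]}$; it is minimally generated by these $q$ square-free monomials and $\epsilon_{\mathcal D,1}\mid\operatorname{lcm}(\epsilon_{\mathcal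 D,2},\ldots,\epsilon_{\mathcal D,s})$. *)

theory Defs
  imports
    "HOL-Library.Poly_Mapping"
    "HOL-Library.Multiset"
    "HOL-Library.Extended_Nat"
    "HOL-Algebra.Ideal_Product"
    "Jordan_Normal_Form.Matrix_Kernel"
    "Jordan_Normal_Form.DL_Rank"
begin

text \<open>
  A monomial is the finite multiset of its variables, so that the exponent of \<open>x\<close> in \<open>a\<close> is
  \<^term>\<open>count a x\<close>, the product of monomials is \<open>+\<close>, divisibility is \<open>\<subseteq>#\<close>, and the least common
  multiple of a nonempty finite set of monomials is its supremum \<open>Sup\<close> with respect to \<open>\<subseteq>#\<close>.
  Polynomials are finitely supported maps from monomials to the field of coefficients; their
  product is the convolution product of \<^typ>\<open>'a \<Rightarrow>\<^sub>0 'b\<close>.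
\<close>

type_synonym ('x, 'k) mpoly = "'x multiset \<Rightarrow>\<^sub>0 'k"

definition poly_ring :: "'x set \<Rightarrow> ('x, 'k::field) mpoly ring" where
  "poly_ring V = \<lparr>carrier = {p. \<forall>a \<in> Poly_Mapping.keys p. set_mset a \<subseteq> V},
                  monoid.mult = (*), one = 1, zero = 0, add = (+)\<rparr>"

definition monomial :: "'x multiset \<Rightarrow> ('x, 'k::field) mpoly" where
  "monomial a = Poly_Mapping.single a 1"

definition squarefree_monomial :: "'x multiset \<Rightarrow> bool" where
  "squarefree_monomial a \<longleftrightarrow> (\<forall>x. count a x \<le> 1)"

definition minimally_generated_by ::
    "('r, 'z) ring_scheme \<Rightarrow> 'r set \<Rightarrow> nat \<Rightarrow> (nat \<Rightarrow> 'r) \<Rightarrow> bool" where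
  "minimally_generated_by R I q g \<longleftrightarrow>
     g ` {1..q} \<subseteq> carrier R \<and> Idl\<^bsub>R\<^esub> (g ` {1..q}) = I \<and>
     (\<forall>A. A \<subset> {1..q} \<longrightarrow> Idl\<^bsub>R\<^esub> (g ` A) \<noteq> I)"

lemma poly_ring_carrier_mult:
  fixes p q :: "('x, 'k::field) mpoly"
  assumes "p \<in> carrier (poly_ring V)" "q \<in> carrier (poly_ring V)"
  shows "p * q \<in> carrier (poly_ring V)"
proof -
  have "set_mset c \<subseteq> V" if "c \<in> Poly_Mapping.keys (p * q)" for c
  proof -
    from that keys_mult[of p q] obtain a b
      where "a \<in> Poly_Mapping.keys p" "b \<in> Poly_Mapping.keys q" "c = a + b" by blast
    with assms show ?thesis by (auto simp: poly_ring_def)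
  qed
  then show ?thesis by (simp add: poly_ring_def)
qed

lemma poly_ring_cring: "cring (poly_ring V :: ('x, 'k::field) mpoly ring)"
proof (rule cringI)
  show "abelian_group (poly_ring V :: ('x, 'k) mpoly ring)"
  proof (rule abelian_groupI)
    fix p :: "('x, 'k) mpoly" assume "p \<in> carrier (poly_ring V)"
    then have "- p \<in> carrier (poly_ring V)" "- p + p = 0"
      by (auto simp: poly_ring_def)
    then show "\<exists>y \<in> carrier (poly_ring V). y \<oplus>\<^bsub>poly_ring V\<^esub> p = \<zero>\<^bsub>poly_ring V\<^esub>"
      by (intro bexI[of _ "- p"]) (simp_all add: poly_ring_def)
  next
    fix p q :: "('x, 'k) mpoly"
    assume "p \<in> carrier (poly_ring V)" "q \<in> carrier (poly_ring V)"
    then show "p \<oplus>\<^bsub>poly_ring V\<^esub> q \<in> carrier (poly_ring V)"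
      using Poly_Mapping.keys_add[of p q] by (fastforce simp: poly_ring_def)
  qed (auto simp: poly_ring_def ac_simps)
  show "comm_monoid (poly_ring V :: ('x, 'k) mpoly ring)"
  proof (rule comm_monoidI)
    fix p q :: "('x, 'k) mpoly"
    assume "p \<in> carrier (poly_ring V)" "q \<in> carrier (poly_ring V)"
    then show "p \<otimes>\<^bsub>poly_ring V\<^esub> q \<in> carrier (poly_ring V)"
      using poly_ring_carrier_mult[of p V q] by (simp add: poly_ring_def)
  qed (auto simp: poly_ring_def ac_simps)
qed (auto simp: poly_ring_def distrib_right)


text \<open>
  Let \<open>S = poly_ring V\<close>. A resolution of an ideal \<open>I\<close> by finitely generated free \<open>S\<close>-modules,
  \<open>\<dots> \<rightarrow> F\<^sub>2 \<rightarrow> F\<^sub>1 \<rightarrow> F\<^sub>0 \<rightarrow> I \<rightarrow> 0\<close>, is given by the matrices of its maps. The rank of \<open>F\<^sub>i\<close> is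
  \<^term>\<open>dim_col (D i)\<close>; the row \<^term>\<open>D 0\<close> is the augmentation \<open>F\<^sub>0 \<rightarrow> I \<subseteq> S\<close>, and
  \<^term>\<open>D (Suc i)\<close> is the differential from \<open>F\<^sub>i\<^sub>+\<^sub>1\<close> to \<open>F\<^sub>i\<close>.
\<close>

definition free_module :: "'x set \<Rightarrow> nat \<Rightarrow> ('x, 'k::field) mpoly vec set" where
  "free_module V n = {v \<in> carrier_vec n. \<forall>j < n. v $ j \<in> carrier (poly_ring V)}"

definition free_resolution ::
    "'x set \<Rightarrow> ('x, 'k::field) mpoly set \<Rightarrow> (nat \<Rightarrow> ('x, 'k) mpoly mat) \<Rightarrow> bool" where
  "free_resolution V I D \<longleftrightarrow>
     dim_row (D 0) = 1 \<and>
     (\<forall>i. dim_row (D (Suc i)) = dim_col (D i)) \<and>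
     (\<forall>i. elements_mat (D i) \<subseteq> carrier (poly_ring V)) \<and>
     (\<lambda>v. (D 0 *\<^sub>v v) $ 0) ` free_module V (dim_col (D 0)) = I \<and>
     (\<forall>i. (\<lambda>v. D (Suc i) *\<^sub>v v) ` free_module V (dim_col (D (Suc i))) =
          mat_kernel (D i) \<inter> free_module V (dim_col (D i)))"

text \<open>
  The \<open>S\<close>-module \<open>k\<close> is \<open>S\<close> modulo the ideal generated by the variables, so applying
  \<open>\<otimes>\<^sub>S k\<close> to a map of free modules replaces each entry of its matrix by its constant term.
\<close>

definition tensor_k :: "('x, 'k::field) mpoly mat \<Rightarrow> 'k mat" where
  "tensor_k = map_mat (\<lambda>p. Poly_Mapping.lookup p {#})"

text \<open>
  The dimension over \<open>k\<close> of the \<open>i\<close>-th homology of \<open>F \<otimes>\<^sub>S k\<close>: cycles minus boundaries. The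
  augmentation is not part of the complex \<open>F\<close>, hence all of \<open>F\<^sub>0 \<otimes>\<^sub>S k\<close> consists of cycles.
\<close>

definition tor_dim :: "(nat \<Rightarrow> ('x, 'k::field) mpoly mat) \<Rightarrow> nat \<Rightarrow> nat" where
  "tor_dim D i =
     (if i = 0 then dim_col (D 0) else kernel_dim (tensor_k (D i)))
     - vec_space.rank (dim_col (D i)) (tensor_k (D (Suc i)))"

text \<open>
  The Betti number \<open>\<beta>\<^sub>i(I) = dim\<^sub>k Tor\<^sub>i\<^sup>S(I, k)\<close>. It does not depend on the resolution chosen; for
  homogeneous \<open>I\<close> it is the rank of the \<open>i\<close>-th module of the minimal free resolution.
\<close>

definition betti :: "'x set \<Rightarrow> ('x, 'k::field) mpoly set \<Rightarrow> nat \<Rightarrow> nat" where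
  "betti V I i = tor_dim (SOME D. free_resolution V I D) i"

text \<open>
  The largest \<open>i\<close> with \<open>\<beta>\<^sub>i(I) \<noteq> 0\<close>, which is \<open>\<infinity>\<close> if there are infinitely many.
\<close>

definition proj_dim :: "'x set \<Rightarrow> ('x, 'k::field) mpoly set \<Rightarrow> enat" where
  "proj_dim V I = (SUP i \<in> {i. betti V I i \<noteq> 0}. enat i)"


text \<open>The extremal ideal \<open>\<E>\<^bsub>q,D\<^esub>\<close> for \<open>D = {(1, {2,\<dots>,s})}\<close>; the variable \<open>y\<^sub>C\<close> is \<open>C\<close> itself.\<close>

definition extremal_vars :: "nat \<Rightarrow> nat set set" where
  "extremal_vars q = {C. C \<noteq> {} \<and> C \<subseteq> {1..q}}"

definition extremal_Q :: "nat \<Rightarrow> nat \<Rightarrow> nat set set" where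
  "extremal_Q q s = {C. C \<subseteq> {1..q} \<and> C \<noteq> {} \<and> (1 \<notin> C \<or> C \<inter> {2..s} \<noteq> {})}"

definition extremal_eps :: "nat \<Rightarrow> nat \<Rightarrow> nat \<Rightarrow> nat set multiset" where
  "extremal_eps q s i = mset_set {C \<in> extremal_Q q s. i \<in> C}"

definition extremal_ideal :: "nat \<Rightarrow> nat \<Rightarrow> (nat set, 'k::field) mpoly set" where
  "extremal_ideal q s =
     Idl\<^bsub>poly_ring (extremal_vars q)\<^esub> ((\<lambda>i. monomial (extremal_eps q s i)) ` {1..q})"

end

theory Submission
  imports Defs "HOL-Library.Product_Lexorder"
begin

text \<open>
  Two free resolutions of the same ideal are homotopy equivalent, and stay so modulo the variables,
  so a Betti number vanishes iff one resolution, reduced modulo the variables, is exact in that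
  place. For a monomial ideal we reduce the Taylor resolution: its basis elements are the sets
  \<open>\<sigma>\<close> of generators, and the boundary keeps exactly the facets with the same least common multiple.

  For the upper bounds, all sets of generators larger than the bound are cancelled in pairs
  \<open>\<sigma> - {f}\<close>, \<open>\<sigma> \<union> {f}\<close> with equal least common multiple. Two relations provide these pairs for
  \<open>I\<^sup>2\<close>: \<open>m\<^sub>i m\<^sub>j\<close> divides the least common multiple of \<open>m\<^sub>i\<^sup>2\<close> and \<open>m\<^sub>j m\<^sub>k\<close>; and if \<open>m\<^sub>p\<close> divides
  that of the \<open>m\<^sub>k\<close> with \<open>k \<in> K\<close>, then \<open>m\<^sub>p m\<^sub>j\<close> divides that of any set which contains
  \<open>m\<^sub>k m\<^sub>j\<close> or \<open>m\<^sub>p m\<^sub>k\<close> for every \<open>k \<in> K\<close>, and \<open>m\<^sub>k m\<^sub>j\<close> for at least one.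
  For the lower bounds, a single set of generators is a cycle of the reduced complex and not a boundary.
\<close>

section \<open>Polynomials\<close>

text \<open>A set of \<open>n + 1\<close> generators sits in homological degree \<open>n\<close>. So
  for the first bound only the full set of \<open>q\<close> generators has to disappear. For the
  square, a set that escapes the first relation either contains some \<open>m_i^2\<close>, and then
  only products with \<open>m_i\<close>, at most \<open>q\<close> of them, or it consists of
  products of distinct generators, at most \<open>q choose 2\<close>. Each of the
  \<open>q - s\<close> generators outside the given divisibility forces one missing product, and
  together they force one more. This leaves \<open>(q choose 2) - (q - s + 1)\<close> elements, and
  one less as a degree; if \<open>q = s\<close>, nothing is forced. The obstacle is that the
  pairings interfere: adding \<open>m_i m_j\<close> to a set can make another pairing applicable.
  All of them are put in one linear order, those through a square first, in which this happens only
  to sets that already belong to an earlier pairing. The Taylor complex is built on an indexed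
  family in which repeated and redundant generators are allowed, so all \<open>m_i m_j\<close> with
  \<open>i \<le> j\<close> can serve as generators without deciding which of them coincide.\<close>

lemma lookup_mult_empty:
  fixes p q :: "('x, 'k::field) mpoly"
  shows "Poly_Mapping.lookup (p * q) {#} = Poly_Mapping.lookup p {#} * Poly_Mapping.lookup q {#}"
proof -
  have 1: "Sum_any (\<lambda>b. Poly_Mapping.lookup q b when {#} = a + b)
      = (Poly_Mapping.lookup q {#} when a = {#})" for a :: "'x multiset"
  proof (cases "a = {#}")
    case True
    then have "(\<lambda>b. Poly_Mapping.lookup q b when {#} = a + b) = (\<lambda>b. Poly_Mapping.lookup q b when b = {#})"
      by (auto simp: when_def)
    with True show ?thesis by simp
  next
    case False
    then have "(\<lambda>b. Poly_Mapping.lookup q b when {#} = a + b) = (\<lambda>b. 0)"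
      by (auto simp: when_def)
    with False show ?thesis by simp
  qed
  then show ?thesis
    by (simp only: lookup_mult 1 mult_when Sum_any_when_equal)
qed

lemma lookup_single_mult:
  fixes p :: "('x, 'k::field) mpoly"
  shows "Poly_Mapping.lookup (Poly_Mapping.single a c * p) b =
    (if a \<subseteq># b then c * Poly_Mapping.lookup p (b - a) else 0)"
proof -
  have inner: "Sum_any (\<lambda>d. Poly_Mapping.lookup p d when b = a + d) =
      (if a \<subseteq># b then Poly_Mapping.lookup p (b - a) else 0)"
  proof (cases "a \<subseteq># b")
    case True
    then have "b = a + d \<longleftrightarrow> d = b - a" for d
      by (metis add_diff_cancel_left' subset_mset.add_diff_inverse)
    with True show ?thesis by simp
  next
    case False
    then have "b \<noteq> a + d" for d by (metis mset_subset_eq_add_left)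
    with False show ?thesis by simp
  qed
  have "Poly_Mapping.lookup (Poly_Mapping.single a c) l *
        Sum_any (\<lambda>d. Poly_Mapping.lookup p d when b = l + d) =
      (c * Sum_any (\<lambda>d. Poly_Mapping.lookup p d when b = a + d) when l = a)" for l
    by (cases "l = a") (auto simp: lookup_single when_def)
  then show ?thesis by (simp only: lookup_mult Sum_any_when_equal inner) simp
qed

lemma poly_ring_simps [simp]:
  "\<zero>\<^bsub>poly_ring V\<^esub> = 0" "\<one>\<^bsub>poly_ring V\<^esub> = 1"
  "p \<oplus>\<^bsub>poly_ring V\<^esub> q = p + q" "p \<otimes>\<^bsub>poly_ring V\<^esub> q = p * q"
  by (simp_all add: poly_ring_def)

lemma poly_ring_zero: "0 \<in> carrier (poly_ring V)"
  and poly_ring_one: "1 \<in> carrier (poly_ring V)"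
  by (auto simp: poly_ring_def)

lemma poly_ring_add:
  "p \<in> carrier (poly_ring V) \<Longrightarrow> q \<in> carrier (poly_ring V) \<Longrightarrow> p + q \<in> carrier (poly_ring V)"
  using Poly_Mapping.keys_add[of p q] by (fastforce simp: poly_ring_def)

lemma poly_ring_uminus: "p \<in> carrier (poly_ring V) \<Longrightarrow> - p \<in> carrier (poly_ring V)"
  by (auto simp: poly_ring_def)

lemma poly_ring_minus:
  "p \<in> carrier (poly_ring V) \<Longrightarrow> q \<in> carrier (poly_ring V) \<Longrightarrow> p - q \<in> carrier (poly_ring V)"
  using poly_ring_add[of p V "- q"] poly_ring_uminus[of q V] by simp

lemma poly_ring_sum:
  "(\<And>i. i \<in> A \<Longrightarrow> f i \<in> carrier (poly_ring V)) \<Longrightarrow> sum f A \<in> carrier (poly_ring V)"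
  by (induction A rule: infinite_finite_induct) (auto intro: poly_ring_zero poly_ring_add)

lemma poly_ring_single: "set_mset a \<subseteq> V \<Longrightarrow> Poly_Mapping.single a c \<in> carrier (poly_ring V)"
  by (auto simp: poly_ring_def)

lemma comm_ring_hom_const_term:
  "comm_ring_hom (\<lambda>p :: ('x, 'k::field) mpoly. Poly_Mapping.lookup p {#})"
  by unfold_locales (simp_all add: lookup_add lookup_mult_empty)

section \<open>Comparison of free resolutions\<close>

text \<open>The matrix type ranges over polynomials in all variables of its type; the condition on
  the entries keeps every lift inside \<open>poly_ring V\<close>, where the resolutions are
  exact.\<close>

definition poly_mats :: "'x set \<Rightarrow> nat \<Rightarrow> nat \<Rightarrow> ('x, 'k::field) mpoly mat set" where
  "poly_mats V r c =
     {M \<in> carrier_mat r c. \<forall>i < r. \<forall>j < c. M $$ (i, j) \<in> carrier (poly_ring V)}"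

lemma poly_mats_carrier: "M \<in> poly_mats V r c \<Longrightarrow> M \<in> carrier_mat r c"
  by (simp add: poly_mats_def)

lemma poly_mats_mult:
  assumes "M \<in> poly_mats V r n" "N \<in> poly_mats V n c"
  shows "M * N \<in> poly_mats V r c"
  using assms
  by (auto simp: poly_mats_def scalar_prod_def intro!: poly_ring_sum poly_ring_carrier_mult)

lemma poly_mats_minus:
  "M \<in> poly_mats V r c \<Longrightarrow> N \<in> poly_mats V r c \<Longrightarrow> M - N \<in> poly_mats V r c"
  by (auto simp: poly_mats_def intro!: poly_ring_minus)

lemma poly_mats_one: "1\<^sub>m n \<in> poly_mats V n n"
  by (auto simp: poly_mats_def poly_ring_zero poly_ring_one)

lemma poly_mats_col: "M \<in> poly_mats V r c \<Longrightarrow> j < c \<Longrightarrow> col M j \<in> free_module V r"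
  by (auto simp: poly_mats_def free_module_def)

text \<open>Rank of the target of \<open>D i\<close>, hence shifted by one against the homological
  degree: index 0 is the ring, the target of the augmentation, and index \<open>Suc i\<close> is the
  free module in degree \<open>i\<close>.\<close>

definition free_rank :: "(nat \<Rightarrow> ('x, 'k::field) mpoly mat) \<Rightarrow> nat \<Rightarrow> nat" where
  "free_rank D i = (case i of 0 \<Rightarrow> 1 | Suc j \<Rightarrow> dim_col (D j))"

lemma free_rank_0: "free_rank D 0 = 1"
  by (simp add: free_rank_def)

lemma free_rank_simps:
  assumes "free_resolution V I D"
  shows "dim_row (D i) = free_rank D i" "dim_col (D i) = free_rank D (Suc i)"
  using assms by (auto simp: free_rank_def free_resolution_def split: nat.split)

lemma free_resolution_mats:
  assumes "free_resolution V I D"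
  shows "D i \<in> poly_mats V (free_rank D i) (free_rank D (Suc i))"
  using assms elements_matI[OF carrier_matI, OF free_rank_simps[OF assms]]
  by (fastforce simp: poly_mats_def free_resolution_def free_rank_simps[OF assms] intro!: carrier_matI)

lemma mat_eq_colI:
  assumes "A \<in> carrier_mat r c" "B \<in> carrier_mat r c" "\<And>j. j < c \<Longrightarrow> col A j = col B j"
  shows "A = B"
  using assms by (intro mat_col_eqI) auto

lemma free_resolution_exact:
  assumes "free_resolution V I D"
  shows "(\<lambda>v. D (Suc i) *\<^sub>v v) ` free_module V (free_rank D (Suc (Suc i))) =
    mat_kernel (D i) \<inter> free_module V (free_rank D (Suc i))"
  using assms unfolding free_resolution_def by (simp add: free_rank_simps[OF assms])

lemma unit_vec_free_module: "j < n \<Longrightarrow> unit_vec n j \<in> free_module V n"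
  by (auto simp: free_module_def unit_vec_def poly_ring_zero poly_ring_one)

lemma mult_unit_vec:
  fixes A :: "'a::semiring_1 mat"
  assumes "A \<in> carrier_mat r c" "j < c"
  shows "A *\<^sub>v unit_vec c j = col A j"
  using assms by (auto intro!: eq_vecI simp: scalar_prod_right_unit[OF assms(2)])

lemma mult_mat_zero_vec:
  fixes A :: "'a::semiring_1 mat"
  assumes "A \<in> carrier_mat r c"
  shows "A *\<^sub>v 0\<^sub>v c = 0\<^sub>v r"
  using assms by (auto intro!: eq_vecI)

lemma free_resolution_zero:
  assumes D: "free_resolution V I D"
  shows "D i * D (Suc i) = 0\<^sub>m (free_rank D i) (free_rank D (Suc (Suc i)))"
proof (rule mat_eq_colI)
  note Dc = poly_mats_carrier[OF free_resolution_mats[OF D]]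
  show "D i * D (Suc i) \<in> carrier_mat (free_rank D i) (free_rank D (Suc (Suc i)))"
    using Dc Dc by (rule mult_carrier_mat)
  fix j assume j: "j < free_rank D (Suc (Suc i))"
  have "D (Suc i) *\<^sub>v unit_vec (free_rank D (Suc (Suc i))) j \<in> mat_kernel (D i)"
    using unit_vec_free_module[OF j] free_resolution_exact[OF D] by blast
  then have "D i *\<^sub>v col (D (Suc i)) j = 0\<^sub>v (free_rank D i)"
    by (simp add: mult_unit_vec[OF Dc j] mat_kernel_def free_rank_simps[OF D])
  then show "col (D i * D (Suc i)) j = col (0\<^sub>m (free_rank D i) (free_rank D (Suc (Suc i)))) j"
    using j by (simp add: col_mult2[OF Dc Dc j])
qed simp

lemma matrix_of_columns:
  assumes "\<And>j. j < c \<Longrightarrow> \<exists>v \<in> free_module V n. P j v"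
  shows "\<exists>B \<in> poly_mats V n c. \<forall>j < c. P j (col B j)"
proof -
  obtain v where v: "\<And>j. j < c \<Longrightarrow> v j \<in> free_module V n \<and> P j (v j)"
    using assms by metis
  define B where "B = mat n c (\<lambda>(i, j). v j $ i)"
  have "col B j = v j" if "j < c" for j
    using v[OF that] that by (auto simp: B_def free_module_def intro!: eq_vecI)
  moreover have "B \<in> poly_mats V n c"
    using v by (auto simp: B_def poly_mats_def free_module_def)
  ultimately show ?thesis using v by metis
qed

text \<open>The source is free, so exactness is applied to one column at a time: each column of
  \<open>A\<close> is a cycle, hence an image, and chosen preimages are the columns of
  \<open>B\<close>.\<close>

lemma free_resolution_lift:
  assumes D: "free_resolution V I D" and A: "A \<in> poly_mats V (free_rank D (Suc i)) c"
    and 0: "D i * A = 0\<^sub>m (free_rank D i) c"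
  shows "\<exists>B \<in> poly_mats V (free_rank D (Suc (Suc i))) c. D (Suc i) * B = A"
proof -
  note Dc = poly_mats_carrier[OF free_resolution_mats[OF D]]
  note Ac = poly_mats_carrier[OF A]
  have "\<exists>v \<in> free_module V (free_rank D (Suc (Suc i))). D (Suc i) *\<^sub>v v = col A j" if j: "j < c" for j
  proof -
    have "D i *\<^sub>v col A j = 0\<^sub>v (free_rank D i)"
      using j 0 col_mult2[OF Dc Ac j] by simp
    then have "col A j \<in> mat_kernel (D i) \<inter> free_module V (free_rank D (Suc i))"
      using poly_mats_col[OF A j] Ac
      by (auto simp: mat_kernel_def free_module_def free_rank_simps[OF D])
    then show ?thesis unfolding free_resolution_exact[OF D, symmetric] by auto
  qed
  then obtain B where B: "B \<in> poly_mats V (free_rank D (Suc (Suc i))) c"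
    and c: "\<And>j. j < c \<Longrightarrow> D (Suc i) *\<^sub>v col B j = col A j"
    using matrix_of_columns[of c V "free_rank D (Suc (Suc i))" "\<lambda>j v. D (Suc i) *\<^sub>v v = col A j"]
    by blast
  note Bc = poly_mats_carrier[OF B]
  have "D (Suc i) * B = A"
    by (rule mat_eq_colI[OF mult_carrier_mat[OF Dc Bc] Ac]) (simp add: col_mult2[OF Dc Bc] c)
  with B show ?thesis by blast
qed

text \<open>Here the lift goes through the common image: every entry of the row \<open>E 0\<close>
  lies in \<open>I\<close>, which is the image of \<open>D 0\<close>.\<close>

lemma free_resolution_lift_0:
  assumes D: "free_resolution V I D" and E: "free_resolution V I E"
  shows "\<exists>B \<in> poly_mats V (free_rank D (Suc 0)) (free_rank E (Suc 0)). D 0 * B = E 0"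
proof -
  have D0: "D 0 \<in> carrier_mat 1 (free_rank D (Suc 0))"
    and E0: "E 0 \<in> carrier_mat 1 (free_rank E (Suc 0))"
    using poly_mats_carrier[OF free_resolution_mats[OF D, of 0]]
      poly_mats_carrier[OF free_resolution_mats[OF E, of 0]] by (simp_all add: free_rank_0)
  have "\<exists>v \<in> free_module V (free_rank D (Suc 0)). D 0 *\<^sub>v v = col (E 0) j"
    if j: "j < free_rank E (Suc 0)" for j
  proof -
    have "(E 0 *\<^sub>v unit_vec (free_rank E (Suc 0)) j) $ 0 \<in> I"
      using E unit_vec_free_module[OF j, of V] free_rank_simps[OF E, of 0]
      unfolding free_resolution_def by auto
    then have "col (E 0) j $ 0 \<in> (\<lambda>v. (D 0 *\<^sub>v v) $ 0) ` free_module V (free_rank D (Suc 0))"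
      using D mult_unit_vec[OF E0 j] free_rank_simps[OF D, of 0] unfolding free_resolution_def by auto
    then obtain v where v: "v \<in> free_module V (free_rank D (Suc 0))" "(D 0 *\<^sub>v v) $ 0 = col (E 0) j $ 0"
      by auto
    have "D 0 *\<^sub>v v = col (E 0) j" using v(2) D0 E0 by (intro eq_vecI) auto
    with v(1) show ?thesis by blast
  qed
  then obtain B where B: "B \<in> poly_mats V (free_rank D (Suc 0)) (free_rank E (Suc 0))"
    and c: "\<And>j. j < free_rank E (Suc 0) \<Longrightarrow> D 0 *\<^sub>v col B j = col (E 0) j"
    using matrix_of_columns[of "free_rank E (Suc 0)" V "free_rank D (Suc 0)" "\<lambda>j v. D 0 *\<^sub>v v = col (E 0) j"]
    by blast
  note Bc = poly_mats_carrier[OF B]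
  have "D 0 * B = E 0"
    by (rule mat_eq_colI[OF mult_carrier_mat[OF D0 Bc] E0]) (simp add: col_mult2[OF D0 Bc] c)
  with B show ?thesis by blast
qed

lemma chain_map_exists:
  assumes D: "free_resolution V I D" and E: "free_resolution V I E"
  shows "\<exists>F. (\<forall>i. F i \<in> poly_mats V (free_rank D (Suc i)) (free_rank E (Suc i))) \<and> D 0 * F 0 = E 0 \<and>
    (\<forall>i. D (Suc i) * F (Suc i) = F i * E (Suc i))"
proof -
  note Dc = poly_mats_carrier[OF free_resolution_mats[OF D]]
  note Ec = poly_mats_carrier[OF free_resolution_mats[OF E]]
  \<comment> \<open>The last conjunct says that the columns of \<open>M * E (Suc i)\<close> are
    cycles. This is what the next lift requires, so it is carried along in the recursion.\<close>
  define P where "P i M \<longleftrightarrow> M \<in> poly_mats V (free_rank D (Suc i)) (free_rank E (Suc i)) \<and>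
    (i = 0 \<longrightarrow> D 0 * M = E 0) \<and>
    D i * (M * E (Suc i)) = 0\<^sub>m (free_rank D i) (free_rank E (Suc (Suc i)))" for i M
  have "\<exists>F. \<forall>i. P i (F i) \<and> D (Suc i) * F (Suc i) = F i * E (Suc i)"
  proof (rule dependent_nat_choice)
    obtain B where B: "B \<in> poly_mats V (free_rank D (Suc 0)) (free_rank E (Suc 0))" "D 0 * B = E 0"
      using free_resolution_lift_0[OF D E] by blast
    have "D 0 * (B * E (Suc 0)) = E 0 * E (Suc 0)"
      using assoc_mult_mat[OF Dc poly_mats_carrier[OF B(1)] Ec] B(2) by simp
    then have "P 0 B" using free_resolution_zero[OF E, of 0] B
      by (simp add: P_def free_rank_0)
    then show "\<exists>x. P 0 x" by blast
  next
    fix M i assume M: "P i M"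
    have Mc: "M \<in> carrier_mat (free_rank D (Suc i)) (free_rank E (Suc i))"
      using M by (auto simp: P_def dest: poly_mats_carrier)
    have "M * E (Suc i) \<in> poly_mats V (free_rank D (Suc i)) (free_rank E (Suc (Suc i)))"
      using M poly_mats_mult[OF _ free_resolution_mats[OF E]] by (auto simp: P_def)
    then obtain B where B: "B \<in> poly_mats V (free_rank D (Suc (Suc i))) (free_rank E (Suc (Suc i)))"
      "D (Suc i) * B = M * E (Suc i)"
      using M free_resolution_lift[OF D, of "M * E (Suc i)" i "free_rank E (Suc (Suc i))"]
      unfolding P_def by metis
    note Bc = poly_mats_carrier[OF B(1)]
    have "D (Suc i) * (B * E (Suc (Suc i))) = M * (E (Suc i) * E (Suc (Suc i)))"
      using assoc_mult_mat[OF Dc Bc Ec] assoc_mult_mat[OF Mc Ec Ec] B(2) by simp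
    also have "\<dots> = 0\<^sub>m (free_rank D (Suc i)) (free_rank E (Suc (Suc (Suc i))))"
      using Mc Ec[of "Suc i"] by (simp add: free_resolution_zero[OF E])
    finally have "P (Suc i) B" using B Dc[of "Suc i"] by (simp add: P_def)
    then show "\<exists>N. P (Suc i) N \<and> D (Suc i) * N = M * E (Suc i)" using B by blast
  qed
  then show ?thesis unfolding P_def by blast
qed

lemma homotopy_exists:
  assumes E: "free_resolution V I E"
    and F: "\<And>i. F i \<in> poly_mats V (free_rank E (Suc i)) (free_rank E (Suc i))" "E 0 * F 0 = E 0"
    and FS: "\<And>i. E (Suc i) * F (Suc i) = F i * E (Suc i)"
  shows "\<exists>H. (\<forall>i. H i \<in> poly_mats V (free_rank E (Suc (Suc i))) (free_rank E (Suc i))) \<and>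
    (\<forall>i. E (Suc (Suc i)) * H (Suc i) = F (Suc i) - 1\<^sub>m (free_rank E (Suc (Suc i))) - H i * E (Suc i))"
proof -
  note Ec = poly_mats_carrier[OF free_resolution_mats[OF E]]
  note Fc = poly_mats_carrier[OF F(1)]
  define P where "P i M \<longleftrightarrow> M \<in> poly_mats V (free_rank E (Suc (Suc i))) (free_rank E (Suc i)) \<and>
    E (Suc i) * (F (Suc i) - 1\<^sub>m (free_rank E (Suc (Suc i))) - M * E (Suc i)) =
      0\<^sub>m (free_rank E (Suc i)) (free_rank E (Suc (Suc i)))" for i M
  \<comment> \<open>The defect to be lifted next is a cycle: by \<open>FS\<close> and
    \<open>eq\<close> the product reduces to \<open>N * E (Suc i)\<close>. Here \<open>N\<close> is
    the previous homotopy followed by the differential, or 0 at the start.\<close>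
  have key: "E (Suc i) * (F (Suc i) - 1\<^sub>m (free_rank E (Suc (Suc i))) - M * E (Suc i)) =
      0\<^sub>m (free_rank E (Suc i)) (free_rank E (Suc (Suc i)))"
    if M: "M \<in> carrier_mat (free_rank E (Suc (Suc i))) (free_rank E (Suc i))"
      and N: "N \<in> carrier_mat (free_rank E (Suc i)) (free_rank E (Suc i))"
      and eq: "E (Suc i) * M = F i - 1\<^sub>m (free_rank E (Suc i)) - N"
      and NE: "N * E (Suc i) = 0\<^sub>m (free_rank E (Suc i)) (free_rank E (Suc (Suc i)))" for i M N
  proof -
    let ?n = "free_rank E (Suc i)" and ?m = "free_rank E (Suc (Suc i))"
    have "E (Suc i) * (F (Suc i) - 1\<^sub>m ?m - M * E (Suc i)) =
      E (Suc i) * (F (Suc i) - 1\<^sub>m ?m) - E (Suc i) * (M * E (Suc i))"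
      using M Ec[of "Suc i"] Fc by (intro mult_minus_distrib_mat[of _ ?n ?m _ ?m]) auto
    also have "E (Suc i) * (F (Suc i) - 1\<^sub>m ?m) = F i * E (Suc i) - E (Suc i)"
      using Ec[of "Suc i"] Fc[of "Suc i"] FS mult_minus_distrib_mat[of "E (Suc i)" ?n ?m "F (Suc i)" ?m "1\<^sub>m ?m"]
      by simp
    also have "E (Suc i) * (M * E (Suc i)) = (F i - 1\<^sub>m ?n - N) * E (Suc i)"
      using assoc_mult_mat[OF Ec M Ec] eq by simp
    also have "\<dots> = (F i - 1\<^sub>m ?n) * E (Suc i) - N * E (Suc i)"
      using N Ec[of "Suc i"] Fc by (intro minus_mult_distrib_mat[of _ ?n ?n]) auto
    also have "(F i - 1\<^sub>m ?n) * E (Suc i) = F i * E (Suc i) - E (Suc i)"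
      using Ec[of "Suc i"] Fc[of i] minus_mult_distrib_mat[of "F i" ?n ?n "1\<^sub>m ?n" "E (Suc i)"] by simp
    finally show ?thesis
      using Ec[of "Suc i"] Fc[of i] NE by (auto intro!: eq_matI)
  qed
  have "\<exists>H. \<forall>i. P i (H i) \<and>
      E (Suc (Suc i)) * H (Suc i) = F (Suc i) - 1\<^sub>m (free_rank E (Suc (Suc i))) - H i * E (Suc i)"
  proof (rule dependent_nat_choice)
    let ?n = "free_rank E (Suc 0)"
    note E0 = Ec[of 0]
    have "E 0 * (F 0 - 1\<^sub>m ?n) = 0\<^sub>m (free_rank E 0) ?n"
      using mult_minus_distrib_mat[OF E0 Fc one_carrier_mat] F(2) E0 by (auto intro!: eq_matI)
    moreover have "F 0 - 1\<^sub>m ?n \<in> poly_mats V ?n ?n"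
      using F(1) poly_mats_one poly_mats_minus by blast
    ultimately obtain B where B: "B \<in> poly_mats V (free_rank E (Suc (Suc 0))) ?n"
      "E (Suc 0) * B = F 0 - 1\<^sub>m ?n"
      using free_resolution_lift[OF E] by metis
    have "E (Suc 0) * B = F 0 - 1\<^sub>m ?n - 0\<^sub>m ?n ?n"
      unfolding B(2) using Fc[of 0] by (auto intro!: eq_matI)
    then have "P 0 B"
      using key[of B 0 "0\<^sub>m ?n ?n"] poly_mats_carrier[OF B(1)] B(1) Ec[of "Suc 0"] by (simp add: P_def)
    then show "\<exists>x. P 0 x" by blast
  next
    fix M i assume M: "P i M"
    let ?n = "free_rank E (Suc i)" and ?m = "free_rank E (Suc (Suc i))"
    let ?A = "F (Suc i) - 1\<^sub>m ?m - M * E (Suc i)"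
    have Mc: "M \<in> carrier_mat ?m ?n" using M by (auto simp: P_def dest: poly_mats_carrier)
    have ME: "M * E (Suc i) \<in> poly_mats V ?m ?m"
      using M poly_mats_mult[OF _ free_resolution_mats[OF E]] by (auto simp: P_def)
    then have "?A \<in> poly_mats V ?m ?m"
      using F(1) poly_mats_one poly_mats_minus by blast
    moreover have "E (Suc i) * ?A = 0\<^sub>m (free_rank E (Suc i)) ?m"
      using M Ec[of "Suc i"] by (simp add: P_def)
    ultimately obtain B where B: "B \<in> poly_mats V (free_rank E (Suc (Suc (Suc i)))) ?m"
      "E (Suc (Suc i)) * B = ?A"
      using free_resolution_lift[OF E] by metis
    have "M * E (Suc i) * E (Suc (Suc i)) = 0\<^sub>m ?m (free_rank E (Suc (Suc (Suc i))))"
      using assoc_mult_mat[OF Mc Ec Ec] Mc Ec[of "Suc i"] by (simp add: free_resolution_zero[OF E])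
    then have "P (Suc i) B"
      using key[OF poly_mats_carrier[OF B(1)] poly_mats_carrier[OF ME] B(2)] B(1)
      by (simp add: P_def)
    then show "\<exists>N. P (Suc i) N \<and> E (Suc (Suc i)) * N = ?A" using B by blast
  qed
  then show ?thesis unfolding P_def by blast
qed

section \<open>Exactness modulo the variables, and its independence of the resolution\<close>

definition exact_tensor :: "(nat \<Rightarrow> ('x, 'k::field) mpoly mat) \<Rightarrow> nat \<Rightarrow> bool" where
  "exact_tensor D i \<longleftrightarrow> (\<forall>v \<in> carrier_vec (free_rank D (Suc i)).
     tensor_k (D i) *\<^sub>v v = 0\<^sub>v (free_rank D i) \<longrightarrow>
     (\<exists>w \<in> carrier_vec (free_rank D (Suc (Suc i))). tensor_k (D (Suc i)) *\<^sub>v w = v))"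

lemma tensor_k_carrier: "M \<in> carrier_mat r c \<Longrightarrow> tensor_k M \<in> carrier_mat r c"
  by (simp add: tensor_k_def)

lemma tensor_k_mult:
  assumes "M \<in> carrier_mat r n" "N \<in> carrier_mat n c"
  shows "tensor_k (M * N) = tensor_k M * tensor_k N"
proof -
  interpret comm_ring_hom "\<lambda>p :: ('a, 'b) mpoly. Poly_Mapping.lookup p {#}"
    by (rule comm_ring_hom_const_term)
  show ?thesis unfolding tensor_k_def using assms by (rule mat_hom_mult)
qed

lemma tensor_k_minus:
  assumes "M \<in> carrier_mat r c" "N \<in> carrier_mat r c"
  shows "tensor_k (M - N) = tensor_k M - tensor_k N"
  using assms by (auto simp: tensor_k_def lookup_minus intro!: eq_matI)

lemma tensor_k_one: "tensor_k (1\<^sub>m n) = 1\<^sub>m n"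
  by (auto simp: tensor_k_def lookup_one intro!: eq_matI)

text \<open>A cycle \<open>z\<close> of \<open>E\<close> is carried to \<open>D\<close> by
  \<open>F\<close>, bounded there by some \<open>w\<close>, and \<open>w\<close> is carried back by
  \<open>G\<close>. This bounds \<open>G F z\<close>, which differs from \<open>z\<close> by the
  boundary of \<open>H z\<close>. So the homotopy is built on the side of \<open>E\<close> only,
  from \<open>G F\<close> to the identity.\<close>

lemma exact_tensor_transfer:
  assumes D: "free_resolution V I D" and E: "free_resolution V I E"
    and exact: "exact_tensor D (Suc i)"
  shows "exact_tensor E (Suc i)"
  unfolding exact_tensor_def
proof (intro ballI impI)
  let ?T = "tensor_k :: ('a, 'b) mpoly mat \<Rightarrow> 'b mat"
  let ?e = "\<lambda>i. free_rank E (Suc i)" and ?d = "\<lambda>i. free_rank D (Suc i)"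
  note Dc = poly_mats_carrier[OF free_resolution_mats[OF D]]
  note Ec = poly_mats_carrier[OF free_resolution_mats[OF E]]
  obtain F where F: "\<And>i. F i \<in> poly_mats V (free_rank D (Suc i)) (free_rank E (Suc i))" "D 0 * F 0 = E 0"
    "\<And>i. D (Suc i) * F (Suc i) = F i * E (Suc i)"
    using chain_map_exists[OF D E] by blast
  obtain G where G: "\<And>i. G i \<in> poly_mats V (free_rank E (Suc i)) (free_rank D (Suc i))" "E 0 * G 0 = D 0"
    "\<And>i. E (Suc i) * G (Suc i) = G i * D (Suc i)"
    using chain_map_exists[OF E D] by blast
  note Fc = poly_mats_carrier[OF F(1)] and Gc = poly_mats_carrier[OF G(1)]
  have E0: "E 0 \<in> carrier_mat 1 (?e 0)"
    using Ec[of 0] by (simp add: free_rank_0)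
  have "\<exists>H. (\<forall>i. H i \<in> poly_mats V (?e (Suc i)) (?e i)) \<and>
    (\<forall>i. E (Suc (Suc i)) * H (Suc i) = G (Suc i) * F (Suc i) - 1\<^sub>m (?e (Suc i)) - H i * E (Suc i))"
  proof (rule homotopy_exists[OF E, of "\<lambda>i. G i * F i"])
    show "G i * F i \<in> poly_mats V (?e i) (?e i)" for i
      using F(1) G(1) by (rule poly_mats_mult[rotated])
    show "E 0 * (G 0 * F 0) = E 0"
      using assoc_mult_mat[OF E0 Gc Fc] G(2) F(2) by simp
    show "E (Suc i) * (G (Suc i) * F (Suc i)) = G i * F i * E (Suc i)" for i
      using assoc_mult_mat[OF Ec Gc Fc] assoc_mult_mat[OF Gc Fc Ec] assoc_mult_mat[OF Gc Dc Fc]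
        F(3) G(3) by metis
  qed
  then obtain H where H: "\<And>i. H i \<in> poly_mats V (?e (Suc i)) (?e i)"
    "\<And>i. E (Suc (Suc i)) * H (Suc i) = G (Suc i) * F (Suc i) - 1\<^sub>m (?e (Suc i)) - H i * E (Suc i)"
    by blast
  note Hc = poly_mats_carrier[OF H(1)]
  note c = tensor_k_carrier[OF Dc] tensor_k_carrier[OF Ec] tensor_k_carrier[OF Fc]
    tensor_k_carrier[OF Gc] tensor_k_carrier[OF Hc]
  have TF: "?T (D (Suc i)) * ?T (F (Suc i)) = ?T (F i) * ?T (E (Suc i))" for i
    unfolding tensor_k_mult[OF Dc Fc, symmetric] tensor_k_mult[OF Fc Ec, symmetric] F(3) ..
  have TG: "?T (E (Suc i)) * ?T (G (Suc i)) = ?T (G i) * ?T (D (Suc i))" for i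
    unfolding tensor_k_mult[OF Ec Gc, symmetric] tensor_k_mult[OF Gc Dc, symmetric] G(3) ..
  fix z assume z: "z \<in> carrier_vec (?e (Suc i))"
    and "?T (E (Suc i)) *\<^sub>v z = 0\<^sub>v (free_rank E (Suc i))"
  then have Ez: "?T (E (Suc i)) *\<^sub>v z = 0\<^sub>v (?e i)" using Ec[of "Suc i"] by simp
  let ?y = "?T (F (Suc i)) *\<^sub>v z"
  have y: "?y \<in> carrier_vec (?d (Suc i))" using c(3) z by (rule mult_mat_vec_carrier)
  have "?T (D (Suc i)) *\<^sub>v ?y = ?T (F i) *\<^sub>v (?T (E (Suc i)) *\<^sub>v z)"
    using assoc_mult_mat_vec[OF c(1,3) z] assoc_mult_mat_vec[OF c(3,2) z] TF by metis
  also have "\<dots> = 0\<^sub>v (free_rank D (Suc i))" by (simp add: Ez mult_mat_zero_vec[OF c(3)])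
  finally obtain w where w: "w \<in> carrier_vec (?d (Suc (Suc i)))" "?T (D (Suc (Suc i))) *\<^sub>v w = ?y"
    using exact y by (auto simp: exact_tensor_def)
  let ?x = "?T (G (Suc (Suc i))) *\<^sub>v w" and ?h = "?T (H (Suc i)) *\<^sub>v z"
  have x: "?x \<in> carrier_vec (?e (Suc (Suc i)))" and h: "?h \<in> carrier_vec (?e (Suc (Suc i)))"
    using mult_mat_vec_carrier[OF c(4) w(1)] mult_mat_vec_carrier[OF c(5) z] by auto
  have 1: "?T (E (Suc (Suc i))) *\<^sub>v ?x = ?T (G (Suc i)) *\<^sub>v ?y"
    using assoc_mult_mat_vec[OF c(2,4) w(1)] assoc_mult_mat_vec[OF c(4,1) w(1)] TG w(2) by metis
  have "?T (E (Suc (Suc i))) * ?T (H (Suc i))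
      = ?T (G (Suc i)) * ?T (F (Suc i)) - 1\<^sub>m (?e (Suc i)) - ?T (H i) * ?T (E (Suc i))"
  proof -
    have "?T (E (Suc (Suc i)) * H (Suc i)) =
        ?T (G (Suc i) * F (Suc i) - 1\<^sub>m (?e (Suc i))) - ?T (H i * E (Suc i))"
      unfolding H(2) using Gc[of "Suc i"] Fc[of "Suc i"] Hc[of i] Ec[of "Suc i"]
      by (intro tensor_k_minus[of _ "?e (Suc i)" "?e (Suc i)"]) auto
    also have "?T (G (Suc i) * F (Suc i) - 1\<^sub>m (?e (Suc i))) =
        ?T (G (Suc i) * F (Suc i)) - 1\<^sub>m (?e (Suc i))"
      using Gc[of "Suc i"] Fc[of "Suc i"]
      by (subst tensor_k_minus[of _ "?e (Suc i)" "?e (Suc i)"]) (auto simp: tensor_k_one)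
    finally show ?thesis
      by (simp add: tensor_k_mult[OF Ec Hc] tensor_k_mult[OF Gc Fc] tensor_k_mult[OF Hc Ec])
  qed
  then have "?T (E (Suc (Suc i))) *\<^sub>v ?h =
      (?T (G (Suc i)) * ?T (F (Suc i)) - 1\<^sub>m (?e (Suc i)) - ?T (H i) * ?T (E (Suc i))) *\<^sub>v z"
    using assoc_mult_mat_vec[OF c(2,5) z] by simp
  also have "\<dots> = (?T (G (Suc i)) * ?T (F (Suc i))) *\<^sub>v z - z - (?T (H i) * ?T (E (Suc i))) *\<^sub>v z"
    unfolding minus_mult_distrib_mat_vec[OF minus_carrier_mat[OF one_carrier_mat] mult_carrier_mat[OF c(5,2)] z]
      minus_mult_distrib_mat_vec[OF mult_carrier_mat[OF c(4,3)] one_carrier_mat z]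
    using z by simp
  also have "(?T (H i) * ?T (E (Suc i))) *\<^sub>v z = 0\<^sub>v (?e (Suc i))"
    by (simp add: assoc_mult_mat_vec[OF c(5,2) z] Ez mult_mat_zero_vec[OF c(5)])
  also have "(?T (G (Suc i)) * ?T (F (Suc i))) *\<^sub>v z = ?T (G (Suc i)) *\<^sub>v ?y"
    using assoc_mult_mat_vec[OF c(4,3) z] .
  finally have 2: "?T (E (Suc (Suc i))) *\<^sub>v ?h = ?T (G (Suc i)) *\<^sub>v ?y - z - 0\<^sub>v (?e (Suc i))" .
  have "?T (E (Suc (Suc i))) *\<^sub>v (?x - ?h) = ?T (E (Suc (Suc i))) *\<^sub>v ?x - ?T (E (Suc (Suc i))) *\<^sub>v ?h"
    using c(2) x h by (rule mult_minus_distrib_mat_vec)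
  also have "\<dots> = z"
    unfolding 1 2 using z mult_mat_vec_carrier[OF c(4) y] by (auto intro!: eq_vecI)
  finally show "\<exists>w \<in> carrier_vec (?e (Suc (Suc i))). ?T (E (Suc (Suc i))) *\<^sub>v w = z"
    using x h by (intro bexI[of _ "?x - ?h"]) auto
qed

text \<open>The subtraction is that of natural numbers, so the left side means
  \<open>kernel_dim A \<le> rank B\<close>. By \<open>AB\<close> the image of \<open>B\<close> lies
  in the kernel; a maximal independent set of columns of \<open>B\<close> is then a basis of the
  kernel as soon as it has enough elements.\<close>

lemma kernel_dim_eq_rank_iff:
  fixes A B :: "'k::field mat"
  assumes A: "A \<in> carrier_mat m n" and B: "B \<in> carrier_mat n p" and AB: "A * B = 0\<^sub>m m p"
  shows "kernel_dim A - vec_space.rank n B = 0 \<longleftrightarrow>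
    (\<forall>v \<in> carrier_vec n. A *\<^sub>v v = 0\<^sub>v m \<longrightarrow> (\<exists>w \<in> carrier_vec p. B *\<^sub>v w = v))"
proof -
  interpret kernel m n A by unfold_locales (rule A)
  let ?W = "NC.span (set (cols B))"
  have Bc: "set (cols B) \<subseteq> carrier_vec n" using B cols_dim by blast
  have W: "?W = {v \<in> carrier_vec n. \<exists>w \<in> carrier_vec p. B *\<^sub>v w = v}"
    using NC.col_space_eq[OF B] B by (simp add: NC.col_space_def)
  have "A *\<^sub>v (B *\<^sub>v w) = 0\<^sub>v m" if "w \<in> carrier_vec p" for w
    using assoc_mult_mat_vec[OF A B that, symmetric] that by (auto simp: AB intro!: eq_vecI)
  then have WK: "?W \<subseteq> mat_kernel A" using A by (auto simp: W mat_kernel)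
  have rank: "vec_space.rank n B = vectorspace.dim class_ring (NC.V\<lparr>carrier := ?W\<rparr>)"
    by (simp add: NC.rank_def)
  have exact: "?W = mat_kernel A \<longleftrightarrow>
      (\<forall>v \<in> carrier_vec n. A *\<^sub>v v = 0\<^sub>v m \<longrightarrow> (\<exists>w \<in> carrier_vec p. B *\<^sub>v w = v))"
    using WK A by (auto simp: W mat_kernel)
  have "?W = mat_kernel A" if le: "dim \<le> vec_space.rank n B"
  proof -
    obtain U where U: "maximal U (\<lambda>T. T \<subseteq> set (cols B) \<and> NC.lin_indpt T)"
    proof -
      have "\<exists>U. finite U \<and> maximal U (\<lambda>T. T \<subseteq> set (cols B) \<and> NC.lin_indpt T) \<and> {} \<subseteq> U"
      proof (rule maximal_exists_superset[of "set (cols B)"])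
        show "{} \<subseteq> set (cols B) \<and> NC.lin_indpt {}" unfolding NC.lin_dep_def by blast
      qed auto
      then show thesis using that by blast
    qed
    have card: "vec_space.rank n B = card U" by (rule NC.rank_card_indpt[OF B U])
    have UB: "U \<subseteq> set (cols B)" and li: "NC.lin_indpt U" using U by (auto simp: maximal_def)
    have UW: "U \<subseteq> ?W" using UB NC.in_own_span[OF Bc] by blast
    have "Ker.basis U"
    proof (rule Ker.dim_li_is_basis)
      obtain K where K: "finite K" "Ker.basis K" using kernel_basis_exists[OF A] by auto
      then show "Ker.fin_dim" unfolding Ker.fin_dim_def Ker.basis_def by auto
      show "finite U" using UB by (rule finite_subset) simp
      show "U \<subseteq> mat_kernel A" using UW WK by blast
      show "Ker.lin_indpt U" using li lindep_same UW WK by blast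
      show "dim \<le> card U" using le card by simp
    qed
    then have "mat_kernel A = Ker.span U" by (simp add: Ker.basis_def)
    also have "\<dots> = NC.span U" using UW WK by (intro span_same) blast
    also have "\<dots> \<subseteq> ?W" using UB by (rule NC.span_is_monotone)
    finally show ?thesis using WK by blast
  qed
  moreover have "dim \<le> vec_space.rank n B" if "?W = mat_kernel A"
    using that by (simp add: rank)
  ultimately have "dim \<le> vec_space.rank n B \<longleftrightarrow> ?W = mat_kernel A" by blast
  then show ?thesis using exact by simp
qed

text \<open>Restricted to positive degrees because \<open>exact_tensor D 0\<close> imposes the
  augmentation on cycles, whereas \<open>tor_dim D 0\<close> counts everything in degree 0 as a
  cycle.\<close>

lemma tor_dim_eq_0_iff:
  fixes D :: "nat \<Rightarrow> ('x, 'k::field) mpoly mat"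
  assumes D: "free_resolution V I D"
  shows "tor_dim D (Suc i) = 0 \<longleftrightarrow> exact_tensor D (Suc i)"
proof -
  note Dc = poly_mats_carrier[OF free_resolution_mats[OF D]]
  have "tensor_k (D (Suc i)) * tensor_k (D (Suc (Suc i))) = tensor_k (D (Suc i) * D (Suc (Suc i)))"
    by (rule tensor_k_mult[symmetric, OF Dc Dc])
  also have "\<dots> = 0\<^sub>m (free_rank D (Suc i)) (free_rank D (Suc (Suc (Suc i))))"
    unfolding free_resolution_zero[OF D] by (auto simp: tensor_k_def intro!: eq_matI)
  finally show ?thesis
    unfolding tor_dim_def exact_tensor_def free_rank_simps[OF D]
    using kernel_dim_eq_rank_iff[OF tensor_k_carrier[OF Dc] tensor_k_carrier[OF Dc]] by simp
qed

text \<open>The existence of \<open>D\<close> ensures that the chosen matrices form a resolution,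
  and exactness is then transferred in both directions.\<close>

lemma betti_eq_0_iff:
  assumes D: "free_resolution V I D"
  shows "betti V I (Suc i) = 0 \<longleftrightarrow> exact_tensor D (Suc i)"
proof -
  have "free_resolution V I (SOME D. free_resolution V I D)" using someI[of "free_resolution V I", OF D] .
  then show ?thesis unfolding betti_def
    using tor_dim_eq_0_iff exact_tensor_transfer D by metis
qed

lemma proj_dim_le:
  assumes "\<And>i. n < i \<Longrightarrow> betti V I i = 0"
  shows "proj_dim V I \<le> enat n"
  unfolding proj_dim_def
proof (rule SUP_least)
  fix i assume "i \<in> {i. betti V I i \<noteq> 0}"
  then have "i \<le> n" using assms[of i] by (cases "n < i") auto
  then show "enat i \<le> enat n" by simp
qed

lemma proj_dim_ge:
  assumes "betti V I n \<noteq> 0"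
  shows "enat n \<le> proj_dim V I"
  unfolding proj_dim_def using assms by (intro SUP_upper) simp

section \<open>Least common multiples\<close>

text \<open>On the empty set the supremum is \<open>{#}\<close>, the monomial 1. The empty set can
  therefore index the basis element of the ring, where the augmentation ends.\<close>

definition mlcm :: "('a \<Rightarrow> 'x multiset) \<Rightarrow> 'a set \<Rightarrow> 'x multiset" where
  "mlcm l \<sigma> = Sup (l ` \<sigma>)"

lemma mlcm_subseteq_iff:
  assumes "finite \<sigma>"
  shows "mlcm l \<sigma> \<subseteq># u \<longleftrightarrow> (\<forall>j \<in> \<sigma>. l j \<subseteq># u)"
proof (cases "\<sigma> = {}")
  case False
  then show ?thesis
    unfolding mlcm_def using assms by (subst subset_mset.cSup_le_iff) auto
qed (simp add: mlcm_def Sup_multiset_empty)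

lemma mlcm_upper: "finite \<sigma> \<Longrightarrow> j \<in> \<sigma> \<Longrightarrow> l j \<subseteq># mlcm l \<sigma>"
  using mlcm_subseteq_iff[of \<sigma> l "mlcm l \<sigma>"] by simp

lemma mlcm_mono: "finite \<tau> \<Longrightarrow> \<sigma> \<subseteq> \<tau> \<Longrightarrow> mlcm l \<sigma> \<subseteq># mlcm l \<tau>"
  by (subst mlcm_subseteq_iff) (auto intro: finite_subset mlcm_upper)

lemma mlcm_empty [simp]: "mlcm l {} = {#}"
  by (simp add: mlcm_def Sup_multiset_empty)

lemma mlcm_insert_absorb:
  assumes "finite \<sigma>" "l j \<subseteq># mlcm l \<sigma>"
  shows "mlcm l (insert j \<sigma>) = mlcm l \<sigma>"
  using assms by (intro subset_mset.order_antisym) (auto simp: mlcm_subseteq_iff intro: mlcm_upper)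

text \<open>Exponents of a least common multiple are maxima, attained on a finite nonempty set; the
  alternative \<open>count a x = 0\<close> accounts for empty \<open>\<sigma>\<close>.\<close>

lemma subseteq_mlcm_iff:
  assumes "finite \<sigma>"
  shows "a \<subseteq># mlcm l \<sigma> \<longleftrightarrow> (\<forall>x. count a x = 0 \<or> (\<exists>j \<in> \<sigma>. count a x \<le> count (l j) x))"
proof (intro iffI allI)
  fix x assume a: "a \<subseteq># mlcm l \<sigma>"
  show "count a x = 0 \<or> (\<exists>j \<in> \<sigma>. count a x \<le> count (l j) x)"
  proof (cases "\<sigma> = {}")
    case True
    then show ?thesis using a by simp
  next
    case False
    have "subset_mset.bdd_above (l ` \<sigma>)" using assms by simp
    then have "count (mlcm l \<sigma>) x = (SUP j\<in>\<sigma>. count (l j) x)"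
      using False by (simp add: mlcm_def count_Sup_multiset_nonempty image_image)
    also have "\<dots> \<in> (\<lambda>j. count (l j) x) ` \<sigma>"
      using assms False Max_in[of "(\<lambda>j. count (l j) x) ` \<sigma>"]
        cSup_eq_Max[of "(\<lambda>j. count (l j) x) ` \<sigma>"] by simp
    finally show ?thesis using mset_subset_eq_count[OF a, of x] by auto
  qed
next
  assume R: "\<forall>x. count a x = 0 \<or> (\<exists>j \<in> \<sigma>. count a x \<le> count (l j) x)"
  show "a \<subseteq># mlcm l \<sigma>"
  proof (rule mset_subset_eqI)
    fix x show "count a x \<le> count (mlcm l \<sigma>) x"
      using R mlcm_upper[OF assms, of _ l] by (metis le0 le_trans mset_subset_eq_count)
  qed
qed

lemma set_mset_mlcm:
  assumes "finite \<sigma>" "\<And>j. j \<in> \<sigma> \<Longrightarrow> set_mset (l j) \<subseteq> V"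
  shows "set_mset (mlcm l \<sigma>) \<subseteq> V"
proof (rule ccontr)
  assume "\<not> set_mset (mlcm l \<sigma>) \<subseteq> V"
  then obtain x where x: "x \<in># mlcm l \<sigma>" "x \<notin> V" by blast
  then have "count (mlcm l \<sigma>) x \<noteq> 0" by simp
  then obtain j where "j \<in> \<sigma>" "count (mlcm l \<sigma>) x \<le> count (l j) x"
    using subseteq_mlcm_iff[OF assms(1), of "mlcm l \<sigma>" l] subset_mset.order_refl by metis
  then have "j \<in> \<sigma>" "x \<in># l j" using x(1) by (auto simp flip: count_greater_zero_iff)
  with assms(2) x(2) show False by blast
qed

section \<open>Simplicial boundaries with weights\<close>

definition ins_sign :: "'a::linorder \<Rightarrow> 'a set \<Rightarrow> 'r::comm_ring_1" where
  "ins_sign j \<sigma> = (-1) ^ card {i \<in> \<sigma>. i < j}"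

lemma ins_sign_square: "ins_sign j \<sigma> * ins_sign j \<sigma> = 1"
  by (simp add: ins_sign_def flip: power_add mult_2)

lemma ins_sign_swap:
  assumes "finite \<rho>" "j \<notin> \<rho>" "f \<notin> \<rho>" "j \<noteq> f"
  shows "ins_sign j (insert f \<rho>) * ins_sign f (insert j \<rho>) = - (ins_sign f \<rho> * ins_sign j \<rho>)"
proof -
  have ins: "ins_sign a (insert b \<rho>) = (if b < a then - ins_sign a \<rho> else ins_sign a \<rho>)"
    if "b \<notin> \<rho>" for a b
  proof -
    have "{i \<in> insert b \<rho>. i < a} = (if b < a then insert b {i \<in> \<rho>. i < a} else {i \<in> \<rho>. i < a})"
      by auto
    then show ?thesis using that assms(1) by (simp add: ins_sign_def)
  qed
  show ?thesis using assms by (cases j f rule: linorder_cases) (simp_all add: ins mult.commute)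
qed

text \<open>The coefficient at \<open>\<tau>\<close> of the boundary of \<open>c\<close>; chains are
  functions on all sets, with no degree attached. Three weights occur: constant 1 for the augmented
  chain complex of the simplex, \<open>mlcm_quot\<close> for the Taylor complex, and
  \<open>same_mlcm\<close> for its reduction modulo the variables.\<close>

definition boundary ::
    "'a::linorder set \<Rightarrow> ('a set \<Rightarrow> 'a set \<Rightarrow> 'r) \<Rightarrow> ('a set \<Rightarrow> 'r) \<Rightarrow> 'a set \<Rightarrow> 'r::comm_ring_1" where
  "boundary A W c \<tau> = (\<Sum>j \<in> A - \<tau>. ins_sign j \<tau> * W \<tau> (insert j \<tau>) * c (insert j \<tau>))"

definition cone :: "'a::linorder \<Rightarrow> ('a set \<Rightarrow> 'r::comm_ring_1) \<Rightarrow> 'a set \<Rightarrow> 'r" where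
  "cone f c \<sigma> = (if f \<in> \<sigma> then ins_sign f (\<sigma> - {f}) * c (\<sigma> - {f}) else 0)"

text \<open>Coning is a contraction: the boundary of the cone plus the cone of the boundary is the
  identity, and \<open>cycle\<close> removes the second term. All conditions are local to
  \<open>\<tau>\<close>, since a pairing respects the weights only on some of the sets.\<close>

lemma boundary_cone:
  assumes A: "finite A" "f \<in> A" "\<tau> \<subseteq> A"
    and toggle: "W (\<tau> - {f}) (insert f \<tau>) = 1"
    and weight: "\<And>j. f \<in> \<tau> \<Longrightarrow> j \<in> A - \<tau> \<Longrightarrow> c (insert j (\<tau> - {f})) \<noteq> 0 \<Longrightarrow>
      W \<tau> (insert j \<tau>) = W (\<tau> - {f}) (insert j (\<tau> - {f}))"
    and cycle: "f \<in> \<tau> \<Longrightarrow> boundary A W c (\<tau> - {f}) = 0"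
  shows "boundary A W (cone f c) \<tau> = c \<tau>"
proof (cases "f \<in> \<tau>")
  case False
  have "boundary A W (cone f c) \<tau> =
      (\<Sum>j \<in> A - \<tau>. if j = f then ins_sign f \<tau> * W \<tau> (insert f \<tau>) * (ins_sign f \<tau> * c \<tau>) else 0)"
    unfolding boundary_def cone_def using False by (intro sum.cong) (auto simp: Diff_insert_absorb)
  also have "\<dots> = (ins_sign f \<tau> * ins_sign f \<tau>) * c \<tau>"
    using False A toggle by (simp add: sum.delta Diff_insert_absorb algebra_simps)
  finally show ?thesis by (simp add: ins_sign_square)
next
  case True
  define \<rho> where "\<rho> = \<tau> - {f}"
  have \<rho>: "\<tau> = insert f \<rho>" "f \<notin> \<rho>" "finite \<rho>" "A - \<rho> = insert f (A - \<tau>)"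
    using True A finite_subset[of \<tau> A] by (auto simp: \<rho>_def)
  have eq: "ins_sign j \<tau> * W \<tau> (insert j \<tau>) * cone f c (insert j \<tau>) =
      - ins_sign f \<rho> * (ins_sign j \<rho> * W \<rho> (insert j \<rho>) * c (insert j \<rho>))" if j: "j \<in> A - \<tau>" for j
  proof -
    have nj: "j \<notin> \<rho>" "j \<noteq> f" and ins: "insert j \<tau> - {f} = insert j \<rho>"
      using j \<rho> by auto
    have "cone f c (insert j \<tau>) = ins_sign f (insert j \<rho>) * c (insert j \<rho>)"
      using True by (simp add: cone_def ins)
    moreover have "c (insert j \<rho>) \<noteq> 0 \<Longrightarrow> W \<tau> (insert j \<tau>) = W \<rho> (insert j \<rho>)"
      using weight[OF True j] by (simp add: \<rho>_def)
    ultimately have "ins_sign j \<tau> * W \<tau> (insert j \<tau>) * cone f c (insert j \<tau>) =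
        (ins_sign j (insert f \<rho>) * ins_sign f (insert j \<rho>)) * (W \<rho> (insert j \<rho>) * c (insert j \<rho>))"
      by (cases "c (insert j \<rho>) = 0") (simp_all add: \<rho>(1) algebra_simps)
    then show ?thesis
      unfolding ins_sign_swap[OF \<rho>(3) nj(1) \<rho>(2) nj(2)] by (simp add: algebra_simps)
  qed
  have "boundary A W (cone f c) \<tau> =
      - ins_sign f \<rho> * (\<Sum>j \<in> A - \<tau>. ins_sign j \<rho> * W \<rho> (insert j \<rho>) * c (insert j \<rho>))"
    unfolding boundary_def sum_distrib_left by (rule sum.cong[OF refl eq])
  also have "(\<Sum>j \<in> A - \<tau>. ins_sign j \<rho> * W \<rho> (insert j \<rho>) * c (insert j \<rho>)) =
      boundary A W c \<rho> - ins_sign f \<rho> * W \<rho> (insert f \<rho>) * c (insert f \<rho>)"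
    using True A unfolding boundary_def \<rho>(4) by simp
  also have "\<dots> = - (ins_sign f \<rho> * c \<tau>)"
    using cycle[OF True] toggle True by (simp add: \<rho>_def insert_absorb)
  finally show ?thesis
    by (simp add: mult.assoc[symmetric] ins_sign_square)
qed

text \<open>By \<open>U\<close> the weight of a path of two steps from \<open>\<tau>\<close> depends
  only on its end. The two orders of adding \<open>i\<close> and \<open>j\<close> thus differ in
  sign alone and cancel.\<close>

lemma boundary_boundary:
  fixes U :: "'a::linorder set \<Rightarrow> 'r::comm_ring_1"
  assumes A: "finite A" "\<tau> \<subseteq> A"
    and U: "\<And>i j. i \<in> A - \<tau> \<Longrightarrow> j \<in> A - \<tau> \<Longrightarrow>
      W \<tau> (insert i \<tau>) * W (insert i \<tau>) (insert j (insert i \<tau>)) = U (insert j (insert i \<tau>))"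
  shows "boundary A W (boundary A W c) \<tau> = 0"
proof -
  define B where "B = {(i, j). i \<in> A - \<tau> \<and> j \<in> A - \<tau> \<and> i \<noteq> j}"
  define g where "g = (\<lambda>(i, j). ins_sign i \<tau> * ins_sign j (insert i \<tau>) *
    (U (insert j (insert i \<tau>)) * c (insert j (insert i \<tau>))))"
  have fin: "finite B" "finite \<tau>" using A
    by (auto simp: B_def intro: finite_subset[of _ "A \<times> A"] finite_subset[of \<tau> A])
  have "boundary A W (boundary A W c) \<tau> = (\<Sum>i \<in> A - \<tau>. \<Sum>j \<in> A - insert i \<tau>. g (i, j))"
    unfolding boundary_def sum_distrib_left
    by (intro sum.cong refl) (auto simp: g_def mult_ac U[symmetric])
  also have "\<dots> = sum g (Sigma (A - \<tau>) (\<lambda>i. A - insert i \<tau>))"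
    using A by (subst sum.Sigma) auto
  also have "Sigma (A - \<tau>) (\<lambda>i. A - insert i \<tau>) = B" by (auto simp: B_def)
  also have "sum g B = 0"
  proof -
    let ?L = "{p \<in> B. fst p < snd p}" and ?R = "{p \<in> B. snd p < fst p}"
    have anti: "g (j, i) = - g (i, j)" if "(i, j) \<in> B" for i j
    proof -
      have ij: "i \<notin> \<tau>" "j \<notin> \<tau>" "i \<noteq> j" using that by (auto simp: B_def)
      have sw: "ins_sign i (insert j \<tau>) * ins_sign j (insert i \<tau>) = - (ins_sign j \<tau> * ins_sign i \<tau> :: 'r)"
        by (rule ins_sign_swap[OF fin(2) ij])
      have "ins_sign j \<tau> * ins_sign i (insert j \<tau>) =
          ins_sign j \<tau> * (ins_sign i (insert j \<tau>) * ins_sign j (insert i \<tau>)) * (ins_sign j (insert i \<tau>) :: 'r)"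
        by (simp add: mult.assoc ins_sign_square)
      also have "\<dots> = - (ins_sign j \<tau> * ins_sign j \<tau>) * ins_sign i \<tau> * ins_sign j (insert i \<tau>)"
        unfolding sw by (simp add: algebra_simps)
      finally show ?thesis
        by (simp add: g_def ins_sign_square insert_commute)
    qed
    have "B = ?L \<union> ?R" by (auto simp: B_def)
    then have "sum g B = sum g ?L + sum g ?R"
      using fin(1) by (metis (no_types, lifting) Collect_disj_eq sum.union_disjoint[of ?L ?R g]
          disjoint_iff finite_Un mem_Collect_eq order_less_asym)
    also have "sum g ?R = (\<Sum>p \<in> ?L. g (snd p, fst p))"
      by (rule sum.reindex_bij_witness[of _ prod.swap prod.swap]) (auto simp: B_def)
    also have "\<dots> = - sum g ?L"
      unfolding sum_negf[symmetric] by (rule sum.cong) (auto simp: anti)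
    finally show ?thesis by simp
  qed
  finally show ?thesis .
qed

section \<open>Matrices indexed by finite sets\<close>

definition enum :: "'a set \<Rightarrow> nat \<Rightarrow> 'a" where
  "enum X = (SOME e. bij_betw e {..<card X} X)"

lemma bij_betw_enum: "finite X \<Longrightarrow> bij_betw (enum X) {..<card X} X"
  unfolding enum_def using ex_bij_betw_nat_finite[of X]
  by (intro someI_ex[of "\<lambda>e. bij_betw e {..<card X} X"]) (simp add: atLeast0LessThan)

definition fun_vec :: "'a set \<Rightarrow> ('a \<Rightarrow> 'r) \<Rightarrow> 'r vec" where
  "fun_vec X c = vec (card X) (\<lambda>r. c (enum X r))"

definition fun_mat :: "'a set \<Rightarrow> 'b set \<Rightarrow> ('a \<Rightarrow> 'b \<Rightarrow> 'r) \<Rightarrow> 'r mat" where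
  "fun_mat X Y g = mat (card X) (card Y) (\<lambda>(r, c). g (enum X r) (enum Y c))"

lemma fun_mat_carrier [simp]: "fun_mat X Y g \<in> carrier_mat (card X) (card Y)"
  and fun_vec_carrier [simp]: "fun_vec X c \<in> carrier_vec (card X)"
  by (simp_all add: fun_mat_def fun_vec_def)

lemma fun_mat_dim [simp]: "dim_row (fun_mat X Y g) = card X" "dim_col (fun_mat X Y g) = card Y"
  by (simp_all add: fun_mat_def)

lemma fun_mat_mult_fun_vec:
  assumes "finite Y"
  shows "fun_mat X Y g *\<^sub>v fun_vec Y c = fun_vec X (\<lambda>x. \<Sum>y \<in> Y. g x y * c y)"
proof (rule eq_vecI)
  fix r assume "r < dim_vec (fun_vec X (\<lambda>x. \<Sum>y \<in> Y. g x y * c y))"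
  then have r: "r < card X" by (simp add: fun_vec_def)
  have "(fun_mat X Y g *\<^sub>v fun_vec Y c) $ r = (\<Sum>i<card Y. g (enum X r) (enum Y i) * c (enum Y i))"
    using r by (simp add: fun_mat_def fun_vec_def scalar_prod_def atLeast0LessThan)
  also have "\<dots> = (\<Sum>y \<in> Y. g (enum X r) y * c y)"
    using bij_betw_enum[OF assms] by (rule sum.reindex_bij_betw)
  finally show "(fun_mat X Y g *\<^sub>v fun_vec Y c) $ r = fun_vec X (\<lambda>x. \<Sum>y \<in> Y. g x y * c y) $ r"
    using r by (simp add: fun_vec_def)
qed (simp add: fun_vec_def)

lemma all_enum_iff:
  assumes "finite X"
  shows "(\<forall>r < card X. P (enum X r)) \<longleftrightarrow> (\<forall>x \<in> X. P x)"
proof -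
  have "(\<forall>x \<in> X. P x) \<longleftrightarrow> (\<forall>x \<in> enum X ` {..<card X}. P x)"
    by (simp only: bij_betw_imp_surj_on[OF bij_betw_enum[OF assms]])
  also have "\<dots> \<longleftrightarrow> (\<forall>r < card X. P (enum X r))" by auto
  finally show ?thesis by blast
qed

lemma fun_vec_eq_iff:
  assumes "finite X"
  shows "fun_vec X c = fun_vec X d \<longleftrightarrow> (\<forall>x \<in> X. c x = d x)"
  unfolding all_enum_iff[OF assms, symmetric] by (auto simp: fun_vec_def vec_eq_iff)

lemma fun_vec_eq_0_iff:
  assumes "finite X"
  shows "fun_vec X c = 0\<^sub>v (card X) \<longleftrightarrow> (\<forall>x \<in> X. c x = 0)"
  unfolding all_enum_iff[OF assms, symmetric] by (auto simp: fun_vec_def vec_eq_iff)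

lemma fun_vec_surj:
  assumes "finite X" "v \<in> carrier_vec (card X)"
  shows "\<exists>c. v = fun_vec X c"
proof
  show "v = fun_vec X (\<lambda>x. v $ (inv_into {..<card X} (enum X) x))"
    using assms(2) bij_betw_inv_into_left[OF bij_betw_enum[OF assms(1)]]
    by (auto simp: fun_vec_def intro!: eq_vecI)
qed

lemma fun_vec_free_module_iff:
  assumes "finite X"
  shows "fun_vec X c \<in> free_module V (card X) \<longleftrightarrow> (\<forall>x \<in> X. c x \<in> carrier (poly_ring V))"
  unfolding all_enum_iff[OF assms, symmetric] by (auto simp: fun_vec_def free_module_def)

lemma fun_mat_elements:
  assumes "finite X" "finite Y" "\<And>x y. x \<in> X \<Longrightarrow> y \<in> Y \<Longrightarrow> g x y \<in> S"
  shows "elements_mat (fun_mat X Y g) \<subseteq> S"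
proof
  fix a assume "a \<in> elements_mat (fun_mat X Y g)"
  then obtain r c where rc: "r < card X" "c < card Y" "a = g (enum X r) (enum Y c)"
    by (auto dest!: elements_matD simp: fun_mat_def)
  then have "enum X r \<in> X" "enum Y c \<in> Y"
    using bij_betw_apply[OF bij_betw_enum] assms by auto
  with rc(3) assms(3) show "a \<in> S" by blast
qed

lemma tensor_k_fun_mat:
  "tensor_k (fun_mat X Y g) = fun_mat X Y (\<lambda>x y. Poly_Mapping.lookup (g x y) {#})"
  by (auto simp: tensor_k_def fun_mat_def intro!: eq_matI)

section \<open>The Taylor resolution\<close>

definition subsets_card :: "'a set \<Rightarrow> nat \<Rightarrow> 'a set set" where
  "subsets_card A n = {\<sigma>. \<sigma> \<subseteq> A \<and> card \<sigma> = n}"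

lemma finite_subsets_card [simp]: "finite A \<Longrightarrow> finite (subsets_card A n)"
  by (simp add: subsets_card_def)

lemma card_subsets_card_0: "finite A \<Longrightarrow> subsets_card A 0 = {{}}"
  by (auto simp: subsets_card_def dest: finite_subset)

lemma insert_subsets_card:
  "finite A \<Longrightarrow> \<tau> \<in> subsets_card A n \<Longrightarrow> j \<in> A - \<tau> \<Longrightarrow> insert j \<tau> \<in> subsets_card A (Suc n)"
  by (auto simp: subsets_card_def finite_subset)

text \<open>\<open>the_elem\<close> is meaningful because rows and columns of the matrices are sets
  of consecutive cardinalities: if \<open>\<tau> \<subseteq> \<sigma>\<close>, the difference is a
  singleton.\<close>

definition boundary_entry ::
    "('a::linorder set \<Rightarrow> 'a set \<Rightarrow> 'r::comm_ring_1) \<Rightarrow> 'a set \<Rightarrow> 'a set \<Rightarrow> 'r" where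
  "boundary_entry W \<tau> \<sigma> = (if \<tau> \<subseteq> \<sigma> then ins_sign (the_elem (\<sigma> - \<tau>)) \<tau> * W \<tau> \<sigma> else 0)"

lemma sum_boundary_entry:
  assumes A: "finite A" and \<tau>: "\<tau> \<in> subsets_card A n"
  shows "(\<Sum>\<sigma> \<in> subsets_card A (Suc n). boundary_entry W \<tau> \<sigma> * c \<sigma>) = boundary A W c \<tau>"
proof -
  have fin: "finite \<tau>" using A \<tau> by (auto simp: subsets_card_def intro: finite_subset)
  have im: "(\<lambda>j. insert j \<tau>) ` (A - \<tau>) = {\<sigma> \<in> subsets_card A (Suc n). \<tau> \<subseteq> \<sigma>}"
  proof (intro equalityI subsetI)
    fix \<sigma> assume "\<sigma> \<in> {\<sigma> \<in> subsets_card A (Suc n). \<tau> \<subseteq> \<sigma>}"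
    then have \<sigma>: "\<sigma> \<subseteq> A" "card \<sigma> = Suc n" "\<tau> \<subseteq> \<sigma>" by (auto simp: subsets_card_def)
    then have "card (\<sigma> - \<tau>) = 1" using fin \<tau> by (simp add: card_Diff_subset subsets_card_def)
    then obtain j where "\<sigma> - \<tau> = {j}" by (auto simp: card_1_singleton_iff)
    with \<sigma> show "\<sigma> \<in> (\<lambda>j. insert j \<tau>) ` (A - \<tau>)" by (intro image_eqI[of _ _ j]) auto
  qed (use insert_subsets_card[OF A \<tau>] in auto)
  have "(\<Sum>\<sigma> \<in> subsets_card A (Suc n). boundary_entry W \<tau> \<sigma> * c \<sigma>) =
      (\<Sum>\<sigma> \<in> {\<sigma> \<in> subsets_card A (Suc n). \<tau> \<subseteq> \<sigma>}. boundary_entry W \<tau> \<sigma> * c \<sigma>)"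
    using A by (intro sum.mono_neutral_right) (auto simp: boundary_entry_def)
  also have "\<dots> = (\<Sum>j \<in> A - \<tau>. boundary_entry W \<tau> (insert j \<tau>) * c (insert j \<tau>))"
    unfolding im[symmetric] by (subst sum.reindex) (auto simp: inj_on_def)
  also have "\<dots> = boundary A W c \<tau>"
    unfolding boundary_def
  proof (rule sum.cong[OF refl])
    fix j assume "j \<in> A - \<tau>"
    then have "insert j \<tau> - \<tau> = {j}" by auto
    then show "boundary_entry W \<tau> (insert j \<tau>) * c (insert j \<tau>) =
        ins_sign j \<tau> * W \<tau> (insert j \<tau>) * c (insert j \<tau>)"
      by (simp add: boundary_entry_def subset_insertI)
  qed
  finally show ?thesis .
qed

definition mlcm_quot :: "('a \<Rightarrow> 'x multiset) \<Rightarrow> 'a set \<Rightarrow> 'a set \<Rightarrow> ('x, 'k::field) mpoly" where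
  "mlcm_quot l \<tau> \<sigma> = monomial (mlcm l \<sigma> - mlcm l \<tau>)"

definition taylor ::
    "'a::linorder set \<Rightarrow> ('a \<Rightarrow> 'x multiset) \<Rightarrow> nat \<Rightarrow> ('x, 'k::field) mpoly mat" where
  "taylor A l i = fun_mat (subsets_card A i) (subsets_card A (Suc i)) (boundary_entry (mlcm_quot l))"

lemma taylor_mult:
  assumes A: "finite A"
  shows "taylor A l i *\<^sub>v fun_vec (subsets_card A (Suc i)) c =
    fun_vec (subsets_card A i) (boundary A (mlcm_quot l) c)"
  unfolding taylor_def using A
  by (simp add: fun_mat_mult_fun_vec fun_vec_eq_iff sum_boundary_entry)

text \<open>
  The part of multidegree \<open>u\<close> of the element with coefficients \<open>c\<close>: the basis element indexed by
  \<open>\<sigma>\<close> has multidegree \<^term>\<open>mlcm l \<sigma>\<close>. In each multidegree the Taylor complex is the augmented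
  chain complex of a full simplex.
\<close>

definition mdeg_part ::
    "('a \<Rightarrow> 'x multiset) \<Rightarrow> ('a set \<Rightarrow> ('x, 'k::field) mpoly) \<Rightarrow> 'x multiset \<Rightarrow> 'a set \<Rightarrow> 'k" where
  "mdeg_part l c u \<sigma> =
     (if mlcm l \<sigma> \<subseteq># u then Poly_Mapping.lookup (c \<sigma>) (u - mlcm l \<sigma>) else 0)"

lemma lookup_eq_mdeg_part: "Poly_Mapping.lookup (c \<sigma>) a = mdeg_part l c (a + mlcm l \<sigma>) \<sigma>"
  by (simp add: mdeg_part_def)

lemma mdeg_part_eqI:
  assumes "\<And>u. mdeg_part l c u \<sigma> = mdeg_part l d u \<sigma>"
  shows "c \<sigma> = d \<sigma>"
  by (rule poly_mapping_eqI) (simp add: lookup_eq_mdeg_part[of _ _ _ l] assms)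

lemma ins_sign_single:
  "(ins_sign j \<tau> :: ('x, 'k::field) mpoly) = Poly_Mapping.single {#} (ins_sign j \<tau>)"
proof -
  have "((-1) ^ n :: ('x, 'k) mpoly) = Poly_Mapping.single 0 ((-1) ^ n)" for n
    by (induction n) (simp_all add: mult_single single_uminus)
  then show ?thesis by (simp add: ins_sign_def)
qed

text \<open>Multiplying by the quotient of the two least common multiples moves the coefficient at
  \<open>u - mlcm l (insert j \<tau>)\<close> to \<open>u - mlcm l \<tau>\<close>. Inside one
  multidegree all weights are therefore 1.\<close>

lemma mdeg_part_boundary:
  fixes c :: "'a::linorder set \<Rightarrow> ('x, 'k::field) mpoly"
  assumes A: "finite A" "\<tau> \<subseteq> A"
  shows "mdeg_part l (boundary A (mlcm_quot l) c) u \<tau> = boundary A (\<lambda>_ _. 1) (mdeg_part l c u) \<tau>"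
proof -
  have mono: "mlcm l \<tau> \<subseteq># mlcm l (insert j \<tau>)" for j
    using A finite_subset by (intro mlcm_mono) auto
  show ?thesis
  proof (cases "mlcm l \<tau> \<subseteq># u")
    case True
    have "Poly_Mapping.lookup (ins_sign j \<tau> * mlcm_quot l \<tau> (insert j \<tau>) * c (insert j \<tau>)) (u - mlcm l \<tau>) =
        ins_sign j \<tau> * mdeg_part l c u (insert j \<tau>)" for j
    proof -
      let ?t = "mlcm l \<tau>" and ?s = "mlcm l (insert j \<tau>)"
      have iff: "?s - ?t \<subseteq># u - ?t \<longleftrightarrow> ?s \<subseteq># u"
        using mono[of j] True
        by (metis subset_eq_diff_conv subset_mset.diff_add subset_mset.le_diff_conv2)
      have sub: "u - (?t + (?s - ?t)) = u - ?s"
        using mono[of j] by (simp only: subset_mset.add_diff_inverse)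
      have "ins_sign j \<tau> * mlcm_quot l \<tau> (insert j \<tau>) = Poly_Mapping.single (?s - ?t) (ins_sign j \<tau> :: 'k)"
        by (simp add: ins_sign_single mlcm_quot_def monomial_def mult_single)
      then show ?thesis by (simp add: lookup_single_mult iff sub mdeg_part_def)
    qed
    then show ?thesis using True
      by (simp add: mdeg_part_def[of l "boundary A (mlcm_quot l) c"] boundary_def lookup_sum)
  next
    case False
    then have "\<not> mlcm l (insert j \<tau>) \<subseteq># u" for j
      using mono subset_mset.order_trans by blast
    then show ?thesis using False by (simp add: mdeg_part_def boundary_def)
  qed
qed

lemma taylor_boundary_boundary:
  assumes A: "finite A" "\<tau> \<subseteq> A"
  shows "boundary A (mlcm_quot l) (boundary A (mlcm_quot l) c) \<tau> = 0"
proof (rule boundary_boundary[OF A, where U = "mlcm_quot l \<tau>"])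
  fix i j assume "i \<in> A - \<tau>" "j \<in> A - \<tau>"
  then have fin: "finite (insert j (insert i \<tau>))" using A by (auto intro: finite_subset)
  have "mlcm l \<tau> \<subseteq># mlcm l (insert i \<tau>)" "mlcm l (insert i \<tau>) \<subseteq># mlcm l (insert j (insert i \<tau>))"
    using fin by (auto intro!: mlcm_mono)
  then have "mlcm l (insert i \<tau>) - mlcm l \<tau> + (mlcm l (insert j (insert i \<tau>)) - mlcm l (insert i \<tau>)) =
      mlcm l (insert j (insert i \<tau>)) - mlcm l \<tau>"
    by (metis add.commute subset_mset.add_diff_assoc2 subset_mset.diff_add)
  then show "mlcm_quot l \<tau> (insert i \<tau>) * mlcm_quot l (insert i \<tau>) (insert j (insert i \<tau>)) =
      mlcm_quot l \<tau> (insert j (insert i \<tau>))"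
    by (simp add: mlcm_quot_def monomial_def mult_single)
qed

lemma boundary_closed:
  assumes "finite A" "\<tau> \<subseteq> A" "\<And>j. j \<in> A \<Longrightarrow> set_mset (l j) \<subseteq> V"
    "\<And>j. j \<in> A - \<tau> \<Longrightarrow> c (insert j \<tau>) \<in> carrier (poly_ring V)"
  shows "boundary A (mlcm_quot l) c \<tau> \<in> carrier (poly_ring V)"
  unfolding boundary_def
proof (intro poly_ring_sum poly_ring_carrier_mult assms(4))
  fix j assume "j \<in> A - \<tau>"
  then have "set_mset (mlcm l (insert j \<tau>)) \<subseteq> V"
    using assms by (intro set_mset_mlcm) (auto intro: finite_subset)
  then show "mlcm_quot l \<tau> (insert j \<tau>) \<in> carrier (poly_ring V)"
    unfolding mlcm_quot_def monomial_def by (intro poly_ring_single) (auto dest: in_diffD)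
  show "ins_sign j \<tau> \<in> carrier (poly_ring V)"
    unfolding ins_sign_single by (intro poly_ring_single) simp
qed

text \<open>In multidegree \<open>u\<close> any generator dividing \<open>u\<close> can be the apex
  of a contracting cone. The apex varies with \<open>u\<close>, so \<open>b\<close> is assembled
  coefficient by coefficient, and its finite support and its variables have to be controlled
  separately.\<close>

lemma taylor_exact:
  assumes A: "finite A" and V: "\<And>j. j \<in> A \<Longrightarrow> set_mset (l j) \<subseteq> V"
    and c: "\<And>\<sigma>. \<sigma> \<in> subsets_card A (Suc i) \<Longrightarrow> c \<sigma> \<in> carrier (poly_ring V)"
    and cycle: "\<And>\<tau>. \<tau> \<in> subsets_card A i \<Longrightarrow> boundary A (mlcm_quot l) c \<tau> = 0"
  shows "\<exists>b. (\<forall>\<sigma>. b \<sigma> \<in> carrier (poly_ring V)) \<and>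
    (\<forall>\<sigma> \<in> subsets_card A (Suc i). boundary A (mlcm_quot l) b \<sigma> = (c \<sigma> :: ('x, 'k::field) mpoly))"
proof -
  define vertex where "vertex u = (SOME f. f \<in> A \<and> l f \<subseteq># u)" for u
  \<comment> \<open>Cutting \<open>c\<close> off outside the sets of size \<open>Suc i\<close> makes
    it a cycle at every subset of \<open>A\<close>, whatever its size, as \<open>cyc\<close>
    shows.\<close>
  define c' where "c' \<sigma> = (if \<sigma> \<in> subsets_card A (Suc i) then c \<sigma> else 0)" for \<sigma>
  have c'V: "c' \<sigma> \<in> carrier (poly_ring V)" for \<sigma>
    by (simp add: c'_def c poly_ring_zero)
  \<comment> \<open>The monomial \<open>a\<close> at the basis element \<open>\<sigma>\<close> has
    multidegree \<open>a + mlcm l \<sigma>\<close> and takes its coefficient from the cone in that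
    degree.\<close>
  define \<beta> where "\<beta> \<sigma> a = (if \<sigma> \<subseteq> A then cone (vertex (a + mlcm l \<sigma>)) (mdeg_part l c' (a + mlcm l \<sigma>)) \<sigma> else 0)"
    for \<sigma> a
  \<comment> \<open>A nonzero coefficient stems from a monomial of \<open>c'\<close> at one of the
    finitely many facets. This yields both the finite support of \<open>b\<close> and its membership
    in \<open>poly_ring V\<close>.\<close>
  have nz: "\<exists>f \<in> \<sigma>. a + (mlcm l \<sigma> - mlcm l (\<sigma> - {f})) \<in> Poly_Mapping.keys (c' (\<sigma> - {f}))"
    if "\<beta> \<sigma> a \<noteq> 0" for \<sigma> a
  proof -
    let ?f = "vertex (a + mlcm l \<sigma>)"
    have f: "?f \<in> \<sigma>" "\<sigma> \<subseteq> A" and "mdeg_part l c' (a + mlcm l \<sigma>) (\<sigma> - {?f}) \<noteq> 0"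
      using that by (auto simp: \<beta>_def cone_def split: if_splits)
    moreover have "mlcm l (\<sigma> - {?f}) \<subseteq># mlcm l \<sigma>"
      using f A finite_subset by (intro mlcm_mono) auto
    then have "a + mlcm l \<sigma> - mlcm l (\<sigma> - {?f}) = a + (mlcm l \<sigma> - mlcm l (\<sigma> - {?f}))"
      by (rule subset_mset.diff_add_assoc)
    ultimately show ?thesis
      by (intro bexI[of _ ?f]) (auto simp: mdeg_part_def in_keys_iff split: if_splits)
  qed
  have fin: "finite {a. \<beta> \<sigma> a \<noteq> 0}" for \<sigma>
  proof (cases "\<sigma> \<subseteq> A")
    case True
    then have "finite \<sigma>" using A by (rule finite_subset)
    moreover have "finite ((\<lambda>a. a + (mlcm l \<sigma> - mlcm l (\<sigma> - {f}))) -` Poly_Mapping.keys (c' (\<sigma> - {f})))" for f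
      by (rule finite_vimageI) (auto simp: inj_on_def)
    ultimately have "finite (\<Union>f \<in> \<sigma>. (\<lambda>a. a + (mlcm l \<sigma> - mlcm l (\<sigma> - {f}))) -`
        Poly_Mapping.keys (c' (\<sigma> - {f})))" by blast
    then show ?thesis by (rule rev_finite_subset) (use nz in blast)
  qed (simp add: \<beta>_def)
  define b where "b \<sigma> = Abs_poly_mapping (\<beta> \<sigma>)" for \<sigma>
  have b: "Poly_Mapping.lookup (b \<sigma>) = \<beta> \<sigma>" for \<sigma>
    unfolding b_def using fin by (rule lookup_Abs_poly_mapping)
  have bV: "b \<sigma> \<in> carrier (poly_ring V)" for \<sigma>
  proof -
    have "set_mset a \<subseteq> V" if "a \<in> Poly_Mapping.keys (b \<sigma>)" for a
    proof -
      have "\<beta> \<sigma> a \<noteq> 0" using that by (simp add: in_keys_iff b)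
      from nz[OF this] obtain f where "a + (mlcm l \<sigma> - mlcm l (\<sigma> - {f})) \<in> Poly_Mapping.keys (c' (\<sigma> - {f}))"
        by blast
      then have "set_mset (a + (mlcm l \<sigma> - mlcm l (\<sigma> - {f}))) \<subseteq> V"
        using c'V[of "\<sigma> - {f}"] unfolding poly_ring_def by fastforce
      then show ?thesis by simp
    qed
    then show ?thesis by (simp add: poly_ring_def)
  qed
  have cyc: "boundary A (mlcm_quot l) c' \<tau> = 0" if \<tau>: "\<tau> \<subseteq> A" for \<tau>
  proof (cases "card \<tau> = i")
    case True
    then have "\<tau> \<in> subsets_card A i" using \<tau> by (simp add: subsets_card_def)
    moreover from this have "boundary A (mlcm_quot l) c' \<tau> = boundary A (mlcm_quot l) c \<tau>"
      unfolding boundary_def using insert_subsets_card[OF A] by (intro sum.cong) (auto simp: c'_def)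
    ultimately show ?thesis using cycle by simp
  next
    case False
    have "c' (insert j \<tau>) = 0" if "j \<in> A - \<tau>" for j
      using False that \<tau> A finite_subset[OF \<tau> A] by (auto simp: c'_def subsets_card_def)
    then show ?thesis by (simp add: boundary_def)
  qed
  have "boundary A (mlcm_quot l) b \<sigma> = c' \<sigma>" if \<sigma>: "\<sigma> \<in> subsets_card A (Suc i)" for \<sigma>
  proof (rule mdeg_part_eqI)
    fix u
    have \<sigma>A: "\<sigma> \<subseteq> A" and "\<sigma> \<noteq> {}" using \<sigma> by (auto simp: subsets_card_def)
    show "mdeg_part l (boundary A (mlcm_quot l) b) u \<sigma> = mdeg_part l c' u \<sigma>"
    proof (cases "\<exists>f \<in> A. l f \<subseteq># u")
      case True
      then have f: "vertex u \<in> A" "l (vertex u) \<subseteq># u"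
        unfolding vertex_def using someI_ex[of "\<lambda>f. f \<in> A \<and> l f \<subseteq># u"] by blast+
      have part: "mdeg_part l b u \<rho> = cone (vertex u) (mdeg_part l c' u) \<rho>" if \<rho>: "\<rho> \<subseteq> A" for \<rho>
      proof (cases "mlcm l \<rho> \<subseteq># u")
        case True
        then show ?thesis using \<rho> by (simp add: mdeg_part_def[of l b] b \<beta>_def)
      next
        case F: False
        \<comment> \<open>The apex divides \<open>u\<close>, so some other element of
          \<open>\<rho>\<close> fails to divide it, and the cone vanishes at \<open>\<rho>\<close>
          as well.\<close>
        have "\<not> mlcm l (\<rho> - {vertex u}) \<subseteq># u" if "vertex u \<in> \<rho>"
          using F f(2) that \<rho> A finite_subset[OF \<rho> A]
          by (auto simp: mlcm_subseteq_iff)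
        then show ?thesis using F by (simp add: mdeg_part_def cone_def)
      qed
      have "boundary A (\<lambda>_ _. 1) (mdeg_part l b u) \<sigma> =
          boundary A (\<lambda>_ _. 1) (cone (vertex u) (mdeg_part l c' u)) \<sigma>"
        unfolding boundary_def using \<sigma>A by (intro sum.cong) (auto simp: part)
      also have "\<dots> = mdeg_part l c' u \<sigma>"
      proof (rule boundary_cone[OF A f(1) \<sigma>A])
        have sub: "\<sigma> - {vertex u} \<subseteq> A" using \<sigma>A by blast
        show "boundary A (\<lambda>_ _. 1) (mdeg_part l c' u) (\<sigma> - {vertex u}) = 0"
          unfolding mdeg_part_boundary[OF A sub, symmetric] by (simp add: mdeg_part_def cyc[OF sub])
      qed auto
      finally show ?thesis by (simp add: mdeg_part_boundary[OF A \<sigma>A])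
    next
      case False
      then have "\<not> mlcm l \<rho> \<subseteq># u" if "\<rho> \<subseteq> A" "\<rho> \<noteq> {}" for \<rho>
        using that A finite_subset[OF that(1) A] by (auto simp: mlcm_subseteq_iff)
      then show ?thesis using \<sigma>A \<open>\<sigma> \<noteq> {}\<close> by (simp add: mdeg_part_def)
    qed
  qed
  then show ?thesis using bV by (intro exI[of _ b]) (simp add: c'_def)
qed

lemma free_resolution_taylor:
  fixes l :: "'a::linorder \<Rightarrow> 'x multiset"
  assumes A: "finite A" and V: "\<And>j. j \<in> A \<Longrightarrow> set_mset (l j) \<subseteq> V"
  shows "free_resolution V
    {\<Sum>j \<in> A. monomial (l j) * v j | v. \<forall>j \<in> A. v j \<in> carrier (poly_ring V)}
    (taylor A l :: nat \<Rightarrow> ('x, 'k::field) mpoly mat)"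
  unfolding free_resolution_def
proof (intro conjI allI)
  let ?X = "subsets_card A" and ?T = "taylor A l :: nat \<Rightarrow> ('x, 'k) mpoly mat"
  show "dim_row (?T 0) = 1" using A by (simp add: taylor_def card_subsets_card_0)
  show "dim_row (?T (Suc i)) = dim_col (?T i)" for i by (simp add: taylor_def)
  show "elements_mat (?T i) \<subseteq> carrier (poly_ring V)" for i
    unfolding taylor_def
  proof (rule fun_mat_elements)
    fix \<tau> \<sigma> assume "\<tau> \<in> ?X i" "\<sigma> \<in> ?X (Suc i)"
    then have "set_mset (mlcm l \<sigma>) \<subseteq> V"
      using A V by (intro set_mset_mlcm) (auto simp: subsets_card_def intro: finite_subset)
    then show "boundary_entry (mlcm_quot l) \<tau> \<sigma> \<in> carrier (poly_ring V)"
      unfolding boundary_entry_def mlcm_quot_def monomial_def ins_sign_single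
      by (auto intro!: poly_ring_carrier_mult poly_ring_single poly_ring_zero dest: in_diffD)
  qed (use A in simp_all)
  have fm: "(free_module V (dim_col (?T i)) :: ('x, 'k) mpoly vec set) =
      fun_vec (?X (Suc i)) ` {c. \<forall>\<sigma> \<in> ?X (Suc i). c \<sigma> \<in> carrier (poly_ring V)}" for i
  proof (intro equalityI subsetI)
    fix v :: "('x, 'k) mpoly vec" assume v: "v \<in> free_module V (dim_col (?T i))"
    then have "v \<in> carrier_vec (card (?X (Suc i)))" by (simp add: free_module_def taylor_def)
    then obtain c where "v = fun_vec (?X (Suc i)) c" using A fun_vec_surj finite_subsets_card by metis
    with v A show "v \<in> fun_vec (?X (Suc i)) ` {c. \<forall>\<sigma> \<in> ?X (Suc i). c \<sigma> \<in> carrier (poly_ring V)}"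
      by (auto simp: taylor_def fun_vec_free_module_iff)
  qed (use A in \<open>auto simp: taylor_def fun_vec_free_module_iff\<close>)
  show "(\<lambda>v. (?T 0 *\<^sub>v v) $ 0) ` free_module V (dim_col (?T 0)) =
    {\<Sum>j \<in> A. monomial (l j) * v j | v. \<forall>j \<in> A. v j \<in> carrier (poly_ring V)}"
  proof -
    have bd: "(?T 0 *\<^sub>v fun_vec (?X (Suc 0)) c) $ 0 = (\<Sum>j \<in> A. monomial (l j) * c {j})" for c
    proof -
      have "enum (?X 0) 0 \<in> ?X 0"
        using bij_betw_apply[OF bij_betw_enum[of "?X 0"], of 0] A by (simp add: card_subsets_card_0)
      then have "enum (?X 0) 0 = {}" using A by (simp add: card_subsets_card_0)
      moreover have "mlcm l {j} = l j" for j by (simp add: mlcm_def)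
      ultimately show ?thesis unfolding taylor_mult[OF A] using A
        by (simp add: fun_vec_def card_subsets_card_0 boundary_def mlcm_quot_def ins_sign_def)
    qed
    have "{c. \<forall>\<sigma> \<in> ?X (Suc 0). c \<sigma> \<in> carrier (poly_ring V)} =
        {c :: 'a set \<Rightarrow> ('x, 'k) mpoly. \<forall>j \<in> A. c {j} \<in> carrier (poly_ring V)}"
      by (auto simp: subsets_card_def card_1_singleton_iff)
    then have "(\<lambda>v. (?T 0 *\<^sub>v v) $ 0) ` free_module V (dim_col (?T 0)) =
        (\<lambda>c. \<Sum>j \<in> A. monomial (l j) * c {j}) ` {c. \<forall>j \<in> A. c {j} \<in> carrier (poly_ring V)}"
      by (simp add: fm image_image bd)
    also have "\<dots> = {\<Sum>j \<in> A. monomial (l j) * v j | v. \<forall>j \<in> A. v j \<in> carrier (poly_ring V)}"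
    proof (intro equalityI subsetI)
      fix p assume "p \<in> {\<Sum>j \<in> A. monomial (l j) * v j | v. \<forall>j \<in> A. v j \<in> carrier (poly_ring V)}"
      then obtain v where v: "p = (\<Sum>j \<in> A. monomial (l j) * v j)" "\<forall>j \<in> A. v j \<in> carrier (poly_ring V)"
        by blast
      then show "p \<in> (\<lambda>c. \<Sum>j \<in> A. monomial (l j) * c {j}) ` {c. \<forall>j \<in> A. c {j} \<in> carrier (poly_ring V)}"
        by (intro image_eqI[of _ _ "\<lambda>\<sigma>. v (the_elem \<sigma>)"]) auto
    qed auto
    finally show ?thesis .
  qed
  show "(\<lambda>v. ?T (Suc i) *\<^sub>v v) ` free_module V (dim_col (?T (Suc i))) =
      mat_kernel (?T i) \<inter> free_module V (dim_col (?T i))" for i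
  proof (intro equalityI subsetI)
    fix v assume "v \<in> (\<lambda>v. ?T (Suc i) *\<^sub>v v) ` free_module V (dim_col (?T (Suc i)))"
    then obtain c where c: "\<forall>\<sigma> \<in> ?X (Suc (Suc i)). c \<sigma> \<in> carrier (poly_ring V)"
      and v: "v = fun_vec (?X (Suc i)) (boundary A (mlcm_quot l) c)"
      by (auto simp: fm taylor_mult[OF A])
    have "boundary A (mlcm_quot l) c \<sigma> \<in> carrier (poly_ring V)" if "\<sigma> \<in> ?X (Suc i)" for \<sigma>
      using that c A V insert_subsets_card[OF A that]
      by (intro boundary_closed) (auto simp: subsets_card_def)
    then have "v \<in> free_module V (dim_col (?T i))" using v by (auto simp: fm)
    moreover have "?T i *\<^sub>v v = 0\<^sub>v (dim_row (?T i))"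
      unfolding v taylor_mult[OF A] using A
      by (auto simp: taylor_def fun_vec_eq_0_iff taylor_boundary_boundary subsets_card_def)
    ultimately show "v \<in> mat_kernel (?T i) \<inter> free_module V (dim_col (?T i))"
      by (simp add: mat_kernel_def free_module_def)
  next
    fix v assume "v \<in> mat_kernel (?T i) \<inter> free_module V (dim_col (?T i))"
    then obtain c where c: "\<forall>\<sigma> \<in> ?X (Suc i). c \<sigma> \<in> carrier (poly_ring V)"
      and v: "v = fun_vec (?X (Suc i)) c" "?T i *\<^sub>v v = 0\<^sub>v (dim_row (?T i))"
      by (auto simp: fm mat_kernel_def)
    have "\<forall>\<tau> \<in> ?X i. boundary A (mlcm_quot l) c \<tau> = 0"
      using v(2) A unfolding v(1) taylor_mult[OF A] by (simp add: taylor_def fun_vec_eq_0_iff)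
    then have "\<exists>b. (\<forall>\<sigma>. b \<sigma> \<in> carrier (poly_ring V)) \<and>
        (\<forall>\<sigma> \<in> ?X (Suc i). boundary A (mlcm_quot l) b \<sigma> = c \<sigma>)"
      using c by (intro taylor_exact A V) auto
    then obtain b where b: "\<forall>\<sigma>. b \<sigma> \<in> carrier (poly_ring V)"
      "\<forall>\<sigma> \<in> ?X (Suc i). boundary A (mlcm_quot l) b \<sigma> = c \<sigma>" by blast
    then have "?T (Suc i) *\<^sub>v fun_vec (?X (Suc (Suc i))) b = v"
      using A unfolding v(1) taylor_mult[OF A] by (simp add: fun_vec_eq_iff)
    moreover have "fun_vec (?X (Suc (Suc i))) b \<in> free_module V (dim_col (?T (Suc i)))"
      using b(1) by (auto simp: fm)
    ultimately show "v \<in> (\<lambda>v. ?T (Suc i) *\<^sub>v v) ` free_module V (dim_col (?T (Suc i)))" by blast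
  qed
qed

section \<open>The Taylor complex modulo the variables\<close>

text \<open>For nested finite sets this is the constant term of \<open>mlcm_quot\<close>: the
  quotient monomial is 1 exactly if the least common multiples agree.\<close>

definition same_mlcm :: "('a \<Rightarrow> 'x multiset) \<Rightarrow> 'a set \<Rightarrow> 'a set \<Rightarrow> 'k::comm_ring_1" where
  "same_mlcm l \<tau> \<sigma> = of_bool (mlcm l \<tau> = mlcm l \<sigma>)"

lemma same_mlcm_insert:
  assumes "finite \<tau>"
  shows "same_mlcm l \<tau> (insert j \<tau>) = of_bool (l j \<subseteq># mlcm l \<tau>)"
proof -
  have "mlcm l \<tau> = mlcm l (insert j \<tau>) \<longleftrightarrow> l j \<subseteq># mlcm l \<tau>"
    using mlcm_insert_absorb[OF assms, of l j] mlcm_upper[of "insert j \<tau>" j l] assms by auto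
  then show ?thesis by (simp add: same_mlcm_def)
qed

lemma tensor_k_taylor:
  assumes A: "finite A"
  shows "tensor_k (taylor A l i :: ('x, 'k::field) mpoly mat) =
    fun_mat (subsets_card A i) (subsets_card A (Suc i)) (boundary_entry (same_mlcm l))"
proof -
  have "Poly_Mapping.lookup (boundary_entry (mlcm_quot l) \<tau> \<sigma> :: ('x, 'k) mpoly) {#} =
      boundary_entry (same_mlcm l) \<tau> \<sigma>"
    if "\<tau> \<in> subsets_card A i" "\<sigma> \<in> subsets_card A (Suc i)" for \<tau> \<sigma>
  proof (cases "\<tau> \<subseteq> \<sigma>")
    case True
    have "finite \<sigma>" using that A by (auto simp: subsets_card_def intro: finite_subset)
    then have "mlcm l \<tau> \<subseteq># mlcm l \<sigma>" using True by (rule mlcm_mono)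
    then have "mlcm l \<sigma> - mlcm l \<tau> = {#} \<longleftrightarrow> mlcm l \<tau> = mlcm l \<sigma>"
      by (metis Diff_eq_empty_iff_mset subset_mset.antisym subset_mset.order_refl)
    then show ?thesis
      by (simp add: boundary_entry_def mlcm_quot_def monomial_def ins_sign_single
          mult_single lookup_single same_mlcm_def when_def)
  qed (simp add: boundary_entry_def)
  then show ?thesis
    unfolding taylor_def tensor_k_fun_mat
    unfolding fun_mat_def
    using A bij_betw_apply[OF bij_betw_enum[OF finite_subsets_card[OF A]]]
    by (auto intro!: eq_matI)
qed

lemma free_rank_taylor:
  assumes "finite A"
  shows "free_rank (taylor A l :: nat \<Rightarrow> ('x, 'k::field) mpoly mat) i = card (subsets_card A i)"
  using assms by (cases i) (simp_all add: free_rank_def taylor_def card_subsets_card_0)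

lemma exact_tensor_taylor_iff:
  assumes A: "finite A"
  shows "exact_tensor (taylor A l :: nat \<Rightarrow> ('x, 'k::field) mpoly mat) i \<longleftrightarrow>
    (\<forall>c :: 'a::linorder set \<Rightarrow> 'k. (\<forall>\<tau> \<in> subsets_card A i. boundary A (same_mlcm l) c \<tau> = 0) \<longrightarrow>
       (\<exists>b. \<forall>\<sigma> \<in> subsets_card A (Suc i). boundary A (same_mlcm l) b \<sigma> = c \<sigma>))"
proof -
  let ?X = "subsets_card A" and ?T = "\<lambda>i. tensor_k (taylor A l i :: ('x, 'k) mpoly mat)"
  have all: "(\<forall>v \<in> carrier_vec (card (?X n)). Q v) \<longleftrightarrow> (\<forall>c. Q (fun_vec (?X n) c))" for n and Q :: "'k vec \<Rightarrow> bool"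
    using fun_vec_surj[OF finite_subsets_card[OF A]] fun_vec_carrier by metis
  have ex: "(\<exists>v \<in> carrier_vec (card (?X n)). Q v) \<longleftrightarrow> (\<exists>c. Q (fun_vec (?X n) c))" for n and Q :: "'k vec \<Rightarrow> bool"
    using fun_vec_surj[OF finite_subsets_card[OF A]] fun_vec_carrier by metis
  have mult: "?T n *\<^sub>v fun_vec (?X (Suc n)) c = fun_vec (?X n) (boundary A (same_mlcm l) c)" for n c
    unfolding tensor_k_taylor[OF A] using A
    by (simp add: fun_mat_mult_fun_vec fun_vec_eq_iff sum_boundary_entry)
  show ?thesis
    unfolding exact_tensor_def free_rank_taylor[OF A] all ex mult
    using A by (simp add: fun_vec_eq_iff fun_vec_eq_0_iff)
qed

lemma boundary_same_mlcm_twice: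
  assumes A: "finite A" "\<tau> \<subseteq> A"
  shows "boundary A (same_mlcm l) (boundary A (same_mlcm l) c) \<tau> = 0"
proof (rule boundary_boundary[OF A, where U = "same_mlcm l \<tau>"])
  fix i j assume "i \<in> A - \<tau>" "j \<in> A - \<tau>"
  then have fin: "finite (insert j (insert i \<tau>))" using A by (auto intro: finite_subset)
  then have "mlcm l \<tau> \<subseteq># mlcm l (insert i \<tau>)" "mlcm l (insert i \<tau>) \<subseteq># mlcm l (insert j (insert i \<tau>))"
    by (auto intro!: mlcm_mono)
  then show "same_mlcm l \<tau> (insert i \<tau>) * same_mlcm l (insert i \<tau>) (insert j (insert i \<tau>)) =
      same_mlcm l \<tau> (insert j (insert i \<tau>))"
    by (auto simp: same_mlcm_def dest: subset_mset.antisym)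
qed

text \<open>
  A discrete Morse matching in algebraic form: the sets whose first property is \<open>P t\<close> are matched
  in pairs with equal least common multiple by adding or removing \<open>f t\<close>, and since the properties
  are inherited by larger sets these matchings can be used one after the other.
\<close>

lemma toggle_boundary:
  fixes P :: "'t::linorder \<Rightarrow> 'a::linorder set \<Rightarrow> bool" and c :: "'a set \<Rightarrow> 'k::comm_ring_1"
  assumes A: "finite A"
    and cycle: "\<And>\<tau>. \<tau> \<in> subsets_card A i \<Longrightarrow> boundary A (same_mlcm l) c \<tau> = 0"
    and T: "finite T"
    and f: "\<And>t. t \<in> T \<Longrightarrow> f t \<in> A"
    and up: "\<And>t \<sigma> \<tau>. t \<in> T \<Longrightarrow> P t \<sigma> \<Longrightarrow> \<sigma> \<subseteq> \<tau> \<Longrightarrow> \<tau> \<subseteq> A \<Longrightarrow> P t \<tau>"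
    and rem: "\<And>t \<sigma>. t \<in> T \<Longrightarrow> \<sigma> \<subseteq> A \<Longrightarrow> P t \<sigma> \<Longrightarrow> P t (\<sigma> - {f t})"
    and dvd: "\<And>t \<sigma>. t \<in> T \<Longrightarrow> \<sigma> \<subseteq> A \<Longrightarrow> P t \<sigma> \<Longrightarrow> l (f t) \<subseteq># mlcm l \<sigma>"
    and first: "\<And>t t' \<sigma>. t \<in> T \<Longrightarrow> \<sigma> \<subseteq> A \<Longrightarrow> P t \<sigma> \<Longrightarrow> t' \<in> T \<Longrightarrow> t' < t \<Longrightarrow>
      P t' (insert (f t) \<sigma>) \<Longrightarrow> \<exists>t'' \<in> T. t'' < t \<and> P t'' \<sigma>"
  shows "\<exists>b. \<forall>\<sigma> \<in> subsets_card A (Suc i).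
    (\<exists>t \<in> T. P t \<sigma>) \<longrightarrow> boundary A (same_mlcm l) b \<sigma> = c \<sigma>"
  using T f up rem dvd first
proof (induction T rule: finite_linorder_max_induct)
  case empty
  then show ?case by simp
next
  case (insert t T)
  note f = insert.prems(1)[OF insertI1] and up = insert.prems(2) and rem = insert.prems(3)[OF insertI1]
    and dvd = insert.prems(4)[OF insertI1] and first = insert.prems(5)[OF insertI1]
  have "\<exists>b. \<forall>\<sigma> \<in> subsets_card A (Suc i). (\<exists>t \<in> T. P t \<sigma>) \<longrightarrow> boundary A (same_mlcm l) b \<sigma> = c \<sigma>"
  proof (rule insert.IH)
    fix u t' \<sigma> assume "u \<in> T" "\<sigma> \<subseteq> A" "P u \<sigma>" "t' \<in> T" "t' < u" "P t' (insert (f u) \<sigma>)"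
    then obtain t'' where "t'' \<in> insert t T" "t'' < u" "P t'' \<sigma>"
      using insert.prems(5)[of u \<sigma> t'] by blast
    moreover have "u < t" using insert.hyps(2) \<open>u \<in> T\<close> by blast
    ultimately show "\<exists>t'' \<in> T. t'' < u \<and> P t'' \<sigma>" by auto
  qed (use insert.prems in blast)+
  then obtain b where b: "\<And>\<sigma> t. \<sigma> \<in> subsets_card A (Suc i) \<Longrightarrow> t \<in> T \<Longrightarrow> P t \<sigma> \<Longrightarrow>
      boundary A (same_mlcm l) b \<sigma> = c \<sigma>" by blast
  \<comment> \<open>What the smaller indices leave over: still a cycle, and zero on every set of
    size \<open>Suc i\<close> that has one of their properties. \<open>X\<close> collects the sets
    whose first property is \<open>P t\<close>.\<close>
  define c' where "c' \<sigma> = c \<sigma> - boundary A (same_mlcm l) b \<sigma>" for \<sigma>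
  define X where "X = {\<sigma>. \<sigma> \<subseteq> A \<and> P t \<sigma> \<and> (\<forall>t' \<in> T. \<not> P t' \<sigma>)}"
  define x where "x \<sigma> = (if \<sigma> \<in> X then c' \<sigma> else 0)" for \<sigma>
  have c'0: "c' \<sigma> = 0" if "\<sigma> \<in> subsets_card A (Suc i)" "t' \<in> T" "P t' \<sigma>" for \<sigma> t'
    using b[OF that] by (simp add: c'_def)
  have cyc: "boundary A (same_mlcm l) c' \<tau> = 0" if \<tau>: "\<tau> \<in> subsets_card A i" for \<tau>
  proof -
    have "boundary A (same_mlcm l) c' \<tau> =
        boundary A (same_mlcm l) c \<tau> - boundary A (same_mlcm l) (boundary A (same_mlcm l) b) \<tau>"
      unfolding boundary_def[of A _ _ \<tau>] by (simp add: c'_def right_diff_distrib sum_subtractf)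
    then show ?thesis
      using cycle[OF \<tau>] boundary_same_mlcm_twice[OF A, of \<tau> l b] \<tau> by (simp add: subsets_card_def)
  qed
  have toggle: "mlcm l (insert (f t) \<sigma>) = mlcm l (\<sigma> - {f t})" if "\<sigma> \<subseteq> A" "P t \<sigma>" for \<sigma>
  proof -
    have "l (f t) \<subseteq># mlcm l (\<sigma> - {f t})"
      using that rem by (intro dvd) auto
    then have "mlcm l (insert (f t) (\<sigma> - {f t})) = mlcm l (\<sigma> - {f t})"
      using that A by (intro mlcm_insert_absorb) (auto intro: finite_subset)
    then show ?thesis by simp
  qed
  \<comment> \<open>The cone gives the required boundary on \<open>X\<close> (\<open>on\<close>)
    and, thanks to \<open>first\<close>, has zero boundary on the sets settled before
    (\<open>off\<close>).\<close>
  let ?y = "cone (f t) x"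
  have on: "boundary A (same_mlcm l) ?y \<tau> = c' \<tau>" if \<tau>: "\<tau> \<in> subsets_card A (Suc i)" "\<tau> \<in> X" for \<tau>
  proof -
    have \<tau>X: "\<tau> \<subseteq> A" "P t \<tau>" "\<And>t'. t' \<in> T \<Longrightarrow> \<not> P t' \<tau>" using \<tau>(2) by (auto simp: X_def)
    have fin: "finite \<tau>" using A \<tau>X(1) finite_subset by blast
    have "boundary A (same_mlcm l) ?y \<tau> = x \<tau>"
    proof (rule boundary_cone[OF A f \<tau>X(1)])
      show "same_mlcm l (\<tau> - {f t}) (insert (f t) \<tau>) = (1 :: 'k)"
        using toggle[OF \<tau>X(1,2)] by (simp add: same_mlcm_def)
    next
      fix j assume ft: "f t \<in> \<tau>" and j: "j \<in> A - \<tau>" and nz: "x (insert j (\<tau> - {f t})) \<noteq> 0"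
      then have "insert j (\<tau> - {f t}) \<in> X" by (auto simp: x_def split: if_splits)
      then have "mlcm l (insert (f t) (insert j (\<tau> - {f t}))) = mlcm l (insert j (\<tau> - {f t}) - {f t})
          \<and> mlcm l (insert j (\<tau> - {f t})) = mlcm l (insert (f t) (insert j (\<tau> - {f t})))"
        using toggle[of "insert j (\<tau> - {f t})"] dvd[of "insert j (\<tau> - {f t})"] fin
          mlcm_insert_absorb[of "insert j (\<tau> - {f t})" l "f t"] by (auto simp: X_def)
      moreover have "insert (f t) (insert j (\<tau> - {f t})) = insert j \<tau>" using ft by auto
      moreover have "mlcm l \<tau> = mlcm l (\<tau> - {f t})"
        using toggle[OF \<tau>X(1,2)] ft by (simp add: insert_absorb)
      ultimately show "same_mlcm l \<tau> (insert j \<tau>) =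
          (same_mlcm l (\<tau> - {f t}) (insert j (\<tau> - {f t})) :: 'k)"
        by (simp add: same_mlcm_def)
    next
      assume ft: "f t \<in> \<tau>"
      let ?\<rho> = "\<tau> - {f t}"
      have \<rho>: "?\<rho> \<in> subsets_card A i" using \<tau>(1) ft fin by (auto simp: subsets_card_def)
      \<comment> \<open>By \<open>rem\<close> and \<open>up\<close> all sets around
        \<open>?\<rho>\<close> keep \<open>P t\<close>. One outside \<open>X\<close> thus has an
        earlier property, where \<open>c'\<close> is zero, so restricting \<open>c'\<close> to
        \<open>X\<close> changes nothing here and the cycle condition survives.\<close>
      have "x (insert j ?\<rho>) = c' (insert j ?\<rho>)" if j: "j \<in> A - ?\<rho>" for j
      proof (cases "insert j ?\<rho> \<in> X")
        case False
        have ins: "insert j ?\<rho> \<in> subsets_card A (Suc i)" using A \<rho> j by (rule insert_subsets_card)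
        moreover from this have "P t (insert j ?\<rho>)"
          using rem[OF \<tau>X(1,2)] up[of t ?\<rho> "insert j ?\<rho>"] by (auto simp: subsets_card_def)
        ultimately obtain t' where "t' \<in> T" "P t' (insert j ?\<rho>)"
          using False by (auto simp: X_def subsets_card_def)
        then show ?thesis using c'0[OF ins] False by (simp add: x_def)
      qed (simp add: x_def)
      then have "boundary A (same_mlcm l) x ?\<rho> = boundary A (same_mlcm l) c' ?\<rho>"
        unfolding boundary_def by (intro sum.cong) auto
      then show "boundary A (same_mlcm l) x ?\<rho> = 0" using cyc[OF \<rho>] by simp
    qed
    then show ?thesis using \<tau>(2) by (simp add: x_def)
  qed
  have off: "boundary A (same_mlcm l) ?y \<tau> = 0" if \<tau>: "\<tau> \<subseteq> A" "t' \<in> T" "P t' \<tau>" for \<tau> t'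
  proof -
    \<comment> \<open>A nonzero value would come from a member of \<open>X\<close> that gains the
      earlier property \<open>P t'\<close> when \<open>f t\<close> is added; by \<open>first\<close>
      this member would already have an earlier property.\<close>
    have "?y (insert j \<tau>) = 0" if j: "j \<in> A - \<tau>" for j
    proof (rule ccontr)
      assume "?y (insert j \<tau>) \<noteq> 0"
      then have ft: "f t \<in> insert j \<tau>" and X: "insert j \<tau> - {f t} \<in> X"
        by (auto simp: cone_def x_def split: if_splits)
      have "P t' (insert j \<tau>)"
        using up[of t' \<tau> "insert j \<tau>"] \<tau> j by blast
      then have "P t' (insert (f t) (insert j \<tau> - {f t}))" using ft by (simp add: insert_absorb)
      moreover have "t' < t" using insert.hyps(2) \<tau>(2) by blast
      ultimately obtain t'' where "t'' \<in> insert t T" "t'' < t" "P t'' (insert j \<tau> - {f t})"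
        using first[of "insert j \<tau> - {f t}" t'] X \<tau>(2) by (auto simp: X_def)
      then show False using X by (auto simp: X_def)
    qed
    then show ?thesis by (simp add: boundary_def)
  qed
  have sum: "boundary A (same_mlcm l) (\<lambda>\<sigma>. b \<sigma> + ?y \<sigma>) \<sigma> =
      boundary A (same_mlcm l) b \<sigma> + boundary A (same_mlcm l) ?y \<sigma>" for \<sigma>
    unfolding boundary_def by (simp add: distrib_left sum.distrib)
  show ?case
  proof (intro exI ballI impI)
    fix \<sigma> assume \<sigma>: "\<sigma> \<in> subsets_card A (Suc i)" and "\<exists>t' \<in> insert t T. P t' \<sigma>"
    then consider t' where "t' \<in> T" "P t' \<sigma>" | "\<sigma> \<in> X"
      by (auto simp: X_def subsets_card_def)
    then show "boundary A (same_mlcm l) (\<lambda>\<sigma>. b \<sigma> + ?y \<sigma>) \<sigma> = c \<sigma>"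
    proof cases
      case (1 t')
      then show ?thesis using off[of \<sigma> t'] b[OF \<sigma>] \<sigma> by (simp add: sum subsets_card_def)
    next
      case 2
      then show ?thesis using on[OF \<sigma>] by (simp add: sum c'_def)
    qed
  qed
qed

text \<open>The indicator of \<open>\<sigma>\<close> is a cycle by \<open>facet\<close>. Suppose it
  is the boundary of \<open>b\<close>. Only sets \<open>insert f \<sigma>\<close> with unchanged
  least common multiple contribute at \<open>\<sigma>\<close>. For each of them
  \<open>cofacet\<close> provides a second facet, \<open>insert f \<sigma> - {e}\<close>, at which
  this set alone contributes; the boundary is 0 there, so
  \<open>b (insert f \<sigma>) = 0\<close>.\<close>

lemma not_exact_taylor:
  fixes l :: "'a::linorder \<Rightarrow> 'x multiset"
  assumes A: "finite A" and \<sigma>: "\<sigma> \<in> subsets_card A (Suc i)"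
    and facet: "\<And>j. j \<in> \<sigma> \<Longrightarrow> \<not> l j \<subseteq># mlcm l (\<sigma> - {j})"
    and cofacet: "\<And>f. f \<in> A - \<sigma> \<Longrightarrow> l f \<subseteq># mlcm l \<sigma> \<Longrightarrow>
      \<exists>e \<in> \<sigma>. l e \<subseteq># mlcm l (insert f \<sigma> - {e}) \<and>
        (\<forall>g \<in> A - (insert f \<sigma> - {e}). l g \<subseteq># mlcm l \<sigma> \<longrightarrow> g = e)"
  shows "\<not> exact_tensor (taylor A l :: nat \<Rightarrow> ('x, 'k::field) mpoly mat) i"
proof
  let ?c = "\<lambda>\<rho>. of_bool (\<rho> = \<sigma>) :: 'k"
  assume exact: "exact_tensor (taylor A l :: nat \<Rightarrow> ('x, 'k) mpoly mat) i"
  have \<sigma>A: "\<sigma> \<subseteq> A" and fin: "finite \<sigma>" using A \<sigma> by (auto simp: subsets_card_def intro: finite_subset)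
  have "boundary A (same_mlcm l) ?c \<tau> = 0" if "\<tau> \<in> subsets_card A i" for \<tau>
    unfolding boundary_def
  proof (rule sum.neutral, intro ballI)
    fix j assume j: "j \<in> A - \<tau>"
    have "finite \<tau>" using that A by (auto simp: subsets_card_def intro: finite_subset)
    moreover have "\<not> l j \<subseteq># mlcm l \<tau>" if "insert j \<tau> = \<sigma>"
    proof -
      have "\<tau> = \<sigma> - {j}" "j \<in> \<sigma>" using that j by auto
      then show ?thesis using facet by simp
    qed
    ultimately show "ins_sign j \<tau> * same_mlcm l \<tau> (insert j \<tau>) * ?c (insert j \<tau>) = 0"
      by (auto simp: same_mlcm_insert)
  qed
  with exact obtain b :: "'a set \<Rightarrow> 'k"
    where b: "\<And>\<rho>. \<rho> \<in> subsets_card A (Suc i) \<Longrightarrow> boundary A (same_mlcm l) b \<rho> = ?c \<rho>"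
    unfolding exact_tensor_taylor_iff[OF A] by blast
  have b0: "b (insert f \<sigma>) = 0" if f: "f \<in> A - \<sigma>" "l f \<subseteq># mlcm l \<sigma>" for f
  proof -
    obtain e where e: "e \<in> \<sigma>" "l e \<subseteq># mlcm l (insert f \<sigma> - {e})"
      and only: "\<And>g. g \<in> A - (insert f \<sigma> - {e}) \<Longrightarrow> l g \<subseteq># mlcm l \<sigma> \<Longrightarrow> g = e"
      using cofacet[OF f] by blast
    let ?\<rho> = "insert f \<sigma> - {e}"
    have \<rho>: "?\<rho> \<in> subsets_card A (Suc i)" "?\<rho> \<noteq> \<sigma>" "finite ?\<rho>"
      using \<sigma> f e(1) fin by (auto simp: subsets_card_def)
    have ins: "insert e ?\<rho> = insert f \<sigma>" using e(1) by auto
    have lcm: "mlcm l ?\<rho> = mlcm l \<sigma>"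
      using mlcm_insert_absorb[OF \<rho>(3) e(2)] mlcm_insert_absorb[OF fin f(2)] ins by simp
    have "boundary A (same_mlcm l) b ?\<rho> =
        (\<Sum>j \<in> A - ?\<rho>. if j = e then ins_sign e ?\<rho> * b (insert e ?\<rho>) else 0)"
      unfolding boundary_def
    proof (rule sum.cong[OF refl])
      fix j assume "j \<in> A - ?\<rho>"
      then have "l j \<subseteq># mlcm l ?\<rho> \<longleftrightarrow> j = e"
        using only[of j] e(2) unfolding lcm by blast
      then show "ins_sign j ?\<rho> * same_mlcm l ?\<rho> (insert j ?\<rho>) * b (insert j ?\<rho>) =
          (if j = e then ins_sign e ?\<rho> * b (insert e ?\<rho>) else 0)"
        by (simp add: same_mlcm_insert[OF \<rho>(3)])
    qed
    also have "\<dots> = ins_sign e ?\<rho> * b (insert f \<sigma>)"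
      using A \<sigma>A e(1) ins by (subst sum.delta) auto
    finally have "ins_sign e ?\<rho> * b (insert f \<sigma>) = 0" using b[OF \<rho>(1)] \<rho>(2) by simp
    then have "ins_sign e ?\<rho> * (ins_sign e ?\<rho> * b (insert f \<sigma>)) = 0" by simp
    then show ?thesis by (simp add: mult.assoc[symmetric] ins_sign_square)
  qed
  have "boundary A (same_mlcm l) b \<sigma> = 0"
    unfolding boundary_def by (rule sum.neutral) (auto simp: same_mlcm_insert[OF fin] b0)
  then show False using b[OF \<sigma>] by simp
qed

section \<open>Ideals generated by monomials\<close>

lemma poly_ring_ideal_sum:
  fixes V :: "'x set" and J :: "('x, 'k::field) mpoly set"
  assumes "ideal J (poly_ring V)" "\<And>i. i \<in> A \<Longrightarrow> f i \<in> J"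
  shows "sum f A \<in> J"
proof -
  interpret ideal J "poly_ring V" by fact
  show ?thesis using assms(2)
    by (induction A rule: infinite_finite_induct)
      (use additive_subgroup.zero_closed[OF is_additive_subgroup]
           additive_subgroup.a_closed[OF is_additive_subgroup] in auto)
qed

lemma genideal_image_eq:
  fixes g :: "'a \<Rightarrow> ('x, 'k::field) mpoly"
  assumes A: "finite A" and g: "\<And>j. j \<in> A \<Longrightarrow> g j \<in> carrier (poly_ring V)"
  shows "Idl\<^bsub>poly_ring V\<^esub> (g ` A) = {\<Sum>j \<in> A. g j * v j | v. \<forall>j \<in> A. v j \<in> carrier (poly_ring V)}"
    (is "_ = ?J")
proof
  interpret cring "poly_ring V :: ('x, 'k) mpoly ring" by (rule poly_ring_cring)
  have mem: "(\<Sum>j \<in> A. g j * w j) \<in> ?J" if "\<forall>j \<in> A. w j \<in> carrier (poly_ring V)" for w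
    using that by blast
  have "ideal ?J (poly_ring V)"
  proof (rule idealI)
    show "ring (poly_ring V :: ('x, 'k) mpoly ring)" by (rule ring_axioms)
    show "subgroup ?J (add_monoid (poly_ring V))"
    proof
      show "?J \<subseteq> carrier (add_monoid (poly_ring V))"
        using g by (auto intro!: poly_ring_sum poly_ring_carrier_mult)
      show "\<one>\<^bsub>add_monoid (poly_ring V)\<^esub> \<in> ?J"
        by (auto intro!: exI[of _ "\<lambda>_. 0"] poly_ring_zero)
    next
      fix x y assume "x \<in> ?J" "y \<in> ?J"
      then obtain v w where v: "x = (\<Sum>j \<in> A. g j * v j)" "\<forall>j \<in> A. v j \<in> carrier (poly_ring V)"
        and w: "y = (\<Sum>j \<in> A. g j * w j)" "\<forall>j \<in> A. w j \<in> carrier (poly_ring V)" by blast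
      have "x + y = (\<Sum>j \<in> A. g j * (v j + w j))"
        by (simp add: v(1) w(1) distrib_left sum.distrib)
      moreover have "\<forall>j \<in> A. v j + w j \<in> carrier (poly_ring V)" using v(2) w(2) poly_ring_add by blast
      ultimately show "x \<otimes>\<^bsub>add_monoid (poly_ring V)\<^esub> y \<in> ?J"
        using mem[of "\<lambda>j. v j + w j"] by simp
    next
      fix x assume "x \<in> ?J"
      then obtain v where v: "x = (\<Sum>j \<in> A. g j * v j)" "\<forall>j \<in> A. v j \<in> carrier (poly_ring V)" by blast
      have "x \<in> carrier (poly_ring V)"
        unfolding v(1) using g v(2) by (intro poly_ring_sum poly_ring_carrier_mult) auto
      then have "\<ominus>\<^bsub>poly_ring V\<^esub> x = - x"
        by (intro minus_equality) (auto intro: poly_ring_uminus)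
      also have "- x = (\<Sum>j \<in> A. g j * (- v j))"
        by (simp add: v(1) sum_negf)
      finally have "\<ominus>\<^bsub>poly_ring V\<^esub> x = (\<Sum>j \<in> A. g j * (- v j))" .
      moreover have "\<forall>j \<in> A. - v j \<in> carrier (poly_ring V)" using v(2) poly_ring_uminus by blast
      ultimately show "inv\<^bsub>add_monoid (poly_ring V)\<^esub> x \<in> ?J"
        using mem[of "\<lambda>j. - v j"] by (simp only: a_inv_def)
    qed
  next
    fix a x :: "('x, 'k) mpoly" assume "a \<in> ?J" and x: "x \<in> carrier (poly_ring V)"
    then obtain v where v: "a = (\<Sum>j \<in> A. g j * v j)" "\<forall>j \<in> A. v j \<in> carrier (poly_ring V)" by blast
    have "x * a = (\<Sum>j \<in> A. g j * (x * v j))"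
      by (simp add: v(1) sum_distrib_left mult.left_commute)
    moreover have "\<forall>j \<in> A. x * v j \<in> carrier (poly_ring V)" using v(2) x poly_ring_carrier_mult by blast
    ultimately have *: "x * a \<in> ?J" using mem[of "\<lambda>j. x * v j"] by simp
    then show "x \<otimes>\<^bsub>poly_ring V\<^esub> a \<in> ?J" by simp
    show "a \<otimes>\<^bsub>poly_ring V\<^esub> x \<in> ?J" using * by (simp add: mult.commute)
  qed
  moreover have "g ` A \<subseteq> ?J"
  proof (rule image_subsetI)
    fix i assume i: "i \<in> A"
    have "(\<Sum>j \<in> A. g j * of_bool (j = i)) = (\<Sum>j \<in> A. if j = i then g i else 0)"
      by (rule sum.cong) auto
    then have "g i = (\<Sum>j \<in> A. g j * of_bool (j = i))"
      using i A by simp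
    moreover have "\<forall>j \<in> A. (of_bool (j = i) :: ('x, 'k) mpoly) \<in> carrier (poly_ring V)"
      using poly_ring_zero poly_ring_one by auto
    ultimately show "g i \<in> ?J" using mem[of "\<lambda>j. of_bool (j = i)"] by simp
  qed
  ultimately show "Idl\<^bsub>poly_ring V\<^esub> (g ` A) \<subseteq> ?J" by (rule genideal_minimal)
  show "?J \<subseteq> Idl\<^bsub>poly_ring V\<^esub> (g ` A)"
  proof
    have sub: "g ` A \<subseteq> carrier (poly_ring V)" using g by blast
    interpret I: ideal "Idl\<^bsub>poly_ring V\<^esub> (g ` A)" "poly_ring V :: ('x, 'k) mpoly ring"
      using sub by (rule genideal_ideal)
    fix x assume "x \<in> ?J"
    then obtain v where v: "x = (\<Sum>j \<in> A. g j * v j)" "\<forall>j \<in> A. v j \<in> carrier (poly_ring V)" by blast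
    have "g j * v j \<in> Idl\<^bsub>poly_ring V\<^esub> (g ` A)" if "j \<in> A" for j
      using I.I_r_closed[of "g j" "v j"] genideal_self[OF sub] that v(2) by auto
    then show "x \<in> Idl\<^bsub>poly_ring V\<^esub> (g ` A)"
      unfolding v(1) by (rule poly_ring_ideal_sum[OF I.ideal_axioms])
  qed
qed

lemma genideal_prod_eq:
  fixes g :: "'a::linorder \<Rightarrow> ('x, 'k::field) mpoly"
  assumes A: "finite A" and g: "\<And>j. j \<in> A \<Longrightarrow> g j \<in> carrier (poly_ring V)"
  shows "(Idl\<^bsub>poly_ring V\<^esub> (g ` A)) \<cdot>\<^bsub>poly_ring V\<^esub> (Idl\<^bsub>poly_ring V\<^esub> (g ` A)) =
    Idl\<^bsub>poly_ring V\<^esub> ((\<lambda>(i, j). g i * g j) ` {(i, j). i \<in> A \<and> j \<in> A \<and> i \<le> j})"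
proof
  let ?I = "Idl\<^bsub>poly_ring V\<^esub> (g ` A)" and ?S = "(\<lambda>(i, j). g i * g j) ` {(i, j). i \<in> A \<and> j \<in> A \<and> i \<le> j}"
  interpret cring "poly_ring V :: ('x, 'k) mpoly ring" by (rule poly_ring_cring)
  have sub: "g ` A \<subseteq> carrier (poly_ring V)" using g by blast
  have I: "ideal ?I (poly_ring V)" using sub by (rule genideal_ideal)
  have S: "?S \<subseteq> carrier (poly_ring V)" using g by (auto intro!: poly_ring_carrier_mult)
  interpret J: ideal "Idl\<^bsub>poly_ring V\<^esub> ?S" "poly_ring V :: ('x, 'k) mpoly ring"
    using S by (rule genideal_ideal)
  have idl: "?I = {\<Sum>j \<in> A. g j * v j | v. \<forall>j \<in> A. v j \<in> carrier (poly_ring V)}"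
    using A g by (rule genideal_image_eq)
  have gg: "g i * g j \<in> Idl\<^bsub>poly_ring V\<^esub> ?S" if "i \<in> A" "j \<in> A" for i j
  proof -
    have "g i * g j = g (min i j) * g (max i j)" by (cases "i \<le> j") (auto simp: min_def max_def mult.commute)
    moreover have "(min i j, max i j) \<in> {(i, j). i \<in> A \<and> j \<in> A \<and> i \<le> j}"
      using that by (auto simp: min_def max_def)
    ultimately have "g i * g j \<in> ?S" by (auto intro!: image_eqI[of _ _ "(min i j, max i j)"])
    then show ?thesis using genideal_self[OF S] by blast
  qed
  show "?I \<cdot>\<^bsub>poly_ring V\<^esub> ?I \<subseteq> Idl\<^bsub>poly_ring V\<^esub> ?S"
  proof
    fix x assume "x \<in> ?I \<cdot>\<^bsub>poly_ring V\<^esub> ?I"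
    then show "x \<in> Idl\<^bsub>poly_ring V\<^esub> ?S"
    proof (induction rule: ideal_prod.induct)
      case (prod a b)
      then obtain v w where v: "a = (\<Sum>j \<in> A. g j * v j)" "\<forall>j \<in> A. v j \<in> carrier (poly_ring V)"
        and w: "b = (\<Sum>j \<in> A. g j * w j)" "\<forall>j \<in> A. w j \<in> carrier (poly_ring V)"
        unfolding idl by blast
      have "a * b = (\<Sum>i \<in> A. \<Sum>j \<in> A. (g i * g j) * (v i * w j))"
        unfolding v(1) w(1) sum_product by (intro sum.cong refl) (simp add: mult_ac)
      moreover have "(g i * g j) * (v i * w j) \<in> Idl\<^bsub>poly_ring V\<^esub> ?S" if "i \<in> A" "j \<in> A" for i j
        using J.I_r_closed[OF gg[OF that], of "v i * w j"] v(2) w(2) that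
          poly_ring_carrier_mult[of "v i" V "w j"] by auto
      ultimately have "a * b \<in> Idl\<^bsub>poly_ring V\<^esub> ?S"
        by (auto intro!: poly_ring_ideal_sum[OF J.ideal_axioms])
      then show ?case by simp
    next
      case (sum a b)
      then show ?case using J.a_closed by blast
    qed
  qed
  show "Idl\<^bsub>poly_ring V\<^esub> ?S \<subseteq> ?I \<cdot>\<^bsub>poly_ring V\<^esub> ?I"
  proof (rule genideal_minimal)
    show "ideal (?I \<cdot>\<^bsub>poly_ring V\<^esub> ?I) (poly_ring V)" using I I by (rule ideal_prod_is_ideal)
    show "?S \<subseteq> ?I \<cdot>\<^bsub>poly_ring V\<^esub> ?I"
    proof clarify
      fix i j assume "i \<in> A" "j \<in> A"
      then have "g i \<in> ?I" "g j \<in> ?I" using genideal_self[OF sub] by auto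
      then show "g i * g j \<in> ?I \<cdot>\<^bsub>poly_ring V\<^esub> ?I"
        using ideal_prod.prod[of "g i" ?I "g j" ?I "poly_ring V"] by simp
    qed
  qed
qed

definition sym_pairs :: "'a::linorder set \<Rightarrow> ('a \<times> 'a) set" where
  "sym_pairs A = {(i, j). i \<in> A \<and> j \<in> A \<and> i \<le> j}"

lemma finite_sym_pairs [simp]: "finite A \<Longrightarrow> finite (sym_pairs A)"
  by (rule finite_subset[of _ "A \<times> A"]) (auto simp: sym_pairs_def)

lemma genideal_monomials_square:
  fixes l :: "'a::linorder \<Rightarrow> 'x multiset"
  assumes A: "finite A" and V: "\<And>j. j \<in> A \<Longrightarrow> set_mset (l j) \<subseteq> V"
    and I: "(I :: ('x, 'k::field) mpoly set) = Idl\<^bsub>poly_ring V\<^esub> ((\<lambda>j. monomial (l j)) ` A)"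
  shows "I \<cdot>\<^bsub>poly_ring V\<^esub> I = Idl\<^bsub>poly_ring V\<^esub> ((\<lambda>p. monomial (l (fst p) + l (snd p))) ` sym_pairs A)"
proof -
  have "I \<cdot>\<^bsub>poly_ring V\<^esub> I = Idl\<^bsub>poly_ring V\<^esub>
      ((\<lambda>(i, j). monomial (l i) * monomial (l j)) ` {(i, j). i \<in> A \<and> j \<in> A \<and> i \<le> j})"
    unfolding I using A by (rule genideal_prod_eq) (simp add: V monomial_def poly_ring_single)
  also have "(\<lambda>(i, j). monomial (l i) * monomial (l j)) ` {(i, j). i \<in> A \<and> j \<in> A \<and> i \<le> j} =
      ((\<lambda>p. monomial (l (fst p) + l (snd p))) ` sym_pairs A :: ('x, 'k) mpoly set)"
    unfolding sym_pairs_def by (intro image_cong refl) (auto simp: monomial_def mult_single)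
  finally show ?thesis .
qed

lemma betti_monomial_ideal_eq_0_iff:
  fixes l :: "'a::linorder \<Rightarrow> 'x multiset"
  assumes A: "finite A" and V: "\<And>j. j \<in> A \<Longrightarrow> set_mset (l j) \<subseteq> V"
  shows "betti V (Idl\<^bsub>poly_ring V\<^esub> ((\<lambda>j. monomial (l j)) ` A) :: ('x, 'k) mpoly set) (Suc i) = 0 \<longleftrightarrow>
    exact_tensor (taylor A l :: nat \<Rightarrow> ('x, 'k::field) mpoly mat) (Suc i)"
proof -
  have "(Idl\<^bsub>poly_ring V\<^esub> ((\<lambda>j. monomial (l j)) ` A) :: ('x, 'k) mpoly set) =
      {\<Sum>j \<in> A. monomial (l j) * v j | v. \<forall>j \<in> A. v j \<in> carrier (poly_ring V)}"
    using A by (rule genideal_image_eq) (simp add: V monomial_def poly_ring_single)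
  moreover have "free_resolution V
      {\<Sum>j \<in> A. monomial (l j) * v j | v. \<forall>j \<in> A. v j \<in> carrier (poly_ring V)}
      (taylor A l :: nat \<Rightarrow> ('x, 'k) mpoly mat)"
    using A V by (rule free_resolution_taylor)
  ultimately show ?thesis by (simp only: betti_eq_0_iff)
qed

text \<open>Sets of size \<open>Suc i\<close> index the basis in degree \<open>i\<close>. If every
  set with more than \<open>Suc n\<close> elements belongs to a pairing, all cycles above degree
  \<open>n\<close> are boundaries.\<close>

lemma proj_dim_monomial_ideal_le:
  fixes P :: "'t::linorder \<Rightarrow> 'a::linorder set \<Rightarrow> bool" and l :: "'a \<Rightarrow> 'x multiset"
  assumes A: "finite A" and V: "\<And>j. j \<in> A \<Longrightarrow> set_mset (l j) \<subseteq> V"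
    and T: "finite T"
    and f: "\<And>t. t \<in> T \<Longrightarrow> f t \<in> A"
    and up: "\<And>t \<sigma> \<tau>. t \<in> T \<Longrightarrow> P t \<sigma> \<Longrightarrow> \<sigma> \<subseteq> \<tau> \<Longrightarrow> \<tau> \<subseteq> A \<Longrightarrow> P t \<tau>"
    and rem: "\<And>t \<sigma>. t \<in> T \<Longrightarrow> \<sigma> \<subseteq> A \<Longrightarrow> P t \<sigma> \<Longrightarrow> P t (\<sigma> - {f t})"
    and dvd: "\<And>t \<sigma>. t \<in> T \<Longrightarrow> \<sigma> \<subseteq> A \<Longrightarrow> P t \<sigma> \<Longrightarrow> l (f t) \<subseteq># mlcm l \<sigma>"
    and first: "\<And>t t' \<sigma>. t \<in> T \<Longrightarrow> \<sigma> \<subseteq> A \<Longrightarrow> P t \<sigma> \<Longrightarrow> t' \<in> T \<Longrightarrow> t' < t \<Longrightarrow>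
      P t' (insert (f t) \<sigma>) \<Longrightarrow> \<exists>t'' \<in> T. t'' < t \<and> P t'' \<sigma>"
    and large: "\<And>\<sigma>. \<sigma> \<subseteq> A \<Longrightarrow> Suc n < card \<sigma> \<Longrightarrow> \<exists>t \<in> T. P t \<sigma>"
  shows "proj_dim V (Idl\<^bsub>poly_ring V\<^esub> ((\<lambda>j. monomial (l j)) ` A) :: ('x, 'k::field) mpoly set) \<le> enat n"
proof (rule proj_dim_le)
  fix i assume "n < i"
  then obtain k where i: "i = Suc k" by (cases i) auto
  have "exact_tensor (taylor A l :: nat \<Rightarrow> ('x, 'k) mpoly mat) i"
    unfolding exact_tensor_taylor_iff[OF A]
  proof (intro allI impI)
    fix c :: "'a set \<Rightarrow> 'k" assume "\<forall>\<tau> \<in> subsets_card A i. boundary A (same_mlcm l) c \<tau> = 0"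
    then have cycle: "boundary A (same_mlcm l) c \<tau> = 0" if "\<tau> \<in> subsets_card A i" for \<tau>
      using that by blast
    have "\<exists>b. \<forall>\<sigma> \<in> subsets_card A (Suc i).
        (\<exists>t \<in> T. P t \<sigma>) \<longrightarrow> boundary A (same_mlcm l) b \<sigma> = c \<sigma>"
      by (rule toggle_boundary[where f = f]) (fact A cycle T f up rem dvd first)+
    moreover have "\<exists>t \<in> T. P t \<sigma>" if "\<sigma> \<in> subsets_card A (Suc i)" for \<sigma>
      using large[of \<sigma>] that \<open>n < i\<close> by (simp add: subsets_card_def)
    ultimately show "\<exists>b. \<forall>\<sigma> \<in> subsets_card A (Suc i). boundary A (same_mlcm l) b \<sigma> = c \<sigma>" by blast
  qed
  then show "betti V (Idl\<^bsub>poly_ring V\<^esub> ((\<lambda>j. monomial (l j)) ` A) :: ('x, 'k) mpoly set) i = 0"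
    unfolding i by (subst betti_monomial_ideal_eq_0_iff) (use A V in auto)
qed

lemma proj_dim_monomial_ideal_ge:
  fixes l :: "'a::linorder \<Rightarrow> 'x multiset"
  assumes A: "finite A" and V: "\<And>j. j \<in> A \<Longrightarrow> set_mset (l j) \<subseteq> V"
    and \<sigma>: "\<sigma> \<subseteq> A" "card \<sigma> = Suc n" "n \<noteq> 0"
    and facet: "\<And>j. j \<in> \<sigma> \<Longrightarrow> \<not> l j \<subseteq># mlcm l (\<sigma> - {j})"
    and cofacet: "\<And>f. f \<in> A - \<sigma> \<Longrightarrow> l f \<subseteq># mlcm l \<sigma> \<Longrightarrow>
      \<exists>e \<in> \<sigma>. l e \<subseteq># mlcm l (insert f \<sigma> - {e}) \<and>
        (\<forall>g \<in> A - (insert f \<sigma> - {e}). l g \<subseteq># mlcm l \<sigma> \<longrightarrow> g = e)"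
  shows "enat n \<le> proj_dim V (Idl\<^bsub>poly_ring V\<^esub> ((\<lambda>j. monomial (l j)) ` A) :: ('x, 'k::field) mpoly set)"
proof (rule proj_dim_ge)
  obtain k where n: "n = Suc k" using \<sigma>(3) by (cases n) auto
  have "\<not> exact_tensor (taylor A l :: nat \<Rightarrow> ('x, 'k) mpoly mat) n"
    by (rule not_exact_taylor[OF A _ facet cofacet]) (use \<sigma> in \<open>auto simp: subsets_card_def\<close>)
  then show "betti V (Idl\<^bsub>poly_ring V\<^esub> ((\<lambda>j. monomial (l j)) ` A) :: ('x, 'k) mpoly set) n \<noteq> 0"
    unfolding n by (subst betti_monomial_ideal_eq_0_iff) (use A V in auto)
qed

section \<open>Upper bounds\<close>

text \<open>One pairing suffices: toggle \<open>p\<close> on the sets containing \<open>K\<close>.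
  At most the full set \<open>A\<close> lies above the bound, and it contains
  \<open>K\<close>.\<close>

lemma proj_dim_le_card_minus_2:
  fixes l :: "'a::linorder \<Rightarrow> 'x multiset"
  assumes A: "finite A" and V: "\<And>j. j \<in> A \<Longrightarrow> set_mset (l j) \<subseteq> V"
    and p: "p \<in> A" "p \<notin> K" and K: "K \<subseteq> A" and dvd: "l p \<subseteq># mlcm l K"
  shows "proj_dim V (Idl\<^bsub>poly_ring V\<^esub> ((\<lambda>j. monomial (l j)) ` A) :: ('x, 'k::field) mpoly set)
    \<le> enat (card A - 2)"
proof (rule proj_dim_monomial_ideal_le[where T = "{0 :: nat}" and P = "\<lambda>_ \<sigma>. K \<subseteq> \<sigma>" and f = "\<lambda>_. p", OF A V])
  fix \<sigma> assume "\<sigma> \<subseteq> A" "K \<subseteq> \<sigma>"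
  then have "mlcm l K \<subseteq># mlcm l \<sigma>" using A by (intro mlcm_mono) (auto intro: finite_subset)
  with dvd show "l p \<subseteq># mlcm l \<sigma>" by (rule subset_mset.order_trans)
next
  fix \<sigma> assume \<sigma>: "\<sigma> \<subseteq> A" "Suc (card A - 2) < card \<sigma>"
  have "K \<subseteq> \<sigma>"
  proof
    fix k assume k: "k \<in> K"
    show "k \<in> \<sigma>"
    proof (rule ccontr)
      assume "k \<notin> \<sigma>"
      then have "card \<sigma> \<le> card (A - {k})" using \<sigma>(1) A by (intro card_mono) auto
      then have "card \<sigma> \<le> card A - 1" using k K A by (simp add: card_Diff_singleton subsetD)
      then show False using \<sigma>(2) by linarith
    qed
  qed
  then show "\<exists>t \<in> {0 :: nat}. K \<subseteq> \<sigma>" by simp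
qed (use p K in auto)

section \<open>Pairings for the square of the ideal, indexed by unordered pairs of
  generators\<close>

definition pr :: "'a::linorder \<Rightarrow> 'a \<Rightarrow> 'a \<times> 'a" where
  "pr i j = (min i j, max i j)"

lemma pr_eq_iff: "pr i j = pr k l \<longleftrightarrow> i = k \<and> j = l \<or> i = l \<and> j = k"
  by (auto simp: pr_def min_def max_def split: if_splits)

lemma pr_le: "i \<le> j \<Longrightarrow> pr i j = (i, j)"
  by (simp add: pr_def)

lemma pr_sym_pairs: "i \<in> A \<Longrightarrow> j \<in> A \<Longrightarrow> pr i j \<in> sym_pairs A"
  by (auto simp: pr_def sym_pairs_def min_def max_def)

definition strict_pairs :: "'a::linorder set \<Rightarrow> ('a \<times> 'a) set" where
  "strict_pairs A = {(i, j). i \<in> A \<and> j \<in> A \<and> i < j}"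

lemma strict_pairs_subset: "strict_pairs A \<subseteq> sym_pairs A"
  by (auto simp: strict_pairs_def sym_pairs_def)

lemma sym_pairs_diff_strict: "e \<in> sym_pairs A \<Longrightarrow> e \<notin> strict_pairs A \<Longrightarrow> \<exists>i \<in> A. e = (i, i)"
  by (auto simp: strict_pairs_def sym_pairs_def order.strict_iff_order)

lemma finite_strict_pairs: "finite A \<Longrightarrow> finite (strict_pairs A)"
  using strict_pairs_subset finite_sym_pairs by (rule finite_subset)

lemma pr_strict_pairs: "i \<in> A \<Longrightarrow> j \<in> A \<Longrightarrow> i \<noteq> j \<Longrightarrow> pr i j \<in> strict_pairs A"
  by (auto simp: pr_def strict_pairs_def min_def max_def)

lemma card_strict_pairs:
  assumes "finite A"
  shows "card (strict_pairs A) = card A choose 2"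
proof -
  have "bij_betw (\<lambda>(i, j). {i, j}) (strict_pairs A) {B. B \<subseteq> A \<and> card B = 2}"
  proof (rule bij_betwI')
    fix y assume "y \<in> {B. B \<subseteq> A \<and> card B = 2}"
    then obtain i j where "y = {i, j}" "i \<noteq> j" "i \<in> A" "j \<in> A" by (auto simp: card_2_iff)
    then show "\<exists>x \<in> strict_pairs A. y = (case x of (i, j) \<Rightarrow> {i, j})"
      by (intro bexI[of _ "pr i j"] pr_strict_pairs) (auto simp: pr_def min_def max_def)
  qed (auto simp: strict_pairs_def doubleton_eq_iff)
  then show ?thesis using n_subsets[OF assms, of 2] by (simp add: bij_betw_same_card)
qed

definition pair_sum :: "('a \<Rightarrow> 'x multiset) \<Rightarrow> 'a \<times> 'a \<Rightarrow> 'x multiset" where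
  "pair_sum l e = l (fst e) + l (snd e)"

lemma count_pair_sum_pr: "count (pair_sum l (pr i j)) x = count (l i) x + count (l j) x"
  by (auto simp: pair_sum_def pr_def min_def max_def)

text \<open>
  The conditions under which the pair \<open>pr i j\<close> is added or removed. In the case \<open>\<not> b\<close> \<open>\<sigma>\<close> contains the square of
  the generator \<open>i\<close> and a product of \<open>j\<close> with some generator other than \<open>i\<close>; the sets without this
  property are the faces of the complex \<open>\<L>\<^sup>2\<close> that resolves the square of every square-free
  monomial ideal. The case \<open>b\<close> uses the given divisibility, for \<open>i = p\<close> and \<open>j \<notin> K\<close>.
\<close>

definition toggle_cond :: "'a::linorder set \<Rightarrow> bool \<times> 'a \<times> 'a \<Rightarrow> ('a \<times> 'a) set \<Rightarrow> bool" where
  "toggle_cond K t \<sigma> = (case t of (b, i, j) \<Rightarrow>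
     if b then (\<exists>k \<in> K. pr k j \<in> \<sigma>) \<and> (\<forall>k \<in> K. pr k j \<in> \<sigma> \<or> pr i k \<in> \<sigma>)
     else pr i i \<in> \<sigma> \<and> (\<exists>k. k \<noteq> i \<and> pr j k \<in> \<sigma>))"

lemma toggle_cond_simps:
  "toggle_cond K (True, i, j) \<sigma> \<longleftrightarrow> (\<exists>k \<in> K. pr k j \<in> \<sigma>) \<and> (\<forall>k \<in> K. pr k j \<in> \<sigma> \<or> pr i k \<in> \<sigma>)"
  "toggle_cond K (False, i, j) \<sigma> \<longleftrightarrow> pr i i \<in> \<sigma> \<and> (\<exists>k. k \<noteq> i \<and> pr j k \<in> \<sigma>)"
  by (simp_all add: toggle_cond_def)

text \<open>The pairings are applied in the lexicographic order of these triples. As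
  \<open>False < True\<close>, those through a square come before those through the given
  divisibility.\<close>

definition toggle_index :: "'a::linorder set \<Rightarrow> 'a \<Rightarrow> 'a set \<Rightarrow> (bool \<times> 'a \<times> 'a) set" where
  "toggle_index A p R = {(False, i, j) | i j. i \<in> A \<and> j \<in> A \<and> i \<noteq> j} \<union> {(True, p, j) | j. j \<in> R}"

lemma toggle_index_cases:
  assumes "t \<in> toggle_index A p R"
  obtains (square) i j where "t = (False, i, j)" "i \<in> A" "j \<in> A" "i \<noteq> j"
    | (product) j where "t = (True, p, j)" "j \<in> R"
  using assms by (auto simp: toggle_index_def)

text \<open>Adding a product matters to an earlier square pairing only if it is the new witness
  \<open>pr j' k\<close>. Its factors then differ from \<open>i'\<close>, and a substitute witness
  for the square of \<open>i'\<close> can be found in \<open>\<sigma>\<close>.\<close>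

lemma toggle_cond_first:
  assumes K: "K \<subseteq> A" "p \<notin> K" "2 \<le> card K" "p \<in> A" and R: "R = A - insert p K"
    and t: "t \<in> toggle_index A p R" "toggle_cond K t \<sigma>"
    and t': "t' \<in> toggle_index A p R" "t' < t" "toggle_cond K t' (insert (pr (fst (snd t)) (snd (snd t))) \<sigma>)"
  shows "\<exists>t'' \<in> toggle_index A p R. t'' < t \<and> toggle_cond K t'' \<sigma>"
  using t(1)
proof (cases rule: toggle_index_cases)
  case (square i j)
  then obtain i' j' where t'_eq: "t' = (False, i', j')" and i': "i' \<in> A" "j' \<in> A" "i' \<noteq> j'"
    using t'(1,2) by (auto simp: toggle_index_def less_prod_def)
  obtain k where sq: "pr i' i' \<in> \<sigma>" and k: "k \<noteq> i'" "pr j' k \<in> insert (pr i j) \<sigma>"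
    using t'(3) square by (auto simp: t'_eq toggle_cond_simps pr_eq_iff)
  show ?thesis
  proof (cases "pr j' k \<in> \<sigma>")
    case True
    then have "toggle_cond K t' \<sigma>" using sq k(1) by (auto simp: t'_eq toggle_cond_simps)
    then show ?thesis using t'(1,2) by blast
  next
    case False
    then have "i' \<noteq> i" using k i'(3) by (auto simp: pr_eq_iff)
    then have lt: "i' < i" using t'(2) by (auto simp: t'_eq square(1) less_prod_def)
    \<comment> \<open>The square of \<open>i\<close>, present because of \<open>t\<close>, is a
      product of \<open>i\<close> with a generator other than \<open>i'\<close>.\<close>
    have "toggle_cond K (False, i', i) \<sigma>"
      using sq t(2) \<open>i' \<noteq> i\<close> by (auto simp: square(1) toggle_cond_simps)
    moreover have "(False, i', i) \<in> toggle_index A p R" "(False, i', i) < t"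
      using lt i' square by (auto simp: toggle_index_def less_prod_def)
    ultimately show ?thesis by blast
  qed
next
  case (product j)
  have j: "j \<in> A" "j \<noteq> p" "j \<notin> K" using product(2) R by auto
  show ?thesis
    using t'(1)
  proof (cases rule: toggle_index_cases)
    case (square i' j')
    obtain k where sq: "pr i' i' \<in> \<sigma>" and k: "k \<noteq> i'" "pr j' k \<in> insert (pr p j) \<sigma>"
      using t'(3) j by (auto simp: square(1) product(1) toggle_cond_simps pr_eq_iff)
    show ?thesis
    proof (cases "pr j' k \<in> \<sigma>")
      case True
      then have "toggle_cond K t' \<sigma>" using sq k(1) by (auto simp: square(1) toggle_cond_simps)
      then show ?thesis using t'(1,2) by blast
    next
      case False
      then have ne: "i' \<noteq> p" "i' \<noteq> j" using k square(4) by (auto simp: pr_eq_iff)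
      \<comment> \<open>As \<open>K\<close> has two elements, one differs from \<open>i'\<close>.
        Its product with \<open>j\<close> or with \<open>p\<close> lies in \<open>\<sigma>\<close>
        and is the substitute witness.\<close>
      obtain k0 where k0: "k0 \<in> K" "k0 \<noteq> i'"
      proof -
        have "\<not> K \<subseteq> {i'}" using K(3) card_mono[of "{i'}" K] by auto
        then show thesis using that by blast
      qed
      then have "pr k0 j \<in> \<sigma> \<or> pr p k0 \<in> \<sigma>"
        using t(2) by (auto simp: product(1) toggle_cond_simps)
      then have "toggle_cond K (False, i', j) \<sigma> \<or> toggle_cond K (False, i', p) \<sigma>"
        using sq k0(2) by (auto simp: toggle_cond_simps pr_def min.commute max.commute)
      moreover have "(False, i', j) \<in> toggle_index A p R" "(False, i', p) \<in> toggle_index A p R"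
        using ne square j K(4) by (auto simp: toggle_index_def)
      moreover have "(False, i', x) < t" for x
        by (simp add: product(1) less_prod_def)
      ultimately show ?thesis by blast
    qed
  next
    case (product j')
    have "j' \<notin> K" "j' \<noteq> p" "j' \<noteq> j"
      using product \<open>t = _\<close> t'(2) R by (auto simp: less_prod_def)
    \<comment> \<open>Since \<open>p\<close> and \<open>j\<close> are outside \<open>K\<close>, the
      added \<open>pr p j\<close> is neither a \<open>pr k j'\<close> nor a \<open>pr p k\<close>
      with \<open>k\<close> in \<open>K\<close>.\<close>
    then have "toggle_cond K t' \<sigma>"
      using t'(3) j K(2) by (auto simp: product(1) \<open>t = _\<close> toggle_cond_simps pr_eq_iff)
    then show ?thesis using t'(1,2) by blast
  qed
qed

text \<open>One variable \<open>x\<close> at a time, all exponents of generators being at most 1.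
  Square case: if \<open>x\<close> divides \<open>m_i\<close>, then \<open>m_i^2\<close> has
  exponent 2; otherwise \<open>m_j m_k\<close> suffices. Product case: if \<open>x\<close> does not
  divide \<open>m_p\<close>, then \<open>m_k0 m_j\<close> suffices; otherwise \<open>x\<close>
  divides some \<open>m_k\<close> with \<open>k\<close> in \<open>K\<close>, which replaces
  \<open>m_p\<close> in \<open>m_k m_j\<close> or \<open>m_j\<close> in
  \<open>m_p m_k\<close>.\<close>

lemma toggle_cond_dvd:
  fixes l :: "'a::linorder \<Rightarrow> 'x multiset"
  assumes A: "finite A" and sqf: "\<And>j. j \<in> A \<Longrightarrow> squarefree_monomial (l j)"
    and K: "K \<subseteq> A" and p: "p \<in> A" and dvd: "l p \<subseteq># mlcm l K"
    and t: "t \<in> toggle_index A p R" "toggle_cond K t \<sigma>" and \<sigma>: "\<sigma> \<subseteq> sym_pairs A"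
  shows "pair_sum l (pr (fst (snd t)) (snd (snd t))) \<subseteq># mlcm (pair_sum l) \<sigma>"
proof -
  have fin: "finite \<sigma>" using \<sigma> A finite_subset finite_sym_pairs by blast
  have finK: "finite K" using A K by (rule rev_finite_subset)
  have le1: "count (l j) x \<le> 1" if "j \<in> A" for j x
    using sqf[OF that] by (simp add: squarefree_monomial_def)
  show ?thesis
    unfolding subseteq_mlcm_iff[OF fin]
  proof (intro allI disjI2)
    fix x
    show "\<exists>e \<in> \<sigma>. count (pair_sum l (pr (fst (snd t)) (snd (snd t)))) x \<le> count (pair_sum l e) x"
      using t(1)
    proof (cases rule: toggle_index_cases)
      case (square i j)
      then obtain k where k: "pr i i \<in> \<sigma>" "pr j k \<in> \<sigma>" using t(2) by (auto simp: toggle_cond_simps)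
      show ?thesis
      proof (cases "count (l i) x = 0")
        case True
        then show ?thesis using k(2)
          by (intro bexI[of _ "pr j k"]) (simp_all add: square(1) count_pair_sum_pr)
      next
        case False
        then have "count (l j) x \<le> count (l i) x" using le1[OF square(3), of x] by linarith
        then show ?thesis using k(1)
          by (intro bexI[of _ "pr i i"]) (simp_all add: square(1) count_pair_sum_pr)
      qed
    next
      case (product j)
      then obtain k0 where k0: "k0 \<in> K" "pr k0 j \<in> \<sigma>"
        and all: "\<And>k. k \<in> K \<Longrightarrow> pr k j \<in> \<sigma> \<or> pr p k \<in> \<sigma>"
        using t(2) by (auto simp: toggle_cond_simps)
      have jA: "count (l j) x \<le> 1"
      proof -
        have "j \<in> A" using k0(2) \<sigma> by (auto simp: pr_def sym_pairs_def min_def max_def split: if_splits)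
        then show ?thesis by (rule le1)
      qed
      show ?thesis
      proof (cases "count (l p) x = 0")
        case True
        then show ?thesis using k0(2)
          by (intro bexI[of _ "pr k0 j"]) (simp_all add: product(1) count_pair_sum_pr)
      next
        case False
        then obtain k where k: "k \<in> K" "count (l p) x \<le> count (l k) x"
          using subseteq_mlcm_iff[OF finK, THEN iffD1, OF dvd] by metis
        from all[OF k(1)] show ?thesis
        proof
          assume "pr k j \<in> \<sigma>"
          then show ?thesis using k(2)
            by (intro bexI[of _ "pr k j"]) (simp_all add: product(1) count_pair_sum_pr)
        next
          assume "pr p k \<in> \<sigma>"
          moreover have "count (l j) x \<le> count (l k) x" using k(2) False jA by linarith
          ultimately show ?thesis
            by (intro bexI[of _ "pr p k"]) (simp_all add: product(1) count_pair_sum_pr)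
        qed
      qed
    qed
  qed
qed

text \<open>For each \<open>j\<close> in \<open>R\<close> some product \<open>pr (h j) j\<close> is
  missing, and these are distinct because \<open>h j\<close> is in \<open>K\<close> and
  \<open>j\<close> is not. One more is missing: either some \<open>pr p k\<close>, or else all
  \<open>pr k j\<close> for a fixed \<open>j\<close>, and \<open>K\<close> offers a second
  \<open>k\<close> besides \<open>h j\<close>.\<close>

lemma card_missing_pairs:
  assumes A: "finite A" and K: "K \<subseteq> A" "p \<notin> K" "2 \<le> card K" "p \<in> A"
    and R: "R = A - insert p K" "R \<noteq> {}"
    and none: "\<And>j. j \<in> R \<Longrightarrow> \<not> toggle_cond K (True, p, j) \<sigma>"
  shows "Suc (card R) \<le> card (strict_pairs A - \<sigma>)"
proof -
  have finK: "finite K" using A K(1) by (rule rev_finite_subset)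
  have finM: "finite (strict_pairs A - \<sigma>)"
    using A by (simp add: finite_strict_pairs)
  have dis: "j \<notin> K" "j \<noteq> p" "j \<in> A" if "j \<in> R" for j using that R(1) by auto
  have "\<exists>k \<in> K. pr k j \<notin> \<sigma>" if "j \<in> R" for j
  proof -
    have "K \<noteq> {}" using K(3) by auto
    then show ?thesis using none[OF that] by (auto simp: toggle_cond_simps)
  qed
  then obtain h where h: "\<And>j. j \<in> R \<Longrightarrow> h j \<in> K" "\<And>j. j \<in> R \<Longrightarrow> pr (h j) j \<notin> \<sigma>" by metis
  let ?N = "(\<lambda>j. pr (h j) j) ` R"
  have inj: "inj_on (\<lambda>j. pr (h j) j) R"
    using h(1) dis by (force simp: inj_on_def pr_eq_iff)
  have sub: "?N \<subseteq> strict_pairs A - \<sigma>"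
    using h dis K(1) by (force intro!: pr_strict_pairs)
  have "\<exists>e. e \<in> strict_pairs A - \<sigma> - ?N"
  proof (cases "\<exists>k \<in> K. pr p k \<notin> \<sigma>")
    case True
    then obtain k where k: "k \<in> K" "pr p k \<notin> \<sigma>" by blast
    then have "pr p k \<in> strict_pairs A" using K by (intro pr_strict_pairs) auto
    moreover have "p \<notin> R" using dis(2) by blast
    then have "pr p k \<notin> ?N" using h(1) K(2) by (auto simp: pr_eq_iff)
    ultimately show ?thesis using k(2) by blast
  next
    case False
    obtain j where j: "j \<in> R" using R(2) by blast
    have all: "pr k j \<notin> \<sigma>" if "k \<in> K" for k
      using none[OF j] False that by (auto simp: toggle_cond_simps)
    obtain k where k: "k \<in> K" "k \<noteq> h j"
    proof -
      have "\<not> K \<subseteq> {h j}" using K(3) card_mono[of "{h j}" K] by auto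
      then show thesis using that by blast
    qed
    then have "pr k j \<in> strict_pairs A" using dis[OF j] K(1) by (intro pr_strict_pairs) auto
    moreover have "pr k j \<notin> ?N" using k dis j by (auto simp: pr_eq_iff)
    ultimately show ?thesis using all[OF k(1)] by blast
  qed
  then have "?N \<subset> strict_pairs A - \<sigma>" using sub by blast
  then have "card ?N < card (strict_pairs A - \<sigma>)" using finM by (rule psubset_card_mono[rotated])
  then show ?thesis by (simp add: card_image[OF inj])
qed

lemma choose_two_ge: "3 \<le> q \<Longrightarrow> q \<le> q choose 2"
proof (induction q rule: dec_induct)
  case base
  then show ?case by (simp add: choose_two)
next
  case (step q)
  then show ?case by (simp add: numeral_2_eq_2)
qed

lemma choose_two_ge_double: "4 \<le> q \<Longrightarrow> 2 * q - 2 \<le> q choose 2"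
proof (induction q rule: dec_induct)
  case base
  then show ?case by (simp add: choose_two)
next
  case (step q)
  then show ?case by (simp add: numeral_2_eq_2)
qed

lemma proj_dim_square_le:
  fixes l :: "'a::linorder \<Rightarrow> 'x multiset" and I :: "('x, 'k::field) mpoly set"
  assumes A: "finite A" and V: "\<And>j. j \<in> A \<Longrightarrow> set_mset (l j) \<subseteq> V"
    and sqf: "\<And>j. j \<in> A \<Longrightarrow> squarefree_monomial (l j)"
    and I: "I = Idl\<^bsub>poly_ring V\<^esub> ((\<lambda>j. monomial (l j)) ` A)"
    and p: "p \<in> A" "p \<notin> K" and K: "K \<subseteq> A" "2 \<le> card K" and dvd: "l p \<subseteq># mlcm l K"
    and n: "n = (if Suc (card K) < card A then (card A choose 2) - (card A - card K + 1)
      else (card A choose 2) - 1)"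
  shows "proj_dim V (I \<cdot>\<^bsub>poly_ring V\<^esub> I) \<le> enat n"
proof -
  define R where "R = A - insert p K"
  let ?q = "card A"
  have finK: "finite K" using A K(1) by (rule rev_finite_subset)
  have sub: "insert p K \<subseteq> A" using p K by blast
  have cardR: "card R = ?q - Suc (card K)"
    unfolding R_def using p finK sub by (simp add: card_Diff_subset)
  have cardA: "Suc (card K) \<le> ?q" using card_mono[OF A sub] p finK by simp
  have q3: "3 \<le> ?q" using cardA K(2) by linarith
  \<comment> \<open>The competing sizes of sets outside all pairings: at most \<open>?q\<close> if a
    square occurs; otherwise all \<open>?q choose 2\<close> products if \<open>R\<close> is empty,
    and at least \<open>Suc (card R)\<close> fewer if it is not.\<close>
  have small: "?q \<le> Suc n" and R0: "R = {} \<Longrightarrow> (?q choose 2) \<le> Suc n"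
    and R1: "R \<noteq> {} \<Longrightarrow> (?q choose 2) - Suc (card R) \<le> Suc n"
  proof -
    have "finite R" using A by (simp add: R_def)
    then have "R = {} \<longleftrightarrow> card R = 0" by simp
    then have *: "R = {} \<longleftrightarrow> \<not> Suc (card K) < ?q"
      using cardR cardA by linarith
    show "?q \<le> Suc n"
    proof (cases "R = {}")
      case True
      then show ?thesis using * choose_two_ge[OF q3] by (simp add: n)
    next
      case False
      then have "4 \<le> ?q" using * K(2) by linarith
      then have "2 * ?q - 2 \<le> ?q choose 2" by (rule choose_two_ge_double)
      then show ?thesis using False * K(2) by (simp add: n)
    qed
    show "R = {} \<Longrightarrow> (?q choose 2) \<le> Suc n" using * by (simp add: n)
    show "R \<noteq> {} \<Longrightarrow> (?q choose 2) - Suc (card R) \<le> Suc n"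
      using * by (simp add: n cardR)
  qed
  have "proj_dim V (Idl\<^bsub>poly_ring V\<^esub> ((\<lambda>e. monomial (pair_sum l e)) ` sym_pairs A) :: ('x, 'k) mpoly set)
      \<le> enat n"
  proof (rule proj_dim_monomial_ideal_le[where T = "toggle_index A p R" and P = "toggle_cond K"
        and f = "\<lambda>t. pr (fst (snd t)) (snd (snd t))", OF finite_sym_pairs[OF A]])
    fix e assume "e \<in> sym_pairs A"
    then show "set_mset (pair_sum l e) \<subseteq> V"
      using V[of "fst e"] V[of "snd e"] by (auto simp: sym_pairs_def pair_sum_def)
  next
    have "toggle_index A p R \<subseteq> UNIV \<times> A \<times> A" using p(1) by (auto simp: toggle_index_def R_def)
    then show "finite (toggle_index A p R)" by (rule finite_subset) (use A in simp)
  next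
    fix t assume "t \<in> toggle_index A p R"
    then show "pr (fst (snd t)) (snd (snd t)) \<in> sym_pairs A"
      by (cases rule: toggle_index_cases) (use p(1) in \<open>auto intro!: pr_sym_pairs simp: R_def\<close>)
  next
    fix t and \<sigma> \<tau> :: "('a \<times> 'a) set"
    assume "t \<in> toggle_index A p R" "toggle_cond K t \<sigma>" "\<sigma> \<subseteq> \<tau>"
    then show "toggle_cond K t \<tau>"
      by (cases rule: toggle_index_cases) (auto simp: toggle_cond_simps)
  next
    fix t \<sigma> assume "t \<in> toggle_index A p R" "toggle_cond K t \<sigma>"
    then show "toggle_cond K t (\<sigma> - {pr (fst (snd t)) (snd (snd t))})"
      by (cases rule: toggle_index_cases) (use p in \<open>auto simp: toggle_cond_simps pr_eq_iff R_def\<close>)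
  next
    fix t \<sigma> assume "t \<in> toggle_index A p R" "\<sigma> \<subseteq> sym_pairs A" "toggle_cond K t \<sigma>"
    then show "pair_sum l (pr (fst (snd t)) (snd (snd t))) \<subseteq># mlcm (pair_sum l) \<sigma>"
      using toggle_cond_dvd[OF A sqf K(1) p(1) dvd] by blast
  next
    fix t t' \<sigma> assume "t \<in> toggle_index A p R" "toggle_cond K t \<sigma>" "t' \<in> toggle_index A p R" "t' < t"
      "toggle_cond K t' (insert (pr (fst (snd t)) (snd (snd t))) \<sigma>)"
    then show "\<exists>t'' \<in> toggle_index A p R. t'' < t \<and> toggle_cond K t'' \<sigma>"
      by (rule toggle_cond_first[OF K(1) p(2) K(2) p(1) R_def])
  next
    fix \<sigma> assume \<sigma>: "\<sigma> \<subseteq> sym_pairs A" "Suc n < card \<sigma>"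
    show "\<exists>t \<in> toggle_index A p R. toggle_cond K t \<sigma>"
    proof (rule ccontr)
      assume "\<not> ?thesis"
      then have none: "\<not> toggle_cond K t \<sigma>" if "t \<in> toggle_index A p R" for t using that by blast
      have "card \<sigma> \<le> Suc n"
      proof (cases "\<exists>i. (i, i) \<in> \<sigma>")
        case True
        then obtain i where i: "(i, i) \<in> \<sigma>" "i \<in> A" using \<sigma>(1) by (auto simp: sym_pairs_def)
        \<comment> \<open>Next to the square of \<open>i\<close>, a product not involving
          \<open>i\<close> would make a square pairing applicable.\<close>
        have "\<sigma> \<subseteq> pr i ` A"
        proof
          fix e assume e: "e \<in> \<sigma>"
          then obtain a b where ab: "e = (a, b)" "a \<in> A" "b \<in> A" "a \<le> b"
            using \<sigma>(1) by (auto simp: sym_pairs_def)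
          have "a = i \<or> b = i"
          proof (rule ccontr)
            assume "\<not> ?thesis"
            then have "(False, i, a) \<in> toggle_index A p R" "toggle_cond K (False, i, a) \<sigma>"
              using i e ab by (auto simp: toggle_index_def toggle_cond_simps pr_le)
            then show False using none by blast
          qed
          then have "e = pr i a \<or> e = pr i b" using ab by (auto simp: pr_def)
          then show "e \<in> pr i ` A" using ab by blast
        qed
        then have "card \<sigma> \<le> card (pr i ` A)" using A by (intro card_mono) auto
        also have "\<dots> \<le> ?q" using A by (rule card_image_le)
        finally show ?thesis using small by linarith
      next
        case False
        then have \<sigma>G: "\<sigma> \<subseteq> strict_pairs A"
          using \<sigma>(1) by (auto simp: sym_pairs_def strict_pairs_def order.strict_iff_order)
        have finG: "finite (strict_pairs A)"
          using A by (rule finite_strict_pairs)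
        have card: "card \<sigma> + card (strict_pairs A - \<sigma>) = ?q choose 2"
          using \<sigma>G finG card_Diff_subset[of \<sigma> "strict_pairs A"] card_mono[OF finG \<sigma>G]
          by (simp add: card_strict_pairs[OF A] finite_subset)
        show ?thesis
        proof (cases "R = {}")
          case True
          then show ?thesis using R0 card by linarith
        next
          case False
          then have "Suc (card R) \<le> card (strict_pairs A - \<sigma>)"
            using none by (intro card_missing_pairs[OF A K(1) p(2) K(2) p(1) R_def])
              (auto simp: toggle_index_def)
          then show ?thesis using R1[OF False] card by linarith
        qed
      qed
      then show False using \<sigma>(2) by simp
    qed
  qed
  then show ?thesis
    by (simp add: genideal_monomials_square[OF A V I] pair_sum_def)
qed

section \<open>The extremal ideal\<close>

lemma count_extremal_eps:
  "count (extremal_eps q s i) C = (if C \<in> extremal_Q q s \<and> i \<in> C then 1 else 0)"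
proof -
  have "finite {C \<in> extremal_Q q s. i \<in> C}"
    by (rule finite_subset[of _ "Pow {1..q}"]) (auto simp: extremal_Q_def)
  then show ?thesis by (simp add: extremal_eps_def)
qed

lemma set_mset_extremal_eps: "set_mset (extremal_eps q s i) \<subseteq> extremal_vars q"
proof
  fix C assume "C \<in># extremal_eps q s i"
  then have "count (extremal_eps q s i) C \<noteq> 0" by simp
  then show "C \<in> extremal_vars q"
    by (auto simp: count_extremal_eps extremal_Q_def extremal_vars_def split: if_splits)
qed

lemma extremal_eps_dvd:
  assumes "3 \<le> s"
  shows "extremal_eps q s 1 \<subseteq># mlcm (extremal_eps q s) {2..s}"
  by (subst subseteq_mlcm_iff) (auto simp: count_extremal_eps extremal_Q_def)

text \<open>Without 2, each remaining generator has a variable that no other remaining one has: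
  \<open>{1, 2}\<close> for 1 and \<open>{j}\<close> for \<open>j > 2\<close>. The variable
  \<open>{2}\<close> shows that generator 2 does not divide the least common multiple either, so the
  condition on cofacets is vacuous.\<close>

lemma proj_dim_extremal_ge:
  assumes s: "3 \<le> s" "s \<le> q"
  shows "enat (q - 2) \<le> proj_dim (extremal_vars q) (extremal_ideal q s :: (nat set, 'k::field) mpoly set)"
  unfolding extremal_ideal_def
proof (rule proj_dim_monomial_ideal_ge[where \<sigma> = "{1..q} - {2}"])
  let ?\<sigma> = "{1..q} - {2 :: nat}" and ?e = "extremal_eps q s"
  have not_dvd: "\<not> ?e j \<subseteq># mlcm ?e \<tau>"
    if "C \<in> extremal_Q q s" "j \<in> C" "finite \<tau>" "\<tau> \<inter> C = {}" for j C \<tau>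
    using that by (subst subseteq_mlcm_iff) (auto simp: count_extremal_eps intro!: exI[of _ C])
  show "\<not> ?e j \<subseteq># mlcm ?e (?\<sigma> - {j})" if j: "j \<in> ?\<sigma>" for j
  proof (cases "j = 1")
    case True
    then show ?thesis using s by (intro not_dvd[of "{1, 2}"]) (auto simp: extremal_Q_def)
  next
    case False
    then show ?thesis using j s by (intro not_dvd[of "{j}"]) (auto simp: extremal_Q_def)
  qed
  fix f assume f: "f \<in> {1..q} - ?\<sigma>" "?e f \<subseteq># mlcm ?e ?\<sigma>"
  have "\<not> ?e 2 \<subseteq># mlcm ?e ?\<sigma>" using s by (intro not_dvd[of "{2}"]) (auto simp: extremal_Q_def)
  with f show "\<exists>e \<in> ?\<sigma>. ?e e \<subseteq># mlcm ?e (insert f ?\<sigma> - {e}) \<and>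
      (\<forall>g \<in> {1..q} - (insert f ?\<sigma> - {e}). ?e g \<subseteq># mlcm ?e ?\<sigma> \<longrightarrow> g = e)" by auto
qed (use s set_mset_extremal_eps in \<open>auto simp: card_Diff_singleton\<close>)

section \<open>The square of the extremal ideal\<close>

lemma count_pair_sum_extremal:
  "count (pair_sum (extremal_eps q s) (i, j)) C =
    (if C \<in> extremal_Q q s then of_bool (i \<in> C) + of_bool (j \<in> C) else 0)"
  by (simp add: pair_sum_def count_extremal_eps)

lemma not_pair_dvd:
  assumes "finite \<tau>" "C \<in> extremal_Q q s" "0 < n" "n \<le> count (pair_sum (extremal_eps q s) e) C"
    "\<And>e'. e' \<in> \<tau> \<Longrightarrow> count (pair_sum (extremal_eps q s) e') C < n"
  shows "\<not> pair_sum (extremal_eps q s) e \<subseteq># mlcm (pair_sum (extremal_eps q s)) \<tau>"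
proof
  assume "pair_sum (extremal_eps q s) e \<subseteq># mlcm (pair_sum (extremal_eps q s)) \<tau>"
  then have "count (pair_sum (extremal_eps q s) e) C = 0 \<or>
      (\<exists>e' \<in> \<tau>. count (pair_sum (extremal_eps q s) e) C \<le> count (pair_sum (extremal_eps q s) e') C)"
    by (rule subseteq_mlcm_iff[OF assms(1), THEN iffD1, THEN spec])
  moreover have "count (pair_sum (extremal_eps q s) e) C \<noteq> 0" using assms(3,4) by linarith
  ultimately obtain e' where e': "e' \<in> \<tau>"
    "count (pair_sum (extremal_eps q s) e) C \<le> count (pair_sum (extremal_eps q s) e') C" by metis
  show False using assms(5)[OF e'(1)] e'(2) assms(4) by linarith
qed

text \<open>For \<open>q > s\<close> the set \<open>D\<close> of omitted products is an extreme case
  of the count in \<open>card_missing_pairs\<close>: \<open>h j = 2\<close> for every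
  \<open>j > s\<close>, with \<open>(1, 2)\<close> as the additional one. For \<open>q = s\<close>
  all products of distinct generators are kept; then the square of generator 1 is the only candidate
  for a cofacet, and it is dealt with by exchanging it for \<open>(1, 2)\<close>.\<close>

lemma proj_dim_extremal_square_ge:
  assumes s: "3 \<le> s" "s \<le> q"
    and I: "I = (extremal_ideal q s :: (nat set, 'k::field) mpoly set)"
  shows "enat (if q > s then (q choose 2) - (q - s + 2) else (q choose 2) - 1) \<le>
    proj_dim (extremal_vars q) (I \<cdot>\<^bsub>poly_ring (extremal_vars q)\<^esub> I)"
proof -
  let ?n = "if q > s then (q choose 2) - (q - s + 2) else (q choose 2) - 1"
  let ?A = "{1..q}" and ?p = "pair_sum (extremal_eps q s)"
  let ?B = "sym_pairs ?A" and ?G = "strict_pairs ?A"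
  have finG: "finite ?G" by (simp add: finite_strict_pairs)
  have cardG: "card ?G = q choose 2" by (simp add: card_strict_pairs)
  have choose: "q \<le> q choose 2" using s by (intro choose_two_ge) simp
  have "enat ?n \<le> proj_dim (extremal_vars q)
      (Idl\<^bsub>poly_ring (extremal_vars q)\<^esub> ((\<lambda>e. monomial (?p e)) ` ?B) :: (nat set, 'k) mpoly set)"
  proof (cases "s < q")
    case True
    text \<open>Here no generator divides the least common multiple of other elements of this set.\<close>
    define D :: "(nat \<times> nat) set" where "D = insert (1, 2) ((\<lambda>j. (2, j)) ` {s<..q})"
    have D: "D \<subseteq> ?G" using s True by (auto simp: D_def strict_pairs_def)
    have cardD: "card D = Suc (q - s)"
      unfolding D_def using s by (subst card_insert_disjoint) (auto simp: card_image inj_on_def)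
    have "card (?G - D) = card ?G - card D"
      using D finG by (intro card_Diff_subset) (auto intro: finite_subset)
    then have card: "card (?G - D) = (q choose 2) - Suc (q - s)"
      by (simp only: cardG cardD)
    have not_dvd: "\<not> ?p e \<subseteq># mlcm ?p (?G - D - {e})" if e: "e \<in> ?B" for e
    proof -
      obtain i j where ij: "e = (i, j)" "1 \<le> i" "i \<le> j" "j \<le> q"
        using e by (auto simp: sym_pairs_def)
      \<comment> \<open>Both factors of \<open>e\<close> contain \<open>C\<close>'s variable, giving
        exponent 2. Usually \<open>{i, j}\<close> will do, but \<open>{1}\<close> and
        \<open>{1, j}\<close> with \<open>j > s\<close> are not in \<open>extremal_Q q s\<close>.
        Adding 2 repairs this, and the new products \<open>(1, 2)\<close> and \<open>(2, j)\<close>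
        inside \<open>C\<close> were removed with \<open>D\<close>.\<close>
      define C where "C = (if i = 1 \<and> j = 1 then {1, 2} else if i = 1 \<and> s < j then {1, 2, j} else {i, j})"
      have C: "C \<in> extremal_Q q s" using ij s by (auto simp: C_def extremal_Q_def)
      show ?thesis
      proof (rule not_pair_dvd[OF _ C, of _ 2])
        show "2 \<le> count (?p e) C" using C by (auto simp: ij(1) count_pair_sum_extremal C_def)
        fix e' assume e': "e' \<in> ?G - D - {e}"
        obtain a b where e'_eq: "e' = (a, b)" by (cases e')
        have ab: "e' = (a, b)" "a < b" "\<not> (a = i \<and> b = j)" "b \<le> q" "\<not> (a = 1 \<and> b = 2)"
          "\<not> (a = 2 \<and> s < b)"
          using e' by (auto simp: e'_eq ij(1) strict_pairs_def D_def)
        have "\<not> (a \<in> C \<and> b \<in> C)" using ab ij s by (auto simp: C_def split: if_splits)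
        then show "count (?p e') C < 2" by (auto simp: ab(1) count_pair_sum_extremal)
      qed (use finG in auto)
    qed
    show ?thesis
    proof (rule proj_dim_monomial_ideal_ge[where \<sigma> = "?G - D"])
      show "?G - D \<subseteq> ?B" using strict_pairs_subset by blast
      show "card (?G - D) = Suc ?n" "?n \<noteq> 0"
        using card choose_two_ge_double[of q] True s by auto
      show "\<not> ?p e \<subseteq># mlcm ?p (?G - D - {e})" if "e \<in> ?G - D" for e
        using that strict_pairs_subset by (intro not_dvd) blast
      fix f assume f: "f \<in> ?B - (?G - D)" "?p f \<subseteq># mlcm ?p (?G - D)"
      then have "?G - D - {f} = ?G - D" by blast
      then show "\<exists>e \<in> ?G - D. ?p e \<subseteq># mlcm ?p (insert f (?G - D) - {e}) \<and>
          (\<forall>g \<in> ?B - (insert f (?G - D) - {e}). ?p g \<subseteq># mlcm ?p (?G - D) \<longrightarrow> g = e)"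
        using not_dvd[of f] f by auto
    qed (use set_mset_extremal_eps in \<open>auto simp: pair_sum_def\<close>)
  next
    case False
    then have qs: "q = s" using s by simp
    have sq: "\<not> ?p (i, i) \<subseteq># mlcm ?p ?G" if "2 \<le> i" "i \<le> q" for i
      using that finG by (intro not_pair_dvd[of _ "{i}" _ _ 2])
        (auto simp: extremal_Q_def count_pair_sum_extremal strict_pairs_def)
    show ?thesis
    proof (rule proj_dim_monomial_ideal_ge[where \<sigma> = ?G])
      show "?G \<subseteq> ?B" by (rule strict_pairs_subset)
      show "card ?G = Suc ?n" "?n \<noteq> 0" unfolding cardG using choose s by (auto simp: qs)
      show "\<not> ?p e \<subseteq># mlcm ?p (?G - {e})" if e: "e \<in> ?G" for e
      proof -
        obtain i j where ij: "e = (i, j)" "1 \<le> i" "i < j" "j \<le> q"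
          using e by (auto simp: strict_pairs_def)
        then have C: "{i, j} \<in> extremal_Q q s" using s qs by (auto simp: extremal_Q_def)
        show ?thesis
        proof (rule not_pair_dvd[OF _ C, of _ 2])
          show "2 \<le> count (?p e) {i, j}" using C by (simp add: ij(1) count_pair_sum_extremal)
          fix e' assume e': "e' \<in> ?G - {e}"
          obtain a b where e'_eq: "e' = (a, b)" by (cases e')
          have "a < b" "\<not> (a = i \<and> b = j)" using e' by (auto simp: e'_eq ij(1) strict_pairs_def)
          then have "\<not> (a \<in> {i, j} \<and> b \<in> {i, j})" using ij by auto
          then show "count (?p e') {i, j} < 2" by (auto simp: e'_eq count_pair_sum_extremal)
        qed (use finG in auto)
      qed
      fix f assume f: "f \<in> ?B - ?G" "?p f \<subseteq># mlcm ?p ?G"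
      then obtain i where "f = (i, i)" "1 \<le> i" "i \<le> q"
        using sym_pairs_diff_strict[of f ?A] by auto
      then have f1: "f = (1, 1)" using sq[of i] f(2) by (cases "i = 1") auto
      \<comment> \<open>The square relation again: \<open>m_1 m_2\<close> divides the least common
        multiple of \<open>m_1^2\<close> and \<open>m_2 m_3\<close>, where generator 3 exists
        because \<open>3 \<le> s\<close>.\<close>
      have "?p (1, 2) \<subseteq># mlcm ?p (insert (1, 1) ?G - {(1, 2)})"
      proof (subst subseteq_mlcm_iff)
        have "(2, 3) \<in> ?G" using s by (simp add: strict_pairs_def)
        then have "(1, 1) \<in> insert (1, 1) ?G - {(1, 2)}" "(2, 3) \<in> insert (1, 1) ?G - {(1, 2)}" by auto
        moreover have "count (?p (1, 2)) C \<le> count (?p (1, 1)) C \<or> count (?p (1, 2)) C \<le> count (?p (2, 3)) C" for C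
          by (auto simp: count_pair_sum_extremal)
        ultimately show "\<forall>C. count (?p (1, 2)) C = 0 \<or>
            (\<exists>e \<in> insert (1, 1) ?G - {(1, 2)}. count (?p (1, 2)) C \<le> count (?p e) C)" by blast
      qed (use finG in simp)
      moreover have "g = (1, 2)" if g: "g \<in> ?B - (insert f ?G - {(1, 2)})" "?p g \<subseteq># mlcm ?p ?G" for g
      proof (rule ccontr)
        assume "g \<noteq> (1, 2)"
        then have ne: "g \<in> ?B" "g \<notin> ?G" "g \<noteq> (1, 1)" using g(1) by (auto simp: f1)
        then obtain i where "g = (i, i)" "1 \<le> i" "i \<le> q"
          using sym_pairs_diff_strict[of g ?A] by auto
        then have "g = (i, i)" "2 \<le> i" "i \<le> q" using ne(3) by (cases "i = 1"; simp)+
        then show False using sq[of i] g(2) by simp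
      qed
      moreover have "(1, 2) \<in> ?G" using s by (simp add: strict_pairs_def)
      ultimately show "\<exists>e \<in> ?G. ?p e \<subseteq># mlcm ?p (insert f ?G - {e}) \<and>
          (\<forall>g \<in> ?B - (insert f ?G - {e}). ?p g \<subseteq># mlcm ?p ?G \<longrightarrow> g = e)"
        by (intro bexI[of _ "(1, 2)"]) (auto simp: f1)
    qed (use set_mset_extremal_eps in \<open>auto simp: pair_sum_def\<close>)
  qed
  also have "Idl\<^bsub>poly_ring (extremal_vars q)\<^esub> ((\<lambda>e. monomial (?p e)) ` ?B) =
      I \<cdot>\<^bsub>poly_ring (extremal_vars q)\<^esub> I"
    unfolding pair_sum_def
    by (rule genideal_monomials_square[symmetric])
      (use set_mset_extremal_eps in \<open>auto simp: I extremal_ideal_def\<close>)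
  finally show ?thesis .
qed

lemma monomial_carrierD:
  assumes "(monomial a :: ('x, 'k::field) mpoly) \<in> carrier (poly_ring V)"
  shows "set_mset a \<subseteq> V"
  using assms by (auto simp: monomial_def poly_ring_def)

theorem theoremB:
  shows
    "(\<forall>(V :: 'x set) (I :: ('x, 'k::field) mpoly set) (m :: nat \<Rightarrow> 'x multiset)
        (q :: nat) (s :: nat) (i :: nat \<Rightarrow> nat).
        finite V \<and>
        (\<forall>j \<in> {1..q}. squarefree_monomial (m j)) \<and>
        minimally_generated_by (poly_ring V) I q (\<lambda>j. monomial (m j)) \<and>
        3 \<le> s \<and> s \<le> q \<and>
        inj_on i {1..s} \<and> i ` {1..s} \<subseteq> {1..q} \<and>
        m (i 1) \<subseteq># Sup ((\<lambda>t. m (i t)) ` {2..s})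
        \<longrightarrow>
        proj_dim V I \<le> enat (q - 2) \<and>
        proj_dim V (I \<cdot>\<^bsub>poly_ring V\<^esub> I) \<le>
          enat (if q > s then (q choose 2) - (q - s + 2) else (q choose 2) - 1))
     \<and>
     (\<forall>(q :: nat) (s :: nat). 3 \<le> s \<and> s \<le> q \<longrightarrow>
        (let V = extremal_vars q; I = (extremal_ideal q s :: (nat set, 'k) mpoly set) in
          proj_dim V I = enat (q - 2) \<and>
          proj_dim V (I \<cdot>\<^bsub>poly_ring V\<^esub> I) =
            enat (if q > s then (q choose 2) - (q - s + 2) else (q choose 2) - 1)))"
proof (intro conjI allI impI)
  fix V :: "'x set" and I :: "('x, 'k) mpoly set" and m :: "nat \<Rightarrow> 'x multiset"
    and q s :: nat and i :: "nat \<Rightarrow> nat"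
  assume H: "finite V \<and> (\<forall>j \<in> {1..q}. squarefree_monomial (m j)) \<and>
    minimally_generated_by (poly_ring V) I q (\<lambda>j. monomial (m j)) \<and> 3 \<le> s \<and> s \<le> q \<and>
    inj_on i {1..s} \<and> i ` {1..s} \<subseteq> {1..q} \<and> m (i 1) \<subseteq># Sup ((\<lambda>t. m (i t)) ` {2..s})"
  let ?K = "i ` {2..s}"
  have s: "3 \<le> s" "s \<le> q" and inj: "inj_on i {1..s}" and sub: "i ` {1..s} \<subseteq> {1..q}"
    and sqf: "\<And>j. j \<in> {1..q} \<Longrightarrow> squarefree_monomial (m j)" using H by auto
  have gen: "minimally_generated_by (poly_ring V) I q (\<lambda>j. monomial (m j))" using H by auto
  then have I: "I = Idl\<^bsub>poly_ring V\<^esub> ((\<lambda>j. monomial (m j)) ` {1..q})"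
    by (simp add: minimally_generated_by_def)
  have V: "set_mset (m j) \<subseteq> V" if "j \<in> {1..q}" for j
  proof (rule monomial_carrierD)
    show "(monomial (m j) :: ('x, 'k) mpoly) \<in> carrier (poly_ring V)"
      using gen that by (auto simp: minimally_generated_by_def)
  qed
  have sub2: "{2..s} \<subseteq> {1..s}" by auto
  have one: "1 \<in> {1..s}" using s by simp
  have p: "i 1 \<in> {1..q}" using sub one by blast
  have pK: "i 1 \<notin> ?K" using inj_on_image_mem_iff[OF inj one sub2] by simp
  have K: "?K \<subseteq> {1..q}" using sub sub2 by blast
  have card: "card ?K = s - 1"
    using inj_on_subset[OF inj sub2] by (simp add: card_image)
  have dvd: "m (i 1) \<subseteq># mlcm m ?K" using H by (simp add: mlcm_def image_image)
  show "proj_dim V I \<le> enat (q - 2)"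
    unfolding I using proj_dim_le_card_minus_2[where A = "{1..q}", OF _ V p pK K dvd] by simp
  show "proj_dim V (I \<cdot>\<^bsub>poly_ring V\<^esub> I) \<le>
      enat (if q > s then (q choose 2) - (q - s + 2) else (q choose 2) - 1)"
    by (rule proj_dim_square_le[OF _ V sqf I p pK K _ dvd]) (use s in \<open>auto simp: card\<close>)
next
  fix q s :: nat
  assume s: "3 \<le> s \<and> s \<le> q"
  let ?I = "extremal_ideal q s :: (nat set, 'k) mpoly set" and ?V = "extremal_vars q"
  have dvd: "extremal_eps q s 1 \<subseteq># mlcm (extremal_eps q s) {2..s}"
    using s by (intro extremal_eps_dvd) simp
  have sqf: "squarefree_monomial (extremal_eps q s j)" for j
    by (simp add: squarefree_monomial_def count_extremal_eps)
  have "proj_dim ?V ?I \<le> enat (q - 2)"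
    unfolding extremal_ideal_def
    using proj_dim_le_card_minus_2[OF _ set_mset_extremal_eps _ _ _ dvd, of "{1..q}"] s by simp
  then have eq: "proj_dim ?V ?I = enat (q - 2)"
    by (rule order_class.order.antisym) (use s in \<open>simp add: proj_dim_extremal_ge\<close>)
  have "proj_dim ?V (?I \<cdot>\<^bsub>poly_ring ?V\<^esub> ?I) \<le>
      enat (if q > s then (q choose 2) - (q - s + 2) else (q choose 2) - 1)"
    by (rule proj_dim_square_le[OF _ set_mset_extremal_eps sqf extremal_ideal_def _ _ _ _ dvd])
      (use s in auto)
  then have "proj_dim ?V (?I \<cdot>\<^bsub>poly_ring ?V\<^esub> ?I) =
      enat (if q > s then (q choose 2) - (q - s + 2) else (q choose 2) - 1)"
    by (rule order_class.order.antisym) (use s in \<open>intro proj_dim_extremal_square_ge refl; simp\<close>)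
  with eq show "let V = ?V; I = ?I in proj_dim V I = enat (q - 2) \<and>
      proj_dim V (I \<cdot>\<^bsub>poly_ring V\<^esub> I) =
        enat (if q > s then (q choose 2) - (q - s + 2) else (q choose 2) - 1)"
    by (simp only: Let_def)
qed

end
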